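(* Let $\mu\in\mathcal M_+$ and, for $t\ge 1$, let $\mu^{\boxtimes t}$ denote its $t$-fold free multiplicative convolution power. (i) If $\mu\big((x,+\infty)\big)\sim L(\log x)/(\log x)^{\beta}$ for some $L\in\mathcal R_0$ and $\beta>0$, then for every $t\ge 1$ $$\mu^{\boxtimes t}\big((x,+\infty)\big)\sim t^{\beta}\,\mu\big((x,+\infty)\big).$$ (ii) If $\mu\big((x,+\infty)\big)\sim x^{-\alpha}L(x)$ with $\alpha\in(0,1)$ and $L\in\mathcal R_0$, then for every $t\ge1$ the function $x\mapsto\mu^{\boxtimes t}\big((x,+\infty)\big)$ belongs to $\mathcal R_{-\alpha_t}$, where $$\alpha_t=\frac{\alpha}{\alpha+t(1-\alpha)}.$$ In particular, if $\mu\big((x,+\infty)\big)\sim c/x^{\alpha}$ for some $\alpha\in(0,1)$ and $c>0$, then for every $t\ge1$ $$\mu^{\boxtimes t}\big((x,+\infty)\big)\sim \frac{c_{t,\alpha}}{x^{\alpha_t}},\qquad c_{t,\alpha}=\left(c\,\frac{\pi\alpha}{\sin(\pi\alpha)}\right)^{t/(\alpha+t(1-\alpha))}\frac{\sin(\pi\alpha_t)}{\pi\alpha_t}.$$ (iii) If $\mu\big((x,+\infty)\big)\sim c/x$ with $c>0$, then for every $t\ge1$ $$\mu^{\boxtimes t}\big((x,+\infty)\big)\sim c^{t-1}\,t\,(\log x)^{t-1}\,\mu\big((x,+\infty)\big).$$ (iv) If $\alpha\ge1$, $\mu\big((x,+\infty)\big)\sim x^{-\alpha}L(x)$ with $L\in\mathcal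 R_0$, and the first moment $m_1(\mu)=\int_{[0,+\infty)}s\,\mu(\mathrm ds)$ is finite, then for every $t\ge1$ $$\mu^{\boxtimes t}\big((x,+\infty)\big)\sim t\,m_1(\mu)^{\alpha(t-1)}\,\mu\big((x,+\infty)\big).$$
   Context: $\mathcal M_+$ is the set of Borel probability measures on $[0,+\infty)$. $f(x)\sim g(x)$ means $f(x)/g(x)\to1$ as $x\to+\infty$. For $\rho\in\mathbb R$, $\mathcal R_\rho$ is the class of regularly varying functions of index $\rho$: (positive, measurable) functions $f$ on a neighborhood of $+\infty$ with $f(\lambda x)/f(x)\to\lambda^\rho$ as $x\to+\infty$ for every $\lambda>0$; elements of $\mathcal R_0$ are called slowly varying. For $\mu\in\mathcal M_+$, $\mu\ne\delta_0$, put $\delta=\mu(\{0\})<1$ and $\psi_\mu(z)=\int_{[0,+\infty)}\frac{zt}{1-zt}\,\mu(\mathrm dt)$, $z<0$. The map $\psi_\mu:(-\infty,0)\to(\delta-1,0)$ is invertible with inverse $\chi_\mu$, and the $S$-transform is $S_\mu(z)=\frac{z+1}{z}\chi_\mu(z)$, $z\in(\delta-1,0)$. It is positive and determines $\mu$ uniquely. The free multiplicative convolution $\mu\boxtimes\nu\in\mathcal M_+$ satisfies $S_{\mu\boxtimes\nu}=S_\mu S_\nu$ on some interval $(-\varepsilon,0)$. For real $t\ge1$ the power $\mu^{\boxtimes t}\in\mathcal M_+$ (which exists, extending the integer powers) is the measure with $S_{\mu^{\boxtimes t}}=S_\mu^{\,t}$. *)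

theory Defs
  imports "HOL-Probability.Probability" "HOL-Library.Landau_Symbols"
begin

text \<open>Borel probability measures on \<open>[0, \<infinity>)\<close>, represented as Borel probability measures on the
  real line that are carried by \<open>[0, \<infinity>)\<close>.\<close>

definition M_plus :: "real measure set" where
  "M_plus = {\<mu>. real_distribution \<mu> \<and> measure \<mu> {0..} = 1}"

definition tail :: "real measure \<Rightarrow> real \<Rightarrow> real" where
  "tail \<mu> x = measure \<mu> {x<..}"

definition first_moment :: "real measure \<Rightarrow> real" where
  "first_moment \<mu> = (LINT s|\<mu>. s)"

definition regularly_varying :: "real \<Rightarrow> (real \<Rightarrow> real) \<Rightarrow> bool" where
  "regularly_varying \<rho> f \<longleftrightarrow>
     (\<exists>a. (\<forall>x>a. f x > 0) \<and> f \<in> borel_measurable (restrict_space borel {a<..})) \<and>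
     (\<forall>l>0. ((\<lambda>x. f (l * x) / f x) \<longlongrightarrow> l powr \<rho>) at_top)"

definition psi :: "real measure \<Rightarrow> real \<Rightarrow> real" where
  "psi \<mu> z = (LINT t|\<mu>. z * t / (1 - z * t))"

text \<open>For \<open>\<mu> \<in> M_plus\<close> other than the point mass at 0, \<open>psi \<mu>\<close> is a bijection from \<open>(-\<infinity>, 0)\<close> onto
  \<open>(\<mu>{0} - 1, 0)\<close>. Outside that interval, \<open>chi \<mu>\<close> and \<open>S_transform \<mu>\<close> have no meaning.\<close>

definition chi :: "real measure \<Rightarrow> real \<Rightarrow> real" where
  "chi \<mu> = the_inv_into {..<0} (psi \<mu>)"

definition S_transform :: "real measure \<Rightarrow> real \<Rightarrow> real" where
  "S_transform \<mu> z = (z + 1) / z * chi \<mu> z"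

text \<open>\<open>is_free_mult_power \<mu> t \<nu>\<close> says that \<open>\<nu>\<close> is the free multiplicative convolution power of \<open>\<mu>\<close>
  with exponent \<open>t\<close>. It is a relation because the existence of the power (for \<open>t \<ge> 1\<close>) is a theorem.
  Two S-transforms are compared on an interval \<open>(-\<epsilon>, 0)\<close> inside both of their domains; by
  analyticity this already determines \<open>\<nu>\<close>. The bounds on \<open>\<epsilon>\<close> exclude the point mass at 0, which has
  no S-transform, both for \<open>\<mu>\<close> and for \<open>\<nu>\<close>.\<close>

definition is_free_mult_power :: "real measure \<Rightarrow> real \<Rightarrow> real measure \<Rightarrow> bool" where
  "is_free_mult_power \<mu> t \<nu> \<longleftrightarrow>
     \<nu> \<in> M_plus \<and>
     (\<exists>\<epsilon>>0. \<epsilon> \<le> 1 - measure \<mu> {0} \<and> \<epsilon> \<le> 1 - measure \<nu> {0} \<and>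
       (\<forall>z\<in>{-\<epsilon><..<0}. S_transform \<nu> z = S_transform \<mu> z powr t))"

definition alpha_pow :: "real \<Rightarrow> real \<Rightarrow> real" where
  "alpha_pow \<alpha> t = \<alpha> / (\<alpha> + t * (1 - \<alpha>))"

definition c_pow :: "real \<Rightarrow> real \<Rightarrow> real \<Rightarrow> real" where
  "c_pow c \<alpha> t =
     (c * (pi * \<alpha> / sin (pi * \<alpha>))) powr (t / (\<alpha> + t * (1 - \<alpha>))) *
     (sin (pi * alpha_pow \<alpha> t) / (pi * alpha_pow \<alpha> t))"

end

theory Submission
  imports Defs
begin

text \<open>Substitute \<open>z = - 1 / x\<close> and write \<open>U x = \<integral> t / (t + x) \<mu>(dt)\<close>, which is \<open>- psi \<mu> z\<close>, and \<open>V\<close> for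
  the same function of the power \<open>\<nu>\<close>.  Both decrease to \<open>0\<close> at infinity, and the identity
  \<open>S_transform \<nu> = S_transform \<mu> powr t\<close> says that \<open>V (X x) = U x\<close> along an explicit curve,
  \<open>X x = x (x U x / (1 - U x)) powr (t - 1)\<close> (lemma \<open>stieltjes_power_curve\<close>).  The theorem thus
  follows from the asymptotics of this curve and a passage between tails and Stieltjes transforms.

  This passage uses the functions \<open>stieltjes n x = \<integral> (t / (t + x)) ^ n\<close>.  For an index \<open>\<alpha> < n\<close>, a
  regularly varying tail is asymptotic to a constant multiple of \<open>stieltjes n\<close>; this follows by
  dominated convergence (\<open>stieltjes_tail_ratio\<close>).  Conversely, if \<open>stieltjes n\<close> varies regularly,
  then all moments of the law of \<open>v = t / (t + x)\<close>, weighted by \<open>v ^ n\<close>, have limits that depend only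
  on the index.  Hence the tail is the same multiple of \<open>stieltjes n\<close> as for any other distribution
  with a tail of that index (\<open>Tauberian_comparison\<close>).

  For slowly varying tails and for indices in \<open>(0, 1)\<close>, take \<open>n = 1\<close>.  If the tail is regularly
  varying in \<open>ln x\<close>, then \<open>ln (X x) \<sim> t ln x\<close>, whence the factor \<open>t powr \<beta>\<close>.  For an index \<open>\<alpha>\<close> in \<open>(0, 1)\<close>
  the curve has index \<open>\<alpha> + t (1 - \<alpha>)\<close>, and \<open>V\<close>, which is \<open>U\<close> composed with the inverse of the curve, has
  index \<open>- alpha_pow \<alpha> t\<close>.

  For \<open>\<alpha> \<ge> 1\<close> the leading term of \<open>U\<close> no longer shows the tail, which first appears in the derivative
  of order \<open>n - 1\<close> of \<open>J s = \<integral> t / (1 + s t) \<mu>(dt)\<close>, where \<open>n - 1 \<le> \<alpha> < n\<close>; that derivative corresponds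
  to \<open>stieltjes n\<close>.  Differentiating the identity that relates \<open>J\<close> for \<open>\<mu>\<close> and for \<open>\<nu>\<close>, one finds that
  every term without the top derivative grows more slowly than any negative power of \<open>s\<close>
  (\<open>power_transform_derivatives\<close>).  What remains is a factor \<open>t\<close>: the quotient of \<open>stieltjes n\<close> of \<open>\<nu>\<close>
  at \<open>X x\<close> and of \<open>stieltjes n\<close> of \<open>\<mu>\<close> at \<open>x\<close> tends to \<open>t\<close> (\<open>stieltjes_power_ratio\<close>).  Finally
  \<open>X x / x\<close> tends to the power \<open>t - 1\<close> of the mean if that is finite, and is asymptotic to
  \<open>(c ln x) powr (t - 1)\<close> if the tail is \<open>c / x\<close>.\<close>

section \<open>Regular variation of monotone functions\<close>

text \<open>Regular variation at infinity as a bare limit condition.  The uniformity that measurability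
  brings in the general theory comes here from monotonicity.\<close>

definition varies :: "real \<Rightarrow> (real \<Rightarrow> real) \<Rightarrow> bool" where
  "varies \<rho> f \<longleftrightarrow> (\<forall>\<^sub>F x in at_top. 0 < f x) \<and>
     (\<forall>l>0. ((\<lambda>x. f (l * x) / f x) \<longlongrightarrow> l powr \<rho>) at_top)"

lemma variesD:
  assumes "varies \<rho> f"
  shows "\<forall>\<^sub>F x in at_top. 0 < f x"
    and "l > 0 \<Longrightarrow> ((\<lambda>x. f (l * x) / f x) \<longlongrightarrow> l powr \<rho>) at_top"
  using assms by (auto simp: varies_def)

lemma filterlim_const_mult_at_top:
  fixes l :: real
  assumes "l > 0"
  shows "filterlim (\<lambda>x. l * x) at_top at_top"
  by (rule filterlim_tendsto_pos_mult_at_top[OF tendsto_const assms filterlim_ident])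

lemma regularly_varying_imp_varies:
  assumes "regularly_varying \<rho> f"
  shows "varies \<rho> f"
proof -
  obtain a where "\<forall>x>a. f x > 0"
    using assms by (auto simp: regularly_varying_def)
  then have "\<forall>\<^sub>F x in at_top. f x > 0"
    by (metis eventually_at_top_dense)
  then show ?thesis
    using assms by (auto simp: varies_def regularly_varying_def)
qed

lemma eventually_pos_of_ratio:
  fixes f g :: "'a \<Rightarrow> real"
  assumes "\<forall>\<^sub>F x in F. 0 < f x" and "((\<lambda>x. g x / f x) \<longlongrightarrow> c) F" and "c > 0"
  shows "\<forall>\<^sub>F x in F. 0 < g x"
  using assms(1) order_tendstoD(1)[OF assms(2,3)]
  by eventually_elim (simp add: zero_less_divide_iff)

lemma varies_of_ratio:
  assumes f: "varies \<rho> f" and lim: "((\<lambda>x. g x / f x) \<longlongrightarrow> c) at_top" and c: "c > 0"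
  shows "varies \<rho> g"
proof -
  have pos: "\<forall>\<^sub>F x in at_top. 0 < g x"
    by (rule eventually_pos_of_ratio[OF variesD(1)[OF f] lim c])
  have "((\<lambda>x. g (l * x) / g x) \<longlongrightarrow> l powr \<rho>) at_top" if l: "l > 0" for l
  proof -
    note big = filterlim_const_mult_at_top[OF l]
    have "((\<lambda>x. (g (l * x) / f (l * x)) * (f (l * x) / f x) / (g x / f x))
            \<longlongrightarrow> c * (l powr \<rho>) / c) at_top"
      using c by (intro tendsto_intros filterlim_compose[OF lim big] variesD(2)[OF f l] lim) auto
    moreover have "\<forall>\<^sub>F x in at_top. (g (l * x) / f (l * x)) * (f (l * x) / f x) / (g x / f x)
                      = g (l * x) / g x"
      using pos variesD(1)[OF f]
        filterlim_compose[OF filterlim_ident big, THEN filterlim_iff[THEN iffD1],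
          rule_format, OF variesD(1)[OF f]]
      by eventually_elim (simp add: field_simps)
    ultimately show ?thesis
      using c by (auto intro: Lim_transform_eventually)
  qed
  with pos show ?thesis
    by (auto simp: varies_def)
qed

text \<open>A limit is pinned down by one-sided bounds \<open>a \<eta>\<close> and \<open>b \<eta>\<close> that are not sharp for a fixed
  parameter \<open>\<eta>\<close>, but become sharp when \<open>\<eta>\<close> tends to a critical value.  This is how monotonicity
  replaces uniform convergence throughout.\<close>

lemma tendsto_squeeze_family:
  fixes f :: "'a \<Rightarrow> real"
  assumes A: "A \<noteq> bot" "(a \<longlongrightarrow> L) A"
      "\<forall>\<^sub>F \<eta> in A. \<exists>g. (g \<longlongrightarrow> a \<eta>) F \<and> (\<forall>\<^sub>F x in F. g x \<le> f x)"
    and B: "B \<noteq> bot" "(b \<longlongrightarrow> L) B"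
      "\<forall>\<^sub>F \<eta> in B. \<exists>g. (g \<longlongrightarrow> b \<eta>) F \<and> (\<forall>\<^sub>F x in F. f x \<le> g x)"
  shows "(f \<longlongrightarrow> L) F"
proof (rule order_tendstoI)
  fix l assume "l < L"
  with A(2) have "\<forall>\<^sub>F \<eta> in A. l < a \<eta>"
    by (rule order_tendstoD)
  with A(3) have "\<forall>\<^sub>F \<eta> in A. l < a \<eta> \<and> (\<exists>g. (g \<longlongrightarrow> a \<eta>) F \<and> (\<forall>\<^sub>F x in F. g x \<le> f x))"
    by eventually_elim simp
  then obtain \<eta> g where g: "l < a \<eta>" "(g \<longlongrightarrow> a \<eta>) F" "\<forall>\<^sub>F x in F. g x \<le> f x"
    using A(1) eventually_happens' by blast
  show "\<forall>\<^sub>F x in F. l < f x"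
    using order_tendstoD(1)[OF g(2,1)] g(3) by eventually_elim simp
next
  fix u assume "L < u"
  with B(2) have "\<forall>\<^sub>F \<eta> in B. b \<eta> < u"
    by (rule order_tendstoD)
  with B(3) have "\<forall>\<^sub>F \<eta> in B. b \<eta> < u \<and> (\<exists>g. (g \<longlongrightarrow> b \<eta>) F \<and> (\<forall>\<^sub>F x in F. f x \<le> g x))"
    by eventually_elim simp
  then obtain \<eta> g where g: "b \<eta> < u" "(g \<longlongrightarrow> b \<eta>) F" "\<forall>\<^sub>F x in F. f x \<le> g x"
    using B(1) eventually_happens' by blast
  show "\<forall>\<^sub>F x in F. f x < u"
    using order_tendstoD(2)[OF g(2,1)] g(3) by eventually_elim simp
qed

text \<open>An argument asymptotic to \<open>\<kappa> x\<close> lies between \<open>\<eta> x\<close> for \<open>\<eta>\<close> slightly smaller and slightly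
  larger than \<open>\<kappa>\<close>, so monotonicity squeezes the ratio.\<close>

lemma varies_comp_ratio:
  fixes f Y :: "real \<Rightarrow> real"
  assumes mono: "\<And>x y. 0 < x \<Longrightarrow> x \<le> y \<Longrightarrow> f y \<le> f x"
    and f: "varies \<rho> f" and Y: "((\<lambda>x. Y x / x) \<longlongrightarrow> \<kappa>) at_top" and \<kappa>: "\<kappa> > 0"
  shows "((\<lambda>x. f (Y x) / f x) \<longlongrightarrow> \<kappa> powr \<rho>) at_top"
proof (rule tendsto_squeeze_family)
  show "at_right \<kappa> \<noteq> bot" "at_left \<kappa> \<noteq> bot"
    by simp_all
  show "((\<lambda>\<eta>. \<eta> powr \<rho>) \<longlongrightarrow> \<kappa> powr \<rho>) (at_right \<kappa>)" "((\<lambda>\<eta>. \<eta> powr \<rho>) \<longlongrightarrow> \<kappa> powr \<rho>) (at_left \<kappa>)"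
    using \<kappa> by (auto intro!: tendsto_intros)
  show "\<forall>\<^sub>F \<eta> in at_right \<kappa>. \<exists>g. (g \<longlongrightarrow> \<eta> powr \<rho>) at_top \<and> (\<forall>\<^sub>F x in at_top. g x \<le> f (Y x) / f x)"
    using eventually_at_right_less[of \<kappa>]
  proof eventually_elim
    case (elim \<eta>)
    have "\<forall>\<^sub>F x in at_top. f (\<eta> * x) / f x \<le> f (Y x) / f x"
      using order_tendstoD(2)[OF Y elim] order_tendstoD(1)[OF Y \<kappa>] eventually_gt_at_top[of 0]
        variesD(1)[OF f]
      by eventually_elim (auto intro!: divide_right_mono mono simp: field_simps zero_less_mult_iff)
    then show ?case
      using variesD(2)[OF f, of \<eta>] elim \<kappa> by auto
  qed
  show "\<forall>\<^sub>F \<eta> in at_left \<kappa>. \<exists>g. (g \<longlongrightarrow> \<eta> powr \<rho>) at_top \<and> (\<forall>\<^sub>F x in at_top. f (Y x) / f x \<le> g x)"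
    using eventually_at_left_real[OF \<kappa>]
  proof eventually_elim
    case (elim \<eta>)
    then have \<eta>: "0 < \<eta>" "\<eta> < \<kappa>" by auto
    have "\<forall>\<^sub>F x in at_top. f (Y x) / f x \<le> f (\<eta> * x) / f x"
      using order_tendstoD(1)[OF Y \<eta>(2)] eventually_gt_at_top[of 0] variesD(1)[OF f]
      by eventually_elim (use \<eta> in \<open>auto intro!: divide_right_mono mono simp: field_simps\<close>)
    then show ?case
      using variesD(2)[OF f, of \<eta>] \<eta> by auto
  qed
qed

text \<open>Potter-type bounds, obtained by iterating the ratio at \<open>l = 2\<close>.\<close>

lemma doubling_lower:
  fixes f :: "real \<Rightarrow> real"
  assumes mono: "\<And>x y. 0 < x \<Longrightarrow> x \<le> y \<Longrightarrow> f y \<le> f x"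
    and x0: "x0 > 0" and p: "p \<ge> 0" and pos: "\<And>x. x \<ge> x0 \<Longrightarrow> 0 < f x"
    and dbl: "\<And>x. x \<ge> x0 \<Longrightarrow> f x \<le> 2 powr p * f (2 * x)"
    and x: "x \<ge> x0" and l: "l \<ge> 1"
  shows "f x \<le> (2 * l) powr p * f (l * x)"
proof -
  have iter: "f x \<le> (2 powr p) ^ k * f (2 ^ k * x)" for k
  proof (induction k)
    case (Suc k)
    have "1 * x \<le> 2 ^ k * x"
      using x x0 by (intro mult_right_mono) auto
    then have "(2 powr p) ^ k * f (2 ^ k * x) \<le> (2 powr p) ^ k * (2 powr p * f (2 * (2 ^ k * x)))"
      using x by (intro mult_left_mono dbl) auto
    from order.trans[OF Suc this] show ?case
      by (simp add: mult_ac)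
  qed auto
  define k where "k = nat \<lceil>log 2 l\<rceil>"
  have k: "log 2 l \<le> k" "k \<le> log 2 l + 1"
    using l by (auto simp: k_def)
  have "l = 2 powr (log 2 l)"
    using l by simp
  also have "\<dots> \<le> 2 powr k"
    using k by (intro powr_mono) auto
  finally have le: "l \<le> 2 ^ k"
    by (simp add: powr_realpow)
  have "2 ^ k = 2 powr (real k)"
    by (simp add: powr_realpow)
  also have "\<dots> \<le> 2 powr (log 2 l + 1)"
    using k by (intro powr_mono) auto
  also have "\<dots> = 2 * l"
    using l by (simp add: powr_add)
  finally have ge: "2 ^ k \<le> 2 * l" .
  have "0 < l * x" "1 * x \<le> l * x"
    using l x x0 by (auto intro!: mult_right_mono)
  have "f x \<le> (2 powr p) ^ k * f (2 ^ k * x)"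
    by (rule iter)
  also have "(2 powr p) ^ k = (2 ^ k) powr p"
    by (simp add: powr_powr powr_realpow[symmetric] mult.commute)
  also have "(2 ^ k) powr p * f (2 ^ k * x) \<le> (2 * l) powr p * f (l * x)"
    using ge le l x x0 p \<open>0 < l * x\<close> \<open>1 * x \<le> l * x\<close>
    by (intro mult_mono powr_mono2 mono less_imp_le[OF pos]) (auto intro!: order.trans[OF x])
  finally show ?thesis .
qed

lemma doubling_upper:
  fixes f :: "real \<Rightarrow> real"
  assumes mono: "\<And>x y. 0 < x \<Longrightarrow> x \<le> y \<Longrightarrow> f y \<le> f x"
    and x0: "x0 > 0" and p: "p \<ge> 0" and pos: "\<And>x. x \<ge> x0 \<Longrightarrow> 0 < f x"
    and dbl: "\<And>x. x \<ge> x0 \<Longrightarrow> 2 powr p * f (2 * x) \<le> f x"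
    and x: "x \<ge> x0" and l: "l \<ge> 1"
  shows "(l / 2) powr p * f (l * x) \<le> f x"
proof -
  have iter: "(2 powr p) ^ k * f (2 ^ k * x) \<le> f x" for k
  proof (induction k)
    case (Suc k)
    have "1 * x \<le> 2 ^ k * x"
      using x x0 by (intro mult_right_mono) auto
    then have "(2 powr p) ^ k * (2 powr p * f (2 * (2 ^ k * x))) \<le> (2 powr p) ^ k * f (2 ^ k * x)"
      using x by (intro mult_left_mono dbl) auto
    from order.trans[OF this Suc] show ?case
      by (simp add: mult_ac)
  qed auto
  define k where "k = nat \<lfloor>log 2 l\<rfloor>"
  have k: "k \<le> log 2 l" "log 2 l \<le> k + 1"
    using l by (auto simp: k_def) linarith+
  have "2 ^ k = 2 powr (real k)"
    by (simp add: powr_realpow)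
  also have "\<dots> \<le> 2 powr (log 2 l)"
    using k by (intro powr_mono) auto
  also have "\<dots> = l"
    using l by simp
  finally have le: "2 ^ k \<le> l" .
  have "l = 2 powr (log 2 l)"
    using l by simp
  also have "\<dots> \<le> 2 powr (real k + 1)"
    using k by (intro powr_mono) auto
  finally have ge: "l / 2 \<le> 2 ^ k"
    by (simp add: powr_realpow powr_add)
  have xk: "0 < 2 ^ k * x" "1 * x \<le> l * x"
    using l x x0 by (auto intro!: mult_right_mono)
  have "(l / 2) powr p * f (l * x) \<le> (2 ^ k) powr p * f (2 ^ k * x)"
    using ge le l x x0 p xk
    by (intro mult_mono powr_mono2 mono less_imp_le[OF pos]) (auto intro!: order.trans[OF x])
  also have "(2 ^ k) powr p = (2 powr p) ^ k"
    by (simp add: powr_powr powr_realpow[symmetric] mult.commute)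
  finally show ?thesis
    using iter[of k] by simp
qed

lemma potter_lower:
  fixes f :: "real \<Rightarrow> real"
  assumes mono: "\<And>x y. 0 < x \<Longrightarrow> x \<le> y \<Longrightarrow> f y \<le> f x"
    and f: "varies (- \<alpha>) f" and \<alpha>: "\<alpha> \<ge> 0" and \<epsilon>: "\<epsilon> > 0"
  obtains x0 where "x0 > 0" "\<And>x. x \<ge> x0 \<Longrightarrow> 0 < f x"
    "\<And>x l. x \<ge> x0 \<Longrightarrow> l \<ge> 1 \<Longrightarrow> f x \<le> (2 * l) powr (\<alpha> + \<epsilon>) * f (l * x)"
proof -
  have "2 powr - (\<alpha> + \<epsilon>) < 2 powr - \<alpha>"
    using \<epsilon> by simp
  from order_tendstoD(1)[OF variesD(2)[OF f, of 2] this]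
  have "\<forall>\<^sub>F x in at_top. 2 powr - (\<alpha> + \<epsilon>) < f (2 * x) / f x"
    by simp
  with variesD(1)[OF f] eventually_gt_at_top[of 0]
  have "\<forall>\<^sub>F x in at_top. 0 < x \<and> 0 < f x \<and> f x \<le> 2 powr (\<alpha> + \<epsilon>) * f (2 * x)"
    unfolding powr_minus by eventually_elim (simp add: field_simps)
  then obtain x0 where "\<And>x. x \<ge> x0 \<Longrightarrow> 0 < x \<and> 0 < f x \<and> f x \<le> 2 powr (\<alpha> + \<epsilon>) * f (2 * x)"
    by (auto simp: eventually_at_top_linorder)
  then have x0: "x0 > 0" "\<And>x. x \<ge> x0 \<Longrightarrow> 0 < f x"
    "\<And>x. x \<ge> x0 \<Longrightarrow> f x \<le> 2 powr (\<alpha> + \<epsilon>) * f (2 * x)"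
    by auto
  show ?thesis
    using \<alpha> \<epsilon> by (intro that[OF x0(1,2)] doubling_lower[where f = f, OF mono x0(1) _ x0(2,3)]) auto
qed

lemma potter_upper:
  fixes f :: "real \<Rightarrow> real"
  assumes mono: "\<And>x y. 0 < x \<Longrightarrow> x \<le> y \<Longrightarrow> f y \<le> f x"
    and f: "varies (- \<alpha>) f" and \<epsilon>: "0 < \<epsilon>" "\<epsilon> \<le> \<alpha>"
  obtains x0 where "x0 > 0" "\<And>x. x \<ge> x0 \<Longrightarrow> 0 < f x"
    "\<And>x l. x \<ge> x0 \<Longrightarrow> l \<ge> 1 \<Longrightarrow> (l / 2) powr (\<alpha> - \<epsilon>) * f (l * x) \<le> f x"
proof -
  have "2 powr - \<alpha> < 2 powr - (\<alpha> - \<epsilon>)"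
    using \<epsilon> by simp
  from order_tendstoD(2)[OF variesD(2)[OF f, of 2] this]
  have "\<forall>\<^sub>F x in at_top. f (2 * x) / f x < 2 powr - (\<alpha> - \<epsilon>)"
    by simp
  with variesD(1)[OF f] eventually_gt_at_top[of 0]
  have "\<forall>\<^sub>F x in at_top. 0 < x \<and> 0 < f x \<and> 2 powr (\<alpha> - \<epsilon>) * f (2 * x) \<le> f x"
  proof eventually_elim
    case (elim x)
    then have "f (2 * x) < 2 powr - (\<alpha> - \<epsilon>) * f x"
      by (simp add: field_simps)
    then have "2 powr (\<alpha> - \<epsilon>) * f (2 * x) \<le> 2 powr (\<alpha> - \<epsilon>) * (2 powr - (\<alpha> - \<epsilon>) * f x)"
      by (intro mult_left_mono) auto
    also have "\<dots> = (2 powr (\<alpha> - \<epsilon>) * 2 powr - (\<alpha> - \<epsilon>)) * f x"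
      by (simp only: mult_ac)
    also have "2 powr (\<alpha> - \<epsilon>) * 2 powr - (\<alpha> - \<epsilon>) = (1::real)"
      by (simp flip: powr_add)
    finally show ?case
      using elim by simp
  qed
  then obtain x0 where "\<And>x. x \<ge> x0 \<Longrightarrow> 0 < x \<and> 0 < f x \<and> 2 powr (\<alpha> - \<epsilon>) * f (2 * x) \<le> f x"
    by (auto simp: eventually_at_top_linorder)
  then have x0: "x0 > 0" "\<And>x. x \<ge> x0 \<Longrightarrow> 0 < f x"
    "\<And>x. x \<ge> x0 \<Longrightarrow> 2 powr (\<alpha> - \<epsilon>) * f (2 * x) \<le> f x"
    by auto
  show ?thesis
    using \<epsilon> by (intro that[OF x0(1,2)] doubling_upper[where f = f, OF mono x0(1) _ x0(2,3)]) auto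
qed

lemma varies_powr_lower_bound:
  fixes f :: "real \<Rightarrow> real"
  assumes mono: "\<And>x y. 0 < x \<Longrightarrow> x \<le> y \<Longrightarrow> f y \<le> f x"
    and f: "varies (- \<alpha>) f" and \<alpha>: "\<alpha> \<ge> 0" and \<epsilon>: "\<epsilon> > 0"
  obtains c where "c > 0" "\<forall>\<^sub>F x in at_top. c * x powr - (\<alpha> + \<epsilon>) \<le> f x"
proof -
  obtain x0 where x0: "x0 > 0" "\<And>x. x \<ge> x0 \<Longrightarrow> 0 < f x"
    "\<And>x l. x \<ge> x0 \<Longrightarrow> l \<ge> 1 \<Longrightarrow> f x \<le> (2 * l) powr (\<alpha> + \<epsilon>) * f (l * x)"
    using potter_lower[OF mono f \<alpha> \<epsilon>] by blast
  define c where "c = f x0 * (x0 / 2) powr (\<alpha> + \<epsilon>)"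
  have "c * x powr - (\<alpha> + \<epsilon>) \<le> f x" if "x \<ge> x0" for x
  proof -
    have "f x0 \<le> (2 * (x / x0)) powr (\<alpha> + \<epsilon>) * f x"
      using x0(3)[of x0 "x / x0"] that x0(1) by simp
    then have "c * x powr - (\<alpha> + \<epsilon>) \<le>
        ((2 * (x / x0)) powr (\<alpha> + \<epsilon>) * f x) * (x0 / 2) powr (\<alpha> + \<epsilon>) * x powr - (\<alpha> + \<epsilon>)"
      unfolding c_def by (intro mult_right_mono) auto
    also have "\<dots> = f x"
      unfolding powr_minus using x0(1) that by (simp add: powr_mult powr_divide field_simps)
    finally show ?thesis .
  qed
  then have "\<forall>\<^sub>F x in at_top. c * x powr - (\<alpha> + \<epsilon>) \<le> f x"
    unfolding eventually_at_top_linorder by blast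
  moreover have "c > 0"
    using x0(1) x0(2)[of x0] by (simp add: c_def)
  ultimately show ?thesis
    using that by blast
qed

lemma varies_powr_upper_bound:
  fixes f :: "real \<Rightarrow> real"
  assumes mono: "\<And>x y. 0 < x \<Longrightarrow> x \<le> y \<Longrightarrow> f y \<le> f x"
    and f: "varies (- \<alpha>) f" and \<epsilon>: "0 < \<epsilon>" "\<epsilon> \<le> \<alpha>"
  obtains c where "\<forall>\<^sub>F x in at_top. f x \<le> c * x powr - (\<alpha> - \<epsilon>)"
proof -
  obtain x0 where x0: "x0 > 0" "\<And>x. x \<ge> x0 \<Longrightarrow> 0 < f x"
    "\<And>x l. x \<ge> x0 \<Longrightarrow> l \<ge> 1 \<Longrightarrow> (l / 2) powr (\<alpha> - \<epsilon>) * f (l * x) \<le> f x"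
    using potter_upper[OF mono f \<epsilon>] by blast
  have "f x \<le> (f x0 * (2 * x0) powr (\<alpha> - \<epsilon>)) * x powr - (\<alpha> - \<epsilon>)" if "x \<ge> x0" for x
  proof -
    have "((x / x0) / 2) powr (\<alpha> - \<epsilon>) * f x \<le> f x0"
      using x0(3)[of x0 "x / x0"] that x0(1) by simp
    then have "((x / x0) / 2) powr (\<alpha> - \<epsilon>) * f x * ((2 * x0) powr (\<alpha> - \<epsilon>) * x powr - (\<alpha> - \<epsilon>))
      \<le> f x0 * ((2 * x0) powr (\<alpha> - \<epsilon>) * x powr - (\<alpha> - \<epsilon>))"
      by (intro mult_right_mono) auto
    moreover have "((x / x0) / 2) powr (\<alpha> - \<epsilon>) * f x * ((2 * x0) powr (\<alpha> - \<epsilon>) * x powr - (\<alpha> - \<epsilon>)) = f x"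
      unfolding powr_minus using x0(1) that by (simp add: powr_mult powr_divide field_simps)
    ultimately show ?thesis
      by (simp only: mult_ac)
  qed
  then show ?thesis
    by (intro that) (unfold eventually_at_top_linorder, blast)
qed

text \<open>By the intermediate value theorem, a continuous curve tending to infinity takes every large
  value.  Hence limits may be computed along the curve.\<close>

lemma eventually_along_curve:
  fixes X :: "real \<Rightarrow> real"
  assumes cont: "continuous_on {a..} X" and lim: "filterlim X at_top at_top"
    and P: "\<forall>\<^sub>F x in at_top. P (X x)"
  shows "\<forall>\<^sub>F y in at_top. P y"
proof -
  obtain b where b: "b \<ge> a" "\<And>x. x \<ge> b \<Longrightarrow> P (X x)"
    using P by (auto simp: eventually_at_top_linorder) (meson max.cobounded1 max.bounded_iff)
  have "P y" if y: "y \<ge> X b" for y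
  proof -
    have "\<forall>\<^sub>F x in at_top. x \<ge> b \<and> y \<le> X x"
      using lim by (intro eventually_conj eventually_ge_at_top) (auto simp: filterlim_at_top)
    then obtain c where c: "b \<le> c" "y \<le> X c"
      using eventually_happens' trivial_limit_at_top_linorder by blast
    obtain x where "b \<le> x" "x \<le> c" "X x = y"
      using IVT'[of X b y c] y c b continuous_on_subset[OF cont, of "{b..c}"] by auto
    then show "P y"
      using b(2) by auto
  qed
  then show ?thesis
    by (auto simp: eventually_at_top_linorder)
qed

lemma tendsto_along_curve:
  fixes X :: "real \<Rightarrow> real" and f :: "real \<Rightarrow> real"
  assumes cont: "continuous_on {a..} X" and lim: "filterlim X at_top at_top"
    and f: "((\<lambda>x. f (X x)) \<longlongrightarrow> L) at_top"
  shows "(f \<longlongrightarrow> L) at_top"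
proof (rule topological_tendstoI)
  fix S assume "open S" "L \<in> S"
  from topological_tendstoD[OF f this]
  show "\<forall>\<^sub>F y in at_top. f y \<in> S"
    by (rule eventually_along_curve[OF cont lim])
qed

section \<open>The Stieltjes moments of a distribution on the half-line\<close>

locale half_line_distribution = real_distribution M for M :: "real measure" +
  assumes AE_nonneg: "AE t in M. 0 \<le> t"

lemma half_line_distribution_of_M_plus:
  assumes "\<mu> \<in> M_plus"
  shows "half_line_distribution \<mu>"
proof -
  interpret real_distribution \<mu>
    using assms by (simp add: M_plus_def)
  have "AE t in \<mu>. t \<in> {0..}"
    using assms by (subst AE_in_set_eq_1) (auto simp: M_plus_def)
  then show ?thesis
    by unfold_locales auto
qed

text \<open>With \<open>s = 1 / x\<close>, the case \<open>n = 1\<close> is \<open>- \<psi>(- s)\<close>.  The powers \<open>n \<ge> 2\<close> correspond, up to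
  constants and powers of \<open>x\<close>, to derivatives of \<open>- \<psi>(- s) / s\<close>; they show tails of index below \<open>n\<close>.\<close>

definition stieltjes :: "real measure \<Rightarrow> nat \<Rightarrow> real \<Rightarrow> real" where
  "stieltjes \<mu> n x = (LINT t|\<mu>. (t / (t + x)) ^ n)"

lemma kernel_bounds:
  fixes t x :: real
  assumes "0 \<le> t" "0 < x"
  shows "0 \<le> t / (t + x)" "t / (t + x) < 1" "t / (t + x) \<le> 1"
  using assms by (auto simp: field_simps)

context half_line_distribution
begin

lemma kernel_measurable [measurable]: "(\<lambda>t. (t / (t + x)) ^ n) \<in> borel_measurable M"
  by simp

lemma kernel_integrable:
  assumes "0 < x"
  shows "integrable M (\<lambda>t. (t / (t + x)) ^ n)"
proof (rule integrable_const_bound[where B = 1])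
  show "AE t in M. norm ((t / (t + x)) ^ n) \<le> 1"
    using AE_nonneg by eventually_elim (use assms in \<open>simp add: power_le_one kernel_bounds abs_of_nonneg\<close>)
qed simp

lemma stieltjes_nonneg: "0 < x \<Longrightarrow> 0 \<le> stieltjes M n x"
  unfolding stieltjes_def using AE_nonneg
  by (intro integral_nonneg_AE) (auto elim!: eventually_mono simp: kernel_bounds)

lemma stieltjes_antimono:
  assumes "0 < x" "x \<le> y"
  shows "stieltjes M n y \<le> stieltjes M n x"
  unfolding stieltjes_def
proof (rule integral_mono_AE[OF kernel_integrable kernel_integrable])
  show "AE t in M. (t / (t + y)) ^ n \<le> (t / (t + x)) ^ n"
    using AE_nonneg by eventually_elim (use assms in \<open>auto intro!: power_mono divide_left_mono simp: add_pos_nonneg add_nonneg_pos\<close>)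
qed (use assms in auto)

lemma stieltjes_power_antimono:
  assumes "0 < x" "m \<le> n"
  shows "stieltjes M n x \<le> stieltjes M m x"
  unfolding stieltjes_def
proof (rule integral_mono_AE[OF kernel_integrable kernel_integrable])
  show "AE t in M. (t / (t + x)) ^ n \<le> (t / (t + x)) ^ m"
    using AE_nonneg by eventually_elim (use assms in \<open>auto intro!: power_decreasing simp: kernel_bounds\<close>)
qed (use assms in auto)

lemma stieltjes_le_1: "0 < x \<Longrightarrow> stieltjes M n x \<le> 1"
  using stieltjes_power_antimono[of x 0 n] prob_space by (simp add: stieltjes_def)

lemma tail_antimono: "x \<le> y \<Longrightarrow> tail M y \<le> tail M x"
  unfolding tail_def by (intro finite_measure_mono) auto

lemma tail_nonneg: "0 \<le> tail M x"
  by (simp add: tail_def)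

lemma tail_le_1: "tail M x \<le> 1"
  by (simp add: tail_def)

lemma tail_measurable [measurable]: "tail M \<in> borel_measurable borel"
proof -
  have "(\<lambda>x. - tail M x) \<in> borel_measurable borel"
    by (intro borel_measurable_mono monoI) (simp add: tail_antimono)
  then show ?thesis
    using borel_measurable_uminus_eq by blast
qed

lemma stieltjes_pos:
  assumes "measure M {0} < 1" "0 < x"
  shows "0 < stieltjes M n x"
proof (rule ccontr)
  assume "\<not> 0 < stieltjes M n x"
  then have "integral\<^sup>L M (\<lambda>t. (t / (t + x)) ^ n) = 0"
    using stieltjes_nonneg[of x n] assms(2) by (simp add: stieltjes_def)
  moreover have "AE t in M. 0 \<le> (t / (t + x)) ^ n"
    using AE_nonneg by eventually_elim (use assms in \<open>simp add: kernel_bounds\<close>)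
  ultimately have "AE t in M. (t / (t + x)) ^ n = 0"
    using kernel_integrable[OF assms(2), of n] by (subst (asm) integral_nonneg_eq_0_iff_AE) auto
  then have "AE t in M. t \<in> {0}"
    using AE_nonneg by eventually_elim (use assms in auto)
  then show False
    using assms(1) by (subst (asm) AE_in_set_eq_1) auto
qed

lemma stieltjes_tendsto_0:
  assumes "0 < n"
  shows "(stieltjes M n \<longlongrightarrow> 0) at_top"
proof -
  \<comment> \<open>The maxima make the domination hold for all \<open>t\<close> and \<open>x\<close>; they are invisible when \<open>t \<ge> 0\<close>, \<open>x \<ge> 1\<close>.\<close>
  have "((\<lambda>x. LINT t|M. (max 0 t / (max 0 t + max 1 x)) ^ n) \<longlongrightarrow> (LINT t|M. 0)) at_top"
  proof (rule integral_dominated_convergence_at_top[where w = "\<lambda>_. 1"])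
    have "((\<lambda>x. (max 0 t / (max 0 t + max 1 x)) ^ n) \<longlongrightarrow> 0 ^ n) at_top" for t :: real
      by (intro tendsto_power tendsto_divide_0[OF tendsto_const] filterlim_at_top_imp_at_infinity
          filterlim_tendsto_add_at_top[OF tendsto_const])
        (auto simp: filterlim_at_top intro: eventually_mono[OF eventually_ge_at_top] max.coboundedI2)
    then show "AE t in M. ((\<lambda>x. (max 0 t / (max 0 t + max 1 x)) ^ n) \<longlongrightarrow> 0) at_top"
      using assms by (intro AE_I2) (metis zero_power)
    show "\<forall>\<^sub>F x in at_top. AE t in M. norm ((max 0 t / (max 0 t + max 1 x)) ^ n) \<le> (1::real)"
      by (intro always_eventually allI AE_I2) (auto intro!: power_le_one simp: abs_of_nonneg)
  qed auto
  moreover have "\<forall>\<^sub>F x in at_top. (LINT t|M. (max 0 t / (max 0 t + max 1 x)) ^ n) = stieltjes M n x"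
    using eventually_ge_at_top[of 1]
  proof eventually_elim
    case (elim x)
    show ?case
      unfolding stieltjes_def by (intro integral_cong_AE) (use AE_nonneg elim in \<open>auto elim!: eventually_mono\<close>)
  qed
  ultimately show ?thesis
    by (auto intro: Lim_transform_eventually)
qed

text \<open>The layer-cake formula for the random variable \<open>t / (t + x)\<close>, whose level set above
  \<open>v \<in> (0, 1)\<close> is \<open>t > x v / (1 - v)\<close>.\<close>

lemma stieltjes_layer_cake:
  assumes x: "0 < x" and n: "0 < n"
  shows "stieltjes M n x =
    (LINT v|lborel. indicator {0<..<1} v * (real n * v ^ (n - 1) * tail M (x * v / (1 - v))))"
proof -
  interpret P: pair_sigma_finite M lborel ..
  define h :: "real \<Rightarrow> real \<Rightarrow> ennreal" where
    "h = (\<lambda>t (v::real). ennreal (indicator {0<..<1} v * (real n * v ^ (n - 1))) * (if x * v / (1 - v) < t then 1 else 0))"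
  have [measurable]: "case_prod h \<in> borel_measurable (M \<Otimes>\<^sub>M lborel)"
    unfolding h_def by measurable
  have inner: "(\<integral>\<^sup>+v. h t v \<partial>lborel) = ennreal ((t / (t + x)) ^ n)" if t: "0 \<le> t" for t
  proof -
    define V where "V = t / (t + x)"
    have V: "0 \<le> V" "V < 1"
      using kernel_bounds[OF t x] by (auto simp: V_def)
    have eq: "h t v = ennreal (real n * v ^ (n - 1)) * indicator {0..V} v" if "v \<notin> {0, V}" for v
    proof (cases "0 < v \<and> v < 1")
      case True
      then have "x * v / (1 - v) < t \<longleftrightarrow> v < V"
        using x t by (simp add: V_def field_simps)
      then show ?thesis
        using True that by (auto simp: h_def indicator_def)
    next
      case False
      then show ?thesis
        using V that by (auto simp: h_def indicator_def)
    qed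
    have "AE v in lborel. v \<notin> {0, V}"
      by (intro AE_not_in countable_imp_null_set_lborel) auto
    then have "(\<integral>\<^sup>+v. h t v \<partial>lborel) = (\<integral>\<^sup>+v. ennreal (real n * v ^ (n - 1)) * indicator {0..V} v \<partial>lborel)"
      by (intro nn_integral_cong_AE) (erule eventually_mono, rule eq)
    also have "\<dots> = V ^ n - 0 ^ n"
      using V n by (intro nn_integral_FTC_Icc) (auto intro!: derivative_eq_intros)
    finally show ?thesis
      using n by (simp add: V_def zero_power)
  qed
  have outer: "(\<integral>\<^sup>+t. h t v \<partial>M) =
      ennreal (indicator {0<..<1} v * (real n * v ^ (n - 1) * tail M (x * v / (1 - v))))" for v
  proof -
    have "(\<integral>\<^sup>+t. h t v \<partial>M) = (\<integral>\<^sup>+t. ennreal (indicator {0<..<1} v * (real n * v ^ (n - 1))) *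
        indicator {x * v / (1 - v)<..} t \<partial>M)"
      by (intro nn_integral_cong) (auto simp: h_def indicator_def)
    also have "\<dots> = ennreal (indicator {0<..<1} v * (real n * v ^ (n - 1))) * emeasure M {x * v / (1 - v)<..}"
      by (intro nn_integral_cmult_indicator) auto
    also have "\<dots> = ennreal ((indicator {0<..<1} v * (real n * v ^ (n - 1))) * tail M (x * v / (1 - v)))"
      by (simp add: emeasure_eq_measure tail_def ennreal_mult'' del: ennreal_mult)
    finally show ?thesis
      by (simp add: mult_ac)
  qed
  have "ennreal (stieltjes M n x) = (\<integral>\<^sup>+t. ennreal ((t / (t + x)) ^ n) \<partial>M)"
    unfolding stieltjes_def using AE_nonneg x
    by (intro nn_integral_eq_integral[symmetric] kernel_integrable)
      (auto elim!: eventually_mono simp: kernel_bounds)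
  also have "\<dots> = (\<integral>\<^sup>+t. \<integral>\<^sup>+v. h t v \<partial>lborel \<partial>M)"
    by (intro nn_integral_cong_AE) (use AE_nonneg in \<open>auto elim!: eventually_mono simp: inner\<close>)
  also have "\<dots> = (\<integral>\<^sup>+v. \<integral>\<^sup>+t. h t v \<partial>M \<partial>lborel)"
    by (intro P.Fubini'[symmetric]) simp
  also have "\<dots> = (\<integral>\<^sup>+v. ennreal (indicator {0<..<1} v * (real n * v ^ (n - 1) * tail M (x * v / (1 - v)))) \<partial>lborel)"
    by (simp add: outer)
  finally have *: "(\<integral>\<^sup>+v. ennreal (indicator {0<..<1} v * (real n * v ^ (n - 1) * tail M (x * v / (1 - v)))) \<partial>lborel)
      = ennreal (stieltjes M n x)" by simp
  have "has_bochner_integral lborel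
      (\<lambda>v. indicator {0<..<1} v * (real n * v ^ (n - 1) * tail M (x * v / (1 - v)))) (stieltjes M n x)"
    using * stieltjes_nonneg[OF x, of n] tail_nonneg
    by (intro has_bochner_integral_nn_integral) (auto simp: indicator_def)
  then show ?thesis
    by (simp add: has_bochner_integral_iff)
qed

end

lemma has_bochner_integral_Beta:
  fixes a b :: real
  assumes "0 < a" "0 < b"
  shows "has_bochner_integral lborel
    (\<lambda>v. indicator {0<..<1} v * (v powr (a - 1) * (1 - v) powr (b - 1))) (Beta a b)"
proof (rule has_bochner_integral_nn_integral)
  have "((\<lambda>v. v powr (a - 1) * (1 - v) powr (b - 1)) has_integral Beta a b) {0<..<1}"
    using has_integral_Beta_real[OF assms] by (simp add: has_integral_Icc_iff_Ioo)
  then have "((\<lambda>v. if v \<in> {0<..<1} then v powr (a - 1) * (1 - v) powr (b - 1) else 0)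
      has_integral Beta a b) UNIV"
    by (subst has_integral_restrict_UNIV)
  then have "((\<lambda>v. indicator {0<..<1} v * (v powr (a - 1) * (1 - v) powr (b - 1)))
      has_integral Beta a b) UNIV"
    by (rule has_integral_eq[rotated]) (auto simp: indicator_def)
  then show "(\<integral>\<^sup>+v. ennreal (indicator {0<..<1} v * (v powr (a - 1) * (1 - v) powr (b - 1))) \<partial>lborel) = Beta a b"
    by (intro nn_integral_has_integral_lborel) (auto simp: indicator_def)
  show "0 \<le> Beta a b"
    using assms by (simp add: Beta_def Gamma_real_nonneg)
qed (auto simp: indicator_def)

context half_line_distribution
begin

text \<open>The Abelian theorem.  In the layer-cake formula the integrand divided by \<open>tail M x\<close> converges
  to that of a Beta integral.  It is dominated because \<open>v / (1 - v) \<ge> v\<close> and, by the Potter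
  bound, \<open>tail M (v x) / tail M x\<close> is at most a constant times \<open>v\<close> to a power above \<open>- n\<close>.\<close>

theorem stieltjes_tail_ratio:
  assumes tail: "varies (- \<alpha>) (tail M)" and \<alpha>: "0 \<le> \<alpha>" "\<alpha> < n"
  shows "((\<lambda>x. stieltjes M n x / tail M x) \<longlongrightarrow> n * Beta (n - \<alpha>) (1 + \<alpha>)) at_top"
proof -
  have n: "0 < n" using \<alpha> by (cases n) auto
  define p where "p = \<alpha> + (n - \<alpha>) / 2"
  have p: "0 < p" "p < n"
    using \<alpha> n by (auto simp: p_def field_simps)
  obtain x0 where x0: "x0 > 0" "\<And>x. x \<ge> x0 \<Longrightarrow> 0 < tail M x"
    "\<And>x l. x \<ge> x0 \<Longrightarrow> l \<ge> 1 \<Longrightarrow> tail M x \<le> (2 * l) powr p * tail M (l * x)"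
    using potter_lower[of "tail M" \<alpha> "(n - \<alpha>) / 2", OF tail_antimono tail] \<alpha> unfolding p_def by auto
  define K where "K = 1 / tail M x0"
  have K: "1 \<le> K"
    using x0(2)[of x0] tail_le_1 by (simp add: K_def field_simps)
  \<comment> \<open>Below \<open>x0\<close>, where the Potter bound is not available, the tail is at most \<open>1 = K tail M x0\<close>.\<close>
  have dom: "tail M (x * v / (1 - v)) / tail M x \<le> K * (2 / v) powr p"
    if x: "x \<ge> x0" and v: "0 < v" "v < 1" for x v
  proof -
    have xpos: "0 < x" using x x0(1) by simp
    have pos: "0 < tail M x" by (rule x0(2)[OF x])
    have "x * v * (1 - v) \<le> x * v"
      using v xpos by (simp add: mult_le_cancel_left1)
    then have "x * v \<le> x * v / (1 - v)"
      using v by (simp add: field_simps)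
    then have 1: "tail M (x * v / (1 - v)) \<le> tail M (x * v)"
      by (rule tail_antimono)
    also have "tail M (x * v) \<le> K * (2 / v) powr p * tail M x"
    proof (cases "x * v \<ge> x0")
      case True
      have "tail M (x * v) \<le> (2 * (1 / v)) powr p * tail M (1 / v * (x * v))"
        using v by (intro x0(3)[OF True]) (simp add: field_simps)
      also have "\<dots> = 1 * ((2 / v) powr p * tail M x)"
        using v by simp
      also have "\<dots> \<le> K * ((2 / v) powr p * tail M x)"
        using K pos by (intro mult_right_mono) auto
      finally show ?thesis by (simp add: mult_ac)
    next
      case False
      then have le: "x / x0 \<le> 1 / v"
        using v x0(1) by (simp add: field_simps)
      have "tail M x0 \<le> (2 * (x / x0)) powr p * tail M (x / x0 * x0)"
        using x x0(1) by (intro x0(3)) auto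
      also have "\<dots> \<le> (2 / v) powr p * tail M x"
        using le x0(1) xpos p pos by (auto intro!: mult_right_mono powr_mono2)
      finally have "1 \<le> K * (2 / v) powr p * tail M x"
        using x0(2)[of x0] by (simp add: K_def field_simps)
      then show ?thesis
        using tail_le_1[of "x * v"] by simp
    qed
    finally show ?thesis
      using pos by (simp add: field_simps)
  qed
  define s where "s = (\<lambda>x (v::real). indicator {0<..<1} v * (real n * v ^ (n - 1) * (tail M (x * v / (1 - v)) / tail M x)))"
  define w where "w = (\<lambda>v::real. n * K * 2 powr p * (indicator {0<..<1} v * (v powr ((n - p) - 1) * (1 - v) powr (1 - 1))))"
  have powr_n: "v ^ (n - 1) = v powr (real n - 1)" if "0 < v" for v :: real
    using that n by (simp add: powr_realpow[symmetric] of_nat_diff)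
  have "((\<lambda>x. LINT v|lborel. s x v) \<longlongrightarrow>
      (LINT v|lborel. real n * (indicator {0<..<1} v * (v powr ((n - \<alpha>) - 1) * (1 - v) powr ((1 + \<alpha>) - 1))))) at_top"
  proof (rule integral_dominated_convergence_at_top[where w = w])
    show "integrable lborel w"
      unfolding w_def using has_bochner_integral_Beta[of "n - p" 1] p
      by (intro integrable_mult_right) (simp add: has_bochner_integral_iff)
    show "\<forall>\<^sub>F x in at_top. AE v in lborel. norm (s x v) \<le> w v"
      using eventually_ge_at_top[of x0]
    proof eventually_elim
      case (elim x)
      have "norm (s x v) \<le> w v" for v
      proof (cases "0 < v \<and> v < 1")
        case True
        have "norm (s x v) = real n * v ^ (n - 1) * (tail M (x * v / (1 - v)) / tail M x)"
          using True tail_nonneg by (simp add: s_def)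
        also have "\<dots> \<le> n * v ^ (n - 1) * (K * (2 / v) powr p)"
          using True elim by (intro mult_left_mono dom) auto
        also have "v ^ (n - 1) * (2 / v) powr p = 2 powr p * v powr ((n - p) - 1)"
          using True unfolding powr_n[OF True[THEN conjunct1]]
          by (simp add: powr_divide powr_diff powr_add field_simps)
        then have "real n * v ^ (n - 1) * (K * (2 / v) powr p) = w v"
          using True by (simp add: w_def mult_ac)
        finally show ?thesis .
      qed (auto simp: s_def w_def indicator_def)
      then show ?case by simp
    qed
    have "((\<lambda>x. s x v) \<longlongrightarrow> real n * (indicator {0<..<1} v * (v powr ((n - \<alpha>) - 1) * (1 - v) powr ((1 + \<alpha>) - 1)))) at_top" for v
    proof (cases "0 < v \<and> v < 1")
      case True
      have "((\<lambda>x. n * v ^ (n - 1) * (tail M (v / (1 - v) * x) / tail M x)) \<longlongrightarrow>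
          n * v ^ (n - 1) * (v / (1 - v)) powr (- \<alpha>)) at_top"
        using True by (intro tendsto_intros variesD(2)[OF tail]) auto
      also have "n * v ^ (n - 1) * (v / (1 - v)) powr (- \<alpha>) =
          n * (v powr ((n - \<alpha>) - 1) * (1 - v) powr ((1 + \<alpha>) - 1))"
        using True unfolding powr_n[OF True[THEN conjunct1]]
        by (simp add: powr_divide powr_diff powr_minus powr_add field_simps)
      finally show ?thesis
        using True by (simp add: s_def mult.commute)
    qed (auto simp: s_def)
    then show "AE v in lborel. ((\<lambda>x. s x v) \<longlongrightarrow>
        real n * (indicator {0<..<1} v * (v powr ((n - \<alpha>) - 1) * (1 - v) powr ((1 + \<alpha>) - 1)))) at_top"
      by simp
  qed (auto simp: s_def)
  also have "(LINT v|lborel. real n * (indicator {0<..<1} v * (v powr ((n - \<alpha>) - 1) * (1 - v) powr ((1 + \<alpha>) - 1)))) =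
      n * Beta (n - \<alpha>) (1 + \<alpha>)"
    using has_bochner_integral_Beta[of "n - \<alpha>" "1 + \<alpha>"] \<alpha> by (simp add: has_bochner_integral_iff)
  finally have lim: "((\<lambda>x. LINT v|lborel. s x v) \<longlongrightarrow> real n * Beta (n - \<alpha>) (1 + \<alpha>)) at_top" .
  have "\<forall>\<^sub>F x in at_top. (LINT v|lborel. s x v) = stieltjes M n x / tail M x"
    using eventually_gt_at_top[of 0]
  proof eventually_elim
    case (elim x)
    have "(LINT v|lborel. s x v) = (LINT v|lborel. indicator {0<..<1} v *
        (real n * v ^ (n - 1) * tail M (x * v / (1 - v))) / tail M x)"
      by (simp add: s_def)
    then show ?case
      unfolding integral_divide_zero stieltjes_layer_cake[OF elim n] .
  qed
  then show ?thesis
    by (rule Lim_transform_eventually[OF lim])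
qed

lemma Abelian_constant_pos:
  assumes "0 \<le> \<alpha>" "\<alpha> < n"
  shows "0 < real n * Beta (n - \<alpha>) (1 + \<alpha>)"
  using assms by (auto simp: Beta_def intro!: mult_pos_pos divide_pos_pos Gamma_real_pos)

lemma varies_stieltjes_of_tail:
  assumes "varies (- \<alpha>) (tail M)" "0 \<le> \<alpha>" "\<alpha> < n"
  shows "varies (- \<alpha>) (stieltjes M n)"
  using varies_of_ratio[OF assms(1) stieltjes_tail_ratio[OF assms] Abelian_constant_pos] assms(2,3) .

end

lemma Beta_reflection:
  assumes "0 < \<alpha>" "\<alpha> < (1::real)"
  shows "Beta (1 - \<alpha>) (1 + \<alpha>) = pi * \<alpha> / sin (pi * \<alpha>)"
proof -
  have "Gamma (complex_of_real \<alpha>) * Gamma (complex_of_real (1 - \<alpha>)) =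
      of_real pi / sin (of_real (pi * \<alpha>))"
    using Gamma_reflection_complex[of "complex_of_real \<alpha>"] by simp
  then have "complex_of_real (Gamma \<alpha> * Gamma (1 - \<alpha>)) = complex_of_real (pi / sin (pi * \<alpha>))"
    unfolding Gamma_complex_of_real sin_of_real by (simp only: of_real_mult of_real_divide)
  then have "Gamma \<alpha> * Gamma (1 - \<alpha>) = pi / sin (pi * \<alpha>)"
    by (simp only: of_real_eq_iff)
  moreover have "Gamma (1 + \<alpha>) = \<alpha> * Gamma \<alpha>"
    using assms by (metis Gamma_plus1 add.commute nonpos_Ints_nonpos not_le)
  ultimately show ?thesis
    by (simp add: Beta_def Gamma_numeral mult_ac)
qed

section \<open>A Tauberian theorem by comparison\<close>

lemma inverse_power_tangent:
  fixes a :: real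
  assumes "-1 < a"
  shows "1 - real n * a \<le> 1 / (1 + a) ^ n"
proof -
  have "- a \<le> - a / (1 + a)"
    using assms by (simp add: field_simps)
  then have "1 - real n * a \<le> 1 + real n * (- a / (1 + a))"
    using mult_left_mono[of "- a" "- a / (1 + a)" "real n"] by simp
  also have "\<dots> \<le> (1 + - a / (1 + a)) ^ n"
    using assms by (intro Bernoulli_inequality) (simp add: field_simps)
  also have "1 + - a / (1 + a) = 1 / (1 + a)"
    using assms by (simp add: field_simps)
  finally show ?thesis
    by (simp add: power_one_over)
qed

context half_line_distribution
begin

text \<open>As a function of \<open>l\<close>, the larger side is the integral of the convex function
  \<open>v ^ n / (1 + (l - 1) v) ^ n\<close> with \<open>v = t / (t + x)\<close>, and the smaller side is its tangent at \<open>l = 1\<close>.\<close>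

lemma stieltjes_tangent:
  assumes x: "0 < x" and l: "0 < l"
  shows "stieltjes M n x - real n * (l - 1) * stieltjes M (Suc n) x \<le> stieltjes M n (x / l) / l ^ n"
proof -
  note int = kernel_integrable[OF x] kernel_integrable[of "x / l"]
  have "stieltjes M n x - real n * (l - 1) * stieltjes M (Suc n) x =
      (LINT t|M. (t / (t + x)) ^ n - real n * (l - 1) * (t / (t + x)) ^ Suc n)"
    unfolding stieltjes_def using int(1)[of n] int(1)[of "Suc n"] by (simp del: power_Suc)
  also have "\<dots> \<le> (LINT t|M. (t / (t + x / l)) ^ n / l ^ n)"
  proof (rule integral_mono_AE)
    show "AE t in M. (t / (t + x)) ^ n - real n * (l - 1) * (t / (t + x)) ^ Suc n
        \<le> (t / (t + x / l)) ^ n / l ^ n"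
      using AE_nonneg
    proof eventually_elim
      case (elim t)
      define v where "v = t / (t + x)"
      have v: "0 \<le> v" "v < 1"
        using kernel_bounds[OF elim x] by (auto simp: v_def)
      have "- 1 < (l - 1) * v"
      proof (cases "l \<ge> 1")
        case True
        then have "0 \<le> (l - 1) * v" using v by simp
        then show ?thesis by linarith
      next
        case False
        then have "(1 - l) * v \<le> (1 - l) * 1"
          using v by (intro mult_left_mono) auto
        then show ?thesis using l by (simp add: algebra_simps)
      qed
      from mult_left_mono[OF inverse_power_tangent[OF this, of n], of "v ^ n"]
      have "v ^ n - real n * (l - 1) * v ^ Suc n \<le> (v / (1 + (l - 1) * v)) ^ n"
        using v by (simp add: power_divide algebra_simps)
      also have "v / (1 + (l - 1) * v) = t / (t + x / l) / l"
      proof -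
        have pos: "0 < t + x" "0 < l * t + x"
          using elim x l by (auto intro: add_nonneg_pos)
        have "1 + (l - 1) * v = (l * t + x) / (t + x)"
          using pos by (simp add: v_def field_simps)
        then have "v / (1 + (l - 1) * v) = t / (l * t + x)"
          using pos by (simp add: v_def)
        also have "l * t + x = (t + x / l) * l"
          using l by (simp add: field_simps)
        finally show ?thesis by simp
      qed
      finally show ?case
        by (simp add: v_def power_divide power_mult_distrib)
    qed
  qed (use int x l in \<open>auto simp del: power_Suc\<close>)
  also have "\<dots> = stieltjes M n (x / l) / l ^ n"
    by (simp add: stieltjes_def)
  finally show ?thesis .
qed

text \<open>A monotone density argument.  Divided by \<open>n (l - 1)\<close>, the tangent inequality bounds the ratio
  from below for \<open>l > 1\<close> and from above for \<open>l < 1\<close>.  In the limit \<open>x \<rightarrow> \<infinity>\<close> the bound is the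
  difference quotient of \<open>- l powr (\<alpha> - n) / n\<close> between \<open>1\<close> and \<open>l\<close>; then let \<open>l \<rightarrow> 1\<close>.\<close>

lemma stieltjes_Suc_ratio:
  assumes U: "varies (- \<alpha>) (stieltjes M n)" and n: "0 < n"
  shows "((\<lambda>x. stieltjes M (Suc n) x / stieltjes M n x) \<longlongrightarrow> (n - \<alpha>) / n) at_top"
proof -
  define b where "b = (\<lambda>l::real. (1 - l powr (\<alpha> - n)) / (n * (l - 1)))"
  define g where "g = (\<lambda>(l::real) x. (1 - stieltjes M n (1 / l * x) / stieltjes M n x / l ^ n) / (n * (l - 1)))"
  have "((\<lambda>l. l powr (\<alpha> - n)) has_real_derivative (\<alpha> - n)) (at 1)"
    by (auto intro!: derivative_eq_intros)
  then have "((\<lambda>l. (l powr (\<alpha> - n) - 1) / (l - 1)) \<longlongrightarrow> \<alpha> - n) (at 1)"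
    by (simp add: has_field_derivative_iff)
  then have "((\<lambda>l::real. - ((l powr (\<alpha> - n) - 1) / (l - 1)) / n) \<longlongrightarrow> - (\<alpha> - n) / n) (at 1)"
    using n by (intro tendsto_intros) auto
  also have "(\<lambda>l::real. - ((l powr (\<alpha> - n) - 1) / (l - 1)) / n) = b"
    by (auto simp: b_def fun_eq_iff divide_simps)
  finally have b: "(b \<longlongrightarrow> (n - \<alpha>) / n) (at 1)"
    by simp
  have g: "(g l \<longlongrightarrow> b l) at_top" if "0 < l" "l \<noteq> 1" for l
  proof -
    have "(g l \<longlongrightarrow> (1 - (1 / l) powr (- \<alpha>) / l ^ n) / (n * (l - 1))) at_top"
      unfolding g_def using that n by (intro tendsto_intros variesD(2)[OF U]) auto
    also have "(1 / l) powr (- \<alpha>) / l ^ n = l powr (\<alpha> - n)"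
      using that by (simp add: powr_divide powr_minus powr_diff powr_realpow)
    finally show ?thesis
      by (simp add: b_def)
  qed
  have bound: "\<forall>\<^sub>F x in at_top. 1 - stieltjes M n (1 / l * x) / stieltjes M n x / l ^ n
      \<le> n * (l - 1) * (stieltjes M (Suc n) x / stieltjes M n x)" if l: "0 < l" for l :: real
    using variesD(1)[OF U] eventually_gt_at_top[of 0]
  proof eventually_elim
    case (elim x)
    have "(stieltjes M n x - real n * (l - 1) * stieltjes M (Suc n) x) / stieltjes M n x
        \<le> stieltjes M n (x / l) / l ^ n / stieltjes M n x"
      using stieltjes_tangent[OF elim(2) l, of n] elim(1) by (intro divide_right_mono) auto
    then show ?case
      using elim(1) by (simp add: diff_divide_distrib mult.commute)
  qed
  show ?thesis
  proof (rule tendsto_squeeze_family)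
    show "at_right (1::real) \<noteq> bot" "at_left (1::real) \<noteq> bot"
      by simp_all
    show "(b \<longlongrightarrow> (n - \<alpha>) / n) (at_right 1)" "(b \<longlongrightarrow> (n - \<alpha>) / n) (at_left 1)"
      using b by (auto intro: tendsto_mono[OF at_le])
    show "\<forall>\<^sub>F l in at_right 1. \<exists>g. (g \<longlongrightarrow> b l) at_top \<and>
        (\<forall>\<^sub>F x in at_top. g x \<le> stieltjes M (Suc n) x / stieltjes M n x)"
      using eventually_at_right_less[of 1]
    proof eventually_elim
      case (elim l)
      have "\<forall>\<^sub>F x in at_top. g l x \<le> stieltjes M (Suc n) x / stieltjes M n x"
        using bound[of l] unfolding g_def
        by (rule eventually_mono) (use elim n in \<open>auto simp: divide_le_eq mult_ac\<close>)
      then show ?case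
        using g[of l] elim by auto
    qed
    show "\<forall>\<^sub>F l in at_left 1. \<exists>g. (g \<longlongrightarrow> b l) at_top \<and>
        (\<forall>\<^sub>F x in at_top. stieltjes M (Suc n) x / stieltjes M n x \<le> g x)"
      using eventually_at_left_real[of 0 1, OF zero_less_one]
    proof eventually_elim
      case (elim l)
      then have neg: "real n * (l - 1) < 0"
        using n by (simp add: mult_pos_neg)
      have "\<forall>\<^sub>F x in at_top. stieltjes M (Suc n) x / stieltjes M n x \<le> g l x"
        using bound[of l] elim unfolding g_def
        by (auto elim!: eventually_mono simp: neg_le_divide_eq[OF neg] mult_ac)
      then show ?case
        using g[of l] elim by auto
    qed
  qed
qed

text \<open>Iterating: regular variation of \<open>stieltjes M n\<close> fixes the asymptotic moments of the law of
  \<open>v = t / (t + x)\<close> weighted by \<open>v ^ n\<close>, and the limits depend only on \<open>n\<close> and the index.\<close>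

lemma stieltjes_moment_ratio:
  assumes U: "varies (- \<alpha>) (stieltjes M n)" and \<alpha>: "\<alpha> < n" "0 < n"
  shows "((\<lambda>x. stieltjes M (n + k) x / stieltjes M n x) \<longlongrightarrow> (\<Prod>i<k. (real n + real i - \<alpha>) / (real n + real i))) at_top"
proof -
  have "varies (- \<alpha>) (stieltjes M (n + k)) \<and>
    ((\<lambda>x. stieltjes M (n + k) x / stieltjes M n x) \<longlongrightarrow> (\<Prod>i<k. (real n + real i - \<alpha>) / (real n + real i))) at_top"
  proof (induction k)
    case 0
    have "((\<lambda>x. stieltjes M n x / stieltjes M n x) \<longlongrightarrow> 1) at_top"
      using variesD(1)[OF U] by (intro tendsto_eventually) (auto elim: eventually_mono)
    with U show ?case
      by simp
  next
    case (Suc k)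
    then have Uk: "varies (- \<alpha>) (stieltjes M (n + k))" by simp
    have *: "((\<lambda>x. stieltjes M (Suc (n + k)) x / stieltjes M (n + k) x) \<longlongrightarrow> (n + k - \<alpha>) / (n + k)) at_top"
      using stieltjes_Suc_ratio[OF Uk] \<alpha> by simp
    moreover have "0 < (n + k - \<alpha>) / (n + k)"
      using \<alpha> by simp
    ultimately have "varies (- \<alpha>) (stieltjes M (Suc (n + k)))"
      by (rule varies_of_ratio[OF Uk])
    moreover have "((\<lambda>x. stieltjes M (n + k) x / stieltjes M n x *
        (stieltjes M (Suc (n + k)) x / stieltjes M (n + k) x)) \<longlongrightarrow>
        (\<Prod>i<k. (real n + real i - \<alpha>) / (real n + real i)) * ((n + k - \<alpha>) / (n + k))) at_top"
      using Suc * by (intro tendsto_mult) auto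
    then have "((\<lambda>x. stieltjes M (Suc (n + k)) x / stieltjes M n x) \<longlongrightarrow>
        (\<Prod>i<k. (real n + real i - \<alpha>) / (real n + real i)) * ((n + k - \<alpha>) / (n + k))) at_top"
      by (rule Lim_transform_eventually)
        (use variesD(1)[OF Uk] in \<open>auto elim!: eventually_mono\<close>)
    ultimately show ?case
      by simp
  qed
  then show ?thesis by simp
qed

lemma weighted_integrable:
  assumes h: "continuous_on UNIV h" and x: "0 < x"
  shows "integrable M (\<lambda>t. h (t / (t + x)) * (t / (t + x)) ^ n)"
proof -
  have [measurable]: "h \<in> borel_measurable borel"
    using h by (rule borel_measurable_continuous_onI)
  have "bounded (h ` {0..1})"
    by (intro compact_imp_bounded compact_continuous_image continuous_on_subset[OF h]) auto
  then obtain B where B: "\<And>v. v \<in> {0..1} \<Longrightarrow> norm (h v) \<le> B"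
    by (metis bounded_iff imageI)
  have B0: "0 \<le> B"
    using order.trans[OF norm_ge_zero B[of 0]] by simp
  show ?thesis
  proof (rule integrable_const_bound[where B = B])
    show "AE t in M. norm (h (t / (t + x)) * (t / (t + x)) ^ n) \<le> B"
      using AE_nonneg
    proof eventually_elim
      case (elim t)
      have "norm (h (t / (t + x))) * (t / (t + x)) ^ n \<le> B * 1"
        using elim x by (intro mult_mono B power_le_one) (auto simp: kernel_bounds B0)
      then show ?case
        using elim x by (simp add: abs_mult)
    qed
  qed simp
qed

lemma weighted_diff_bound:
  assumes h: "continuous_on UNIV h" "continuous_on UNIV p" and x: "0 < x" and U: "0 < stieltjes M n x"
    and e: "\<And>v. v \<in> {0..1} \<Longrightarrow> \<bar>h v - p v\<bar> \<le> e"
  shows "\<bar>(LINT t|M. h (t / (t + x)) * (t / (t + x)) ^ n) / stieltjes M n x -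
      (LINT t|M. p (t / (t + x)) * (t / (t + x)) ^ n) / stieltjes M n x\<bar> \<le> e"
proof -
  note int = weighted_integrable[OF h(1) x] weighted_integrable[OF h(2) x]
  have "\<bar>(LINT t|M. h (t / (t + x)) * (t / (t + x)) ^ n) -
      (LINT t|M. p (t / (t + x)) * (t / (t + x)) ^ n)\<bar> =
      norm (LINT t|M. (h (t / (t + x)) - p (t / (t + x))) * (t / (t + x)) ^ n)"
    using int[of n] by (simp add: left_diff_distrib)
  also have "\<dots> \<le> (LINT t|M. e * (t / (t + x)) ^ n)"
  proof (rule order.trans[OF integral_norm_bound], rule integral_mono_AE)
    show "integrable M (\<lambda>t. norm ((h (t / (t + x)) - p (t / (t + x))) * (t / (t + x)) ^ n))"
      using int[of n] by (intro integrable_norm) (simp add: left_diff_distrib)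
    show "integrable M (\<lambda>t. e * (t / (t + x)) ^ n)"
      using kernel_integrable[OF x] by simp
    show "AE t in M. norm ((h (t / (t + x)) - p (t / (t + x))) * (t / (t + x)) ^ n) \<le> e * (t / (t + x)) ^ n"
      using AE_nonneg
      by eventually_elim
        (use x in \<open>auto simp: abs_mult kernel_bounds power_abs abs_of_nonneg intro!: mult_right_mono e\<close>)
  qed
  also have "\<dots> = e * stieltjes M n x"
    by (simp add: stieltjes_def)
  finally show ?thesis
    using U by (simp add: divide_simps flip: diff_divide_distrib)
qed

end

text \<open>Equal limits of all moments give equal limits for all polynomial weights, and by Weierstrass
  for all continuous ones.  The two distributions are compared with each other, so that the limit
  law itself need not be described.\<close>

lemma stieltjes_weighted_diff:
  assumes "half_line_distribution \<mu>" "half_line_distribution \<nu>"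
    and U: "varies (- \<alpha>) (stieltjes \<mu> n)" "varies (- \<alpha>) (stieltjes \<nu> n)" and \<alpha>: "\<alpha> < n" "0 < n"
    and h: "continuous_on UNIV h"
  shows "((\<lambda>x. (LINT t|\<nu>. h (t / (t + x)) * (t / (t + x)) ^ n) / stieltjes \<nu> n x -
      (LINT t|\<mu>. h (t / (t + x)) * (t / (t + x)) ^ n) / stieltjes \<mu> n x) \<longlongrightarrow> 0) at_top"
proof -
  interpret \<mu>: half_line_distribution \<mu> by fact
  interpret \<nu>: half_line_distribution \<nu> by fact
  define E where "E = (\<lambda>M g x. (LINT t|M. g (t / (t + x)) * (t / (t + x)) ^ n) / stieltjes M n x)"
  have poly: "(E M (\<lambda>v. \<Sum>i\<le>m. a i * v ^ i) \<longlongrightarrow>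
      (\<Sum>i\<le>m. a i * (\<Prod>j<i. (real n + real j - \<alpha>) / (real n + real j)))) at_top"
    if M: "half_line_distribution M" and UM: "varies (- \<alpha>) (stieltjes M n)" for M m and a :: "nat \<Rightarrow> real"
  proof -
    interpret half_line_distribution M by fact
    have "((\<lambda>x. \<Sum>i\<le>m. a i * (stieltjes M (n + i) x / stieltjes M n x)) \<longlongrightarrow>
      (\<Sum>i\<le>m. a i * (\<Prod>j<i. (real n + real j - \<alpha>) / (real n + real j)))) at_top"
      by (intro tendsto_sum tendsto_mult tendsto_const stieltjes_moment_ratio[OF UM \<alpha>])
    moreover have "\<forall>\<^sub>F x in at_top. (\<Sum>i\<le>m. a i * (stieltjes M (n + i) x / stieltjes M n x)) =
        E M (\<lambda>v. \<Sum>i\<le>m. a i * v ^ i) x"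
      using eventually_gt_at_top[of 0]
    proof eventually_elim
      case (elim x)
      have "(LINT t|M. (\<Sum>i\<le>m. a i * (t / (t + x)) ^ i) * (t / (t + x)) ^ n) =
          (LINT t|M. (\<Sum>i\<le>m. a i * (t / (t + x)) ^ (n + i)))"
        by (simp add: sum_distrib_left power_add mult_ac)
      also have "\<dots> = (\<Sum>i\<le>m. a i * stieltjes M (n + i) x)"
        unfolding stieltjes_def using kernel_integrable[OF elim]
        by (subst Bochner_Integration.integral_sum) auto
      finally show ?case
        by (simp add: E_def sum_divide_distrib)
    qed
    ultimately show ?thesis
      by (rule Lim_transform_eventually)
  qed
  have "((\<lambda>x. E \<nu> h x - E \<mu> h x) \<longlongrightarrow> 0) at_top"
  proof (rule tendstoI)
    fix e :: real assume e: "e > 0"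
    obtain p where p: "real_polynomial_function p" "\<And>v. v \<in> {0..1} \<Longrightarrow> \<bar>h v - p v\<bar> < e / 4"
      using Stone_Weierstrass_real_polynomial_function[of "{0..1::real}" h "e / 4"] e
        continuous_on_subset[OF h] by auto
    then obtain a m where a: "p = (\<lambda>v. \<Sum>i\<le>m. a i * v ^ i)"
      by (auto simp: real_polynomial_function_iff_sum)
    have cp: "continuous_on UNIV p"
      unfolding a by (intro continuous_intros)
    have "((\<lambda>x. E \<nu> p x - E \<mu> p x) \<longlongrightarrow> 0) at_top"
      using tendsto_diff[OF poly[OF assms(2) U(2), of a m] poly[OF assms(1) U(1), of a m]]
      by (simp add: a)
    from tendstoD[OF this, of "e / 4"] e
    have "\<forall>\<^sub>F x in at_top. \<bar>E \<nu> p x - E \<mu> p x\<bar> < e / 4"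
      by (simp add: dist_real_def)
    with variesD(1)[OF U(1)] variesD(1)[OF U(2)] eventually_gt_at_top[of 0]
    show "\<forall>\<^sub>F x in at_top. dist (E \<nu> h x - E \<mu> h x) 0 < e"
    proof eventually_elim
      case (elim x)
      have "\<bar>E \<nu> h x - E \<nu> p x\<bar> \<le> e / 4" "\<bar>E \<mu> h x - E \<mu> p x\<bar> \<le> e / 4"
        unfolding E_def using elim p(2)
        by (intro \<nu>.weighted_diff_bound \<mu>.weighted_diff_bound h cp; force intro: less_imp_le)+
      with elim e show ?case
        unfolding dist_real_def by linarith
    qed
  qed
  then show ?thesis
    by (simp add: E_def)
qed

definition ramp :: "real \<Rightarrow> real \<Rightarrow> real \<Rightarrow> real" where
  "ramp a b v = min 1 (max 0 ((v - a) / (b - a)))"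

lemma ramp_bounds:
  assumes "a < b"
  shows "0 \<le> ramp a b v" "ramp a b v \<le> 1" "v \<le> a \<Longrightarrow> ramp a b v = 0" "b \<le> v \<Longrightarrow> ramp a b v = 1"
  using assms by (auto simp: ramp_def min_def max_def divide_simps)

lemma kernel_level:
  fixes x \<theta> t :: real
  assumes "0 < x" "0 < \<theta>" "0 \<le> t"
  shows "\<theta> / (1 + \<theta>) < t / (t + x) \<longleftrightarrow> \<theta> * x < t"
  using assms by (simp add: divide_simps add_pos_pos add_nonneg_pos) (simp add: algebra_simps)

lemma (in half_line_distribution) tail_ramp:
  assumes x: "0 < x" and \<theta>: "0 < \<theta>1" "\<theta>1 < \<theta>2"
  defines "a \<equiv> \<theta>1 / (1 + \<theta>1)" and "b \<equiv> \<theta>2 / (1 + \<theta>2)"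
  shows "tail M (\<theta>2 * x) \<le> (LINT t|M. ramp a b (t / (t + x)))"
    and "(LINT t|M. ramp a b (t / (t + x))) \<le> tail M (\<theta>1 * x)"
proof -
  have ab: "a < b"
    using \<theta> by (simp add: a_def b_def field_simps)
  have [measurable]: "ramp a b \<in> borel_measurable borel"
    unfolding ramp_def by measurable
  have int: "integrable M (\<lambda>t. ramp a b (t / (t + x)))"
    by (rule integrable_const_bound[where B = 1]) (auto simp: ramp_bounds[OF ab])
  have int': "integrable M (indicator {c<..} :: real \<Rightarrow> real)" for c
    by (rule integrable_const_bound[where B = 1]) (auto simp: indicator_def)
  have tail: "tail M c = (LINT t|M. indicator {c<..} t)" for c
    by (simp add: tail_def)
  show "tail M (\<theta>2 * x) \<le> (LINT t|M. ramp a b (t / (t + x)))"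
    unfolding tail
  proof (rule integral_mono_AE[OF int' int])
    show "AE t in M. indicator {\<theta>2 * x<..} t \<le> ramp a b (t / (t + x))"
      using AE_nonneg
    proof eventually_elim
      case (elim t)
      show ?case
        using kernel_level[OF x _ elim, of \<theta>2] ramp_bounds[OF ab, of "t / (t + x)"] \<theta>
        by (auto simp: indicator_def b_def)
    qed
  qed
  show "(LINT t|M. ramp a b (t / (t + x))) \<le> tail M (\<theta>1 * x)"
    unfolding tail
  proof (rule integral_mono_AE[OF int int'])
    show "AE t in M. ramp a b (t / (t + x)) \<le> indicator {\<theta>1 * x<..} t"
      using AE_nonneg
    proof eventually_elim
      case (elim t)
      show ?case
        using kernel_level[OF x _ elim, of \<theta>1] ramp_bounds[OF ab, of "t / (t + x)"] \<theta>
        by (auto simp: indicator_def a_def not_less)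
    qed
  qed
qed

text \<open>The Abelian theorem describes the ratio \<open>tail / stieltjes\<close> for \<open>\<mu>\<close>.  The ratio for \<open>\<nu>\<close> has
  the same limit, because both ratios average the same function against weighted laws of
  \<open>v = t / (t + x)\<close> that agree asymptotically: the function is \<open>1 / v ^ n\<close> for \<open>v > 1/2\<close> and \<open>0\<close>
  otherwise.  Ramps smooth its jump; the width of the ramp is the parameter of the squeeze.\<close>

theorem Tauberian_comparison:
  assumes "half_line_distribution \<mu>" "half_line_distribution \<nu>"
    and tail: "varies (- \<alpha>) (tail \<mu>)" and U: "varies (- \<alpha>) (stieltjes \<nu> n)" and \<alpha>: "0 \<le> \<alpha>" "\<alpha> < n"
  shows "((\<lambda>x. tail \<nu> x / stieltjes \<nu> n x) \<longlongrightarrow> 1 / (n * Beta (n - \<alpha>) (1 + \<alpha>))) at_top"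
proof -
  interpret \<mu>: half_line_distribution \<mu> by fact
  interpret \<nu>: half_line_distribution \<nu> by fact
  define C where "C = n * Beta (n - \<alpha>) (1 + \<alpha>)"
  have n: "0 < n" using \<alpha> by (cases n) auto
  have C: "0 < C" unfolding C_def by (rule \<mu>.Abelian_constant_pos[OF \<alpha>])
  note U\<mu> = \<mu>.varies_stieltjes_of_tail[OF tail \<alpha>]
  define h where "h = (\<lambda>\<theta>1 \<theta>2 v. ramp (\<theta>1 / (1 + \<theta>1)) (\<theta>2 / (1 + \<theta>2)) v / (max (\<theta>1 / (1 + \<theta>1)) v) ^ n)"
  have h_cont: "continuous_on UNIV (h \<theta>1 \<theta>2)" if "0 < \<theta>1" "\<theta>1 < \<theta>2" for \<theta>1 \<theta>2
  proof -
    have "\<theta>1 / (1 + \<theta>1) < \<theta>2 / (1 + \<theta>2)" "0 < \<theta>1 / (1 + \<theta>1)"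
      using that by (auto simp: field_simps)
    then show ?thesis
      unfolding h_def ramp_def by (intro continuous_intros) (auto simp: max_def)
  qed
  have h_eq: "(LINT t|M. h \<theta>1 \<theta>2 (t / (t + x)) * (t / (t + x)) ^ n) =
      (LINT t|M. ramp (\<theta>1 / (1 + \<theta>1)) (\<theta>2 / (1 + \<theta>2)) (t / (t + x)))"
    if "0 < \<theta>1" "\<theta>1 < \<theta>2" for \<theta>1 \<theta>2 x M
  proof (rule Bochner_Integration.integral_cong[OF refl])
    fix t
    have ab: "\<theta>1 / (1 + \<theta>1) < \<theta>2 / (1 + \<theta>2)" "0 < \<theta>1 / (1 + \<theta>1)"
      using that by (auto simp: field_simps)
    show "h \<theta>1 \<theta>2 (t / (t + x)) * (t / (t + x)) ^ n =
        ramp (\<theta>1 / (1 + \<theta>1)) (\<theta>2 / (1 + \<theta>2)) (t / (t + x))"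
      using ramp_bounds(3)[OF ab(1), of "t / (t + x)"] ab(2)
      by (cases "t / (t + x) \<le> \<theta>1 / (1 + \<theta>1)") (auto simp: h_def max_def)
  qed
  define D where "D = (\<lambda>\<theta>1 \<theta>2 x. (LINT t|\<nu>. h \<theta>1 \<theta>2 (t / (t + x)) * (t / (t + x)) ^ n) / stieltjes \<nu> n x -
      (LINT t|\<mu>. h \<theta>1 \<theta>2 (t / (t + x)) * (t / (t + x)) ^ n) / stieltjes \<mu> n x)"
  have D: "(D \<theta>1 \<theta>2 \<longlongrightarrow> 0) at_top" if "0 < \<theta>1" "\<theta>1 < \<theta>2" for \<theta>1 \<theta>2
    unfolding D_def
    by (rule stieltjes_weighted_diff[OF assms(1,2) U\<mu> U \<alpha>(2) n h_cont[OF that]])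
  have lim: "((\<lambda>x. tail \<mu> (\<theta> * x) / stieltjes \<mu> n x) \<longlongrightarrow> \<theta> powr (- \<alpha>) / C) at_top" if \<theta>: "0 < \<theta>" for \<theta>
  proof -
    have "((\<lambda>x. tail \<mu> (\<theta> * x) / tail \<mu> x / (stieltjes \<mu> n x / tail \<mu> x)) \<longlongrightarrow> \<theta> powr (- \<alpha>) / C) at_top"
      using \<mu>.stieltjes_tail_ratio[OF tail \<alpha>] C n unfolding C_def
      by (intro tendsto_divide variesD(2)[OF tail \<theta>]) auto
    then show ?thesis
      by (rule Lim_transform_eventually) (use variesD(1)[OF tail] in \<open>auto elim!: eventually_mono\<close>)
  qed
  have "((\<lambda>x. tail \<nu> x / stieltjes \<nu> n x) \<longlongrightarrow> 1 / C) at_top"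
  proof (rule tendsto_squeeze_family)
    have "((\<lambda>\<theta>::real. \<theta> powr (- \<alpha>) / C) \<longlongrightarrow> 1 powr (- \<alpha>) / C) (at 1)"
      using C by (intro tendsto_intros) auto
    then have lim1: "((\<lambda>\<theta>::real. \<theta> powr (- \<alpha>) / C) \<longlongrightarrow> 1 / C) (at 1)" by simp
    then show "((\<lambda>\<theta>. \<theta> powr (- \<alpha>) / C) \<longlongrightarrow> 1 / C) (at_right 1)" "((\<lambda>\<theta>. \<theta> powr (- \<alpha>) / C) \<longlongrightarrow> 1 / C) (at_left 1)"
      by (auto intro: tendsto_mono[OF at_le])
    show "at_right (1::real) \<noteq> bot" "at_left (1::real) \<noteq> bot"
      by simp_all
    show "\<forall>\<^sub>F \<theta> in at_right 1. \<exists>g. (g \<longlongrightarrow> \<theta> powr (- \<alpha>) / C) at_top \<and>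
        (\<forall>\<^sub>F x in at_top. g x \<le> tail \<nu> x / stieltjes \<nu> n x)"
      using eventually_at_right_less[of 1]
    proof eventually_elim
      case (elim \<theta>)
      have "((\<lambda>x. D 1 \<theta> x + tail \<mu> (\<theta> * x) / stieltjes \<mu> n x) \<longlongrightarrow> 0 + \<theta> powr (- \<alpha>) / C) at_top"
        using elim by (intro tendsto_add D lim) auto
      moreover have "\<forall>\<^sub>F x in at_top. D 1 \<theta> x + tail \<mu> (\<theta> * x) / stieltjes \<mu> n x \<le> tail \<nu> x / stieltjes \<nu> n x"
        using variesD(1)[OF U] variesD(1)[OF U\<mu>] eventually_gt_at_top[of 0]
      proof eventually_elim
        case (elim x)
        note ramp = h_eq[of 1 \<theta>, OF zero_less_one \<open>1 < \<theta>\<close>, of _ x]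
        have "tail \<mu> (\<theta> * x) / stieltjes \<mu> n x \<le>
            (LINT t|\<mu>. h 1 \<theta> (t / (t + x)) * (t / (t + x)) ^ n) / stieltjes \<mu> n x"
          using elim \<open>1 < \<theta>\<close> unfolding ramp by (intro divide_right_mono \<mu>.tail_ramp) auto
        moreover have "(LINT t|\<nu>. h 1 \<theta> (t / (t + x)) * (t / (t + x)) ^ n) / stieltjes \<nu> n x \<le>
            tail \<nu> (1 * x) / stieltjes \<nu> n x"
          using elim \<open>1 < \<theta>\<close> unfolding ramp by (intro divide_right_mono \<nu>.tail_ramp) auto
        ultimately show ?case
          by (simp add: D_def)
      qed
      ultimately show ?case by auto
    qed
    show "\<forall>\<^sub>F \<theta> in at_left 1. \<exists>g. (g \<longlongrightarrow> \<theta> powr (- \<alpha>) / C) at_top \<and>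
        (\<forall>\<^sub>F x in at_top. tail \<nu> x / stieltjes \<nu> n x \<le> g x)"
      using eventually_at_left_real[of 0 1, OF zero_less_one]
    proof eventually_elim
      case (elim \<theta>)
      then have \<theta>: "0 < \<theta>" "\<theta> < 1" by auto
      have "((\<lambda>x. D \<theta> 1 x + tail \<mu> (\<theta> * x) / stieltjes \<mu> n x) \<longlongrightarrow> 0 + \<theta> powr (- \<alpha>) / C) at_top"
        using \<theta> by (intro tendsto_add D lim) auto
      moreover have "\<forall>\<^sub>F x in at_top. tail \<nu> x / stieltjes \<nu> n x \<le> D \<theta> 1 x + tail \<mu> (\<theta> * x) / stieltjes \<mu> n x"
        using variesD(1)[OF U] variesD(1)[OF U\<mu>] eventually_gt_at_top[of 0]
      proof eventually_elim
        case (elim x)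
        note ramp = h_eq[of \<theta> 1, OF \<theta>, of _ x]
        have "(LINT t|\<mu>. h \<theta> 1 (t / (t + x)) * (t / (t + x)) ^ n) / stieltjes \<mu> n x \<le>
            tail \<mu> (\<theta> * x) / stieltjes \<mu> n x"
          using elim \<theta> unfolding ramp by (intro divide_right_mono \<mu>.tail_ramp) auto
        moreover have "tail \<nu> (1 * x) / stieltjes \<nu> n x \<le>
            (LINT t|\<nu>. h \<theta> 1 (t / (t + x)) * (t / (t + x)) ^ n) / stieltjes \<nu> n x"
          using elim \<theta> unfolding ramp by (intro divide_right_mono \<nu>.tail_ramp) auto
        ultimately show ?case
          by (simp add: D_def)
      qed
      ultimately show ?case by auto
    qed
  qed
  then show ?thesis
    by (simp add: C_def)
qed

section \<open>Derivatives modulo slowly growing functions\<close>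

text \<open>The functions that grow near \<open>0\<close> more slowly than every negative power form a ring, which is
  also closed under real powers of its positive units.\<close>

definition slow :: "(real \<Rightarrow> real) set" where
  "slow = {f. \<forall>\<epsilon>>0. f \<in> O[at_right 0](\<lambda>s. s powr - \<epsilon>)}"

lemma slowI: "(\<And>\<epsilon>. \<epsilon> > 0 \<Longrightarrow> f \<in> O[at_right 0](\<lambda>s. s powr - \<epsilon>)) \<Longrightarrow> f \<in> slow"
  by (simp add: slow_def)

lemma slowD: "f \<in> slow \<Longrightarrow> \<epsilon> > 0 \<Longrightarrow> f \<in> O[at_right 0](\<lambda>s. s powr - \<epsilon>)"
  by (simp add: slow_def)

lemma slow_cong:
  assumes "f \<in> slow" "\<forall>\<^sub>F s in at_right 0. f s = g s"
  shows "g \<in> slow"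
proof (rule slowI)
  fix \<epsilon> :: real assume "\<epsilon> > 0"
  show "g \<in> O[at_right 0](\<lambda>s. s powr - \<epsilon>)"
    using landau_o.big.in_cong[OF assms(2)] slowD[OF assms(1) \<open>\<epsilon> > 0\<close>] by simp
qed

lemma slow_bounded:
  assumes "\<forall>\<^sub>F s in at_right 0. \<bar>f s\<bar> \<le> C"
  shows "f \<in> slow"
proof (rule slowI)
  fix \<epsilon> :: real assume \<epsilon>: "\<epsilon> > 0"
  have "\<forall>\<^sub>F s in at_right 0. norm (f s) \<le> \<bar>C\<bar> * norm (s powr - \<epsilon>)"
    using assms eventually_at_right_real[OF zero_less_one]
  proof eventually_elim
    case (elim s)
    have "1 \<le> s powr - \<epsilon>"
      using elim \<epsilon> powr_mono'[of "- \<epsilon>" 0 s] by simp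
    then have "C * 1 \<le> \<bar>C\<bar> * s powr - \<epsilon>"
      by (intro mult_mono) auto
    with elim show ?case by simp
  qed
  then show "f \<in> O[at_right 0](\<lambda>s. s powr - \<epsilon>)"
    by (rule bigoI)
qed

lemma slow_const [simp]: "(\<lambda>_. c) \<in> slow"
  by (rule slow_bounded[where C = "\<bar>c\<bar>"]) simp

lemma slow_of_tendsto:
  assumes "(f \<longlongrightarrow> c) (at_right 0)"
  shows "f \<in> slow"
proof (rule slow_bounded)
  have "((\<lambda>s. \<bar>f s\<bar>) \<longlongrightarrow> \<bar>c\<bar>) (at_right 0)"
    using assms by (rule tendsto_rabs)
  then have "\<forall>\<^sub>F s in at_right 0. \<bar>f s\<bar> < \<bar>c\<bar> + 1"
    by (rule order_tendstoD) simp
  then show "\<forall>\<^sub>F s in at_right 0. \<bar>f s\<bar> \<le> \<bar>c\<bar> + 1"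
    by eventually_elim simp
qed

lemma slow_ident [simp]: "(\<lambda>s. s) \<in> slow"
  by (rule slow_of_tendsto[where c = 0]) (auto intro: tendsto_intros)

lemma slow_add: "f \<in> slow \<Longrightarrow> g \<in> slow \<Longrightarrow> (\<lambda>s. f s + g s) \<in> slow"
  by (rule slowI) (simp add: slowD sum_in_bigo)

lemma slow_mult:
  assumes "f \<in> slow" "g \<in> slow"
  shows "(\<lambda>s. f s * g s) \<in> slow"
proof (rule slowI)
  fix \<epsilon> :: real assume "\<epsilon> > 0"
  then have "(\<lambda>s. f s * g s) \<in> O[at_right 0](\<lambda>s. s powr - (\<epsilon> / 2) * s powr - (\<epsilon> / 2))"
    using assms by (intro landau_o.big.mult slowD) auto
  then show "(\<lambda>s. f s * g s) \<in> O[at_right 0](\<lambda>s. s powr - \<epsilon>)"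
    by (simp flip: powr_add)
qed

lemma slow_power: "f \<in> slow \<Longrightarrow> (\<lambda>s. f s ^ k) \<in> slow"
  by (induction k) (auto intro: slow_mult)

lemma slow_powr_pos:
  assumes f: "f \<in> slow" and pos: "\<forall>\<^sub>F s in at_right 0. 0 < f s" and a: "a > 0"
  shows "(\<lambda>s. f s powr a) \<in> slow"
proof (rule slowI)
  fix \<epsilon> :: real assume "\<epsilon> > 0"
  then have "(\<lambda>s. f s powr a) \<in> O[at_right 0](\<lambda>s. (s powr - (\<epsilon> / a)) powr a)"
    using pos a by (intro bigo_powr_nonneg slowD[OF f]) (auto elim: eventually_mono)
  then show "(\<lambda>s. f s powr a) \<in> O[at_right 0](\<lambda>s. s powr - \<epsilon>)"
    using a by (simp add: powr_powr)
qed

lemma slow_powr: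
  assumes f: "f \<in> slow" "(\<lambda>s. 1 / f s) \<in> slow" and pos: "\<forall>\<^sub>F s in at_right 0. 0 < f s"
  shows "(\<lambda>s. f s powr a) \<in> slow"
proof -
  consider "a > 0" | "a = 0" | "a < 0" by linarith
  then show ?thesis
  proof cases
    case 1
    then show ?thesis using slow_powr_pos[OF f(1) pos] by simp
  next
    case 2
    show ?thesis
      by (rule slow_bounded[where C = 1]) (simp add: 2)
  next
    case 3
    have "(\<lambda>s. (1 / f s) powr - a) \<in> slow"
      using 3 pos by (intro slow_powr_pos f) (auto elim: eventually_mono)
    then show ?thesis
      by (rule slow_cong) (use pos in \<open>auto elim!: eventually_mono simp: powr_divide powr_minus\<close>)
  qed
qed

text \<open>\<open>jet \<Gamma> m f c\<close>: the derivatives of \<open>f\<close> of order below \<open>m\<close> are slow, and the \<open>m\<close>-th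
  derivative is \<open>c \<Gamma>\<close> up to a slow function.  If all derivatives of \<open>g\<close> up to
  order \<open>m\<close> are slow, then only one term in the product rule for the \<open>m\<close>-th derivative of \<open>g f\<close> is
  not slow, the one with the \<open>m\<close>-th derivative of \<open>f\<close>.  So jets can be multiplied without binomial sums.\<close>

primrec jet :: "(real \<Rightarrow> real) \<Rightarrow> nat \<Rightarrow> (real \<Rightarrow> real) \<Rightarrow> (real \<Rightarrow> real) \<Rightarrow> bool" where
  "jet \<Gamma> 0 f c \<longleftrightarrow> (\<lambda>s. f s - c s * \<Gamma> s) \<in> slow"
| "jet \<Gamma> (Suc m) f c \<longleftrightarrow> f \<in> slow \<and>
     (\<exists>f'. (\<forall>\<^sub>F s in at_right 0. (f has_real_derivative f' s) (at s)) \<and> jet \<Gamma> m f' c)"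

text \<open>All derivatives up to and including order \<open>m\<close> are slow.\<close>

definition tame :: "nat \<Rightarrow> (real \<Rightarrow> real) \<Rightarrow> bool" where
  "tame m f \<longleftrightarrow> jet (\<lambda>_. 0) m f (\<lambda>_. 0)"

lemma tame_0 [simp]: "tame 0 f \<longleftrightarrow> f \<in> slow"
  by (simp add: tame_def)

lemma tame_Suc: "tame (Suc m) f \<longleftrightarrow> f \<in> slow \<and>
    (\<exists>f'. (\<forall>\<^sub>F s in at_right 0. (f has_real_derivative f' s) (at s)) \<and> tame m f')"
  by (simp add: tame_def)

lemma eventually_deriv_cong:
  assumes "\<forall>\<^sub>F s in at_right 0. (f has_real_derivative f' s) (at s)"
    and "\<forall>\<^sub>F s in at_right (0::real). f s = g s"
  shows "\<forall>\<^sub>F s in at_right 0. (g has_real_derivative f' s) (at s)"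
proof -
  obtain b where b: "b > 0" "\<And>s. 0 < s \<Longrightarrow> s < b \<Longrightarrow> f s = g s"
    using assms(2) by (auto simp: eventually_at_right_field)
  show ?thesis
    using assms(1) eventually_at_right_real[OF b(1)]
  proof eventually_elim
    case (elim s)
    show ?case
      by (rule has_field_derivative_transform_within_open[OF elim(1), of "{0<..<b}"]) (use elim b in auto)
  qed
qed

lemma jet_cong:
  assumes "jet \<Gamma> m f c" "\<forall>\<^sub>F s in at_right 0. f s = g s"
  shows "jet \<Gamma> m g c"
proof (cases m)
  case 0
  have "\<forall>\<^sub>F s in at_right 0. f s - c s * \<Gamma> s = g s - c s * \<Gamma> s"
    using assms(2) by eventually_elim simp
  then show ?thesis
    using assms(1) slow_cong by (auto simp: 0)
next
  case (Suc k)
  then show ?thesis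
    using assms slow_cong eventually_deriv_cong by (auto, blast)
qed

lemma tame_cong: "tame m f \<Longrightarrow> \<forall>\<^sub>F s in at_right 0. f s = g s \<Longrightarrow> tame m g"
  unfolding tame_def by (rule jet_cong)

lemma jet_imp_tame: "jet \<Gamma> (Suc m) f c \<Longrightarrow> tame m f"
proof (induction m arbitrary: f)
  case (Suc m)
  then obtain f' where "f \<in> slow" "\<forall>\<^sub>F s in at_right 0. (f has_real_derivative f' s) (at s)"
    "jet \<Gamma> (Suc m) f' c" by auto
  with Suc.IH[of f'] show ?case
    unfolding tame_Suc by blast
qed simp

lemma tame_imp_jet: "tame m f \<Longrightarrow> jet \<Gamma> m f (\<lambda>_. 0)"
  by (induction m arbitrary: f) (auto simp: tame_Suc)

lemma tame_slow: "tame m f \<Longrightarrow> f \<in> slow"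
  by (cases m) (auto simp: tame_Suc)

lemma tame_pred: "tame (Suc m) f \<Longrightarrow> tame m f"
  unfolding tame_def[of "Suc m"] by (rule jet_imp_tame)

lemma tame_antimono: "k \<le> m \<Longrightarrow> tame m f \<Longrightarrow> tame k f"
  by (induction rule: inc_induct) (auto intro: tame_pred)

lemma jet_add: "jet \<Gamma> m f c \<Longrightarrow> jet \<Gamma> m g d \<Longrightarrow> jet \<Gamma> m (\<lambda>s. f s + g s) (\<lambda>s. c s + d s)"
proof (induction m arbitrary: f g)
  case 0
  then have "(\<lambda>s. (f s - c s * \<Gamma> s) + (g s - d s * \<Gamma> s)) \<in> slow"
    by (intro slow_add) auto
  then show ?case
    by (simp add: algebra_simps)
next
  case (Suc m)
  then obtain f' g' where *: "f \<in> slow" "g \<in> slow" "jet \<Gamma> m f' c" "jet \<Gamma> m g' d"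
      "\<forall>\<^sub>F s in at_right 0. (f has_real_derivative f' s) (at s)"
      "\<forall>\<^sub>F s in at_right 0. (g has_real_derivative g' s) (at s)"
    by auto
  have "\<forall>\<^sub>F s in at_right 0. ((\<lambda>s. f s + g s) has_real_derivative f' s + g' s) (at s)"
    using *(5,6) by eventually_elim (auto intro!: derivative_eq_intros)
  with Suc.IH[OF *(3,4)] slow_add[OF *(1,2)] show ?case
    by auto
qed

lemma tame_add: "tame m f \<Longrightarrow> tame m g \<Longrightarrow> tame m (\<lambda>s. f s + g s)"
  unfolding tame_def using jet_add[of "\<lambda>_. 0" m f "\<lambda>_. 0" g "\<lambda>_. 0"] by simp

lemma jet_mult: "jet \<Gamma> m f c \<Longrightarrow> tame m g \<Longrightarrow> jet \<Gamma> m (\<lambda>s. g s * f s) (\<lambda>s. g s * c s)"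
proof (induction m arbitrary: f g c)
  case 0
  then have "(\<lambda>s. g s * (f s - c s * \<Gamma> s)) \<in> slow"
    by (intro slow_mult) auto
  then show ?case
    by (simp add: algebra_simps)
next
  case (Suc m)
  then obtain f' g' where *: "f \<in> slow" "g \<in> slow" "jet \<Gamma> m f' c" "tame m g'"
      "\<forall>\<^sub>F s in at_right 0. (f has_real_derivative f' s) (at s)"
      "\<forall>\<^sub>F s in at_right 0. (g has_real_derivative g' s) (at s)"
    by (auto simp: tame_Suc)
  have "tame m f" "tame m g"
    using Suc.prems jet_imp_tame tame_pred by blast+
  \<comment> \<open>Both \<open>f\<close> and \<open>g'\<close> are tame of order \<open>m\<close>, so their product only enters the error.\<close>
  have "jet \<Gamma> m (\<lambda>s. f s * g' s) (\<lambda>s. f s * 0)"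
    using Suc.IH[OF tame_imp_jet[OF *(4)] \<open>tame m f\<close>] .
  with Suc.IH[OF *(3) \<open>tame m g\<close>] have "jet \<Gamma> m (\<lambda>s. g s * f' s + f s * g' s) (\<lambda>s. g s * c s + f s * 0)"
    by (rule jet_add)
  then have "jet \<Gamma> m (\<lambda>s. g s * f' s + f s * g' s) (\<lambda>s. g s * c s)"
    by simp
  moreover have "\<forall>\<^sub>F s in at_right 0. ((\<lambda>s. g s * f s) has_real_derivative g s * f' s + f s * g' s) (at s)"
    using *(5,6) by eventually_elim (auto intro!: derivative_eq_intros)
  ultimately show ?case
    using slow_mult[OF *(2,1)] by auto
qed

lemma tame_mult: "tame m f \<Longrightarrow> tame m g \<Longrightarrow> tame m (\<lambda>s. f s * g s)"
  using jet_mult[of "\<lambda>_. 0" m g "\<lambda>_. 0" f] by (simp add: tame_def)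

lemma tame_const [simp]: "tame m (\<lambda>_. c)"
  by (induction m arbitrary: c) (auto simp: tame_Suc intro!: exI[of _ "\<lambda>_. 0"])

lemma tame_ident [simp]: "tame m (\<lambda>s. s)"
  by (cases m) (auto simp: tame_Suc intro!: exI[of _ "\<lambda>_. 1"] derivative_eq_intros)

lemma tame_minus: "tame m f \<Longrightarrow> tame m (\<lambda>s. - f s)"
  using tame_mult[of m "\<lambda>_. -1" f] by simp

lemma tame_diff: "tame m f \<Longrightarrow> tame m g \<Longrightarrow> tame m (\<lambda>s. f s - g s)"
  using tame_add[OF _ tame_minus] by fastforce

lemma DERIV_powr_const:
  assumes "(f has_real_derivative f') (at s)" "0 < f s"
  shows "((\<lambda>s. f s powr a) has_real_derivative a * f s powr (a - 1) * f') (at s)"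
  using DERIV_fun_powr[OF assms, of a] by simp

text \<open>Differentiation lowers the exponent, so the induction runs over all exponents at once.\<close>

lemma tame_powr:
  assumes "tame m f" "(\<lambda>s. 1 / f s) \<in> slow" "\<forall>\<^sub>F s in at_right 0. 0 < f s"
  shows "tame m (\<lambda>s. f s powr a)"
  using assms
proof (induction m arbitrary: a)
  case 0
  then show ?case by (simp add: slow_powr)
next
  case (Suc m)
  then obtain f' where f': "f \<in> slow" "\<forall>\<^sub>F s in at_right 0. (f has_real_derivative f' s) (at s)" "tame m f'"
    by (auto simp: tame_Suc)
  have "\<forall>\<^sub>F s in at_right 0. ((\<lambda>s. f s powr a) has_real_derivative a * f s powr (a - 1) * f' s) (at s)"
    using f'(2) Suc.prems(3) by eventually_elim (rule DERIV_powr_const)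
  moreover have "tame m (\<lambda>s. a * f s powr (a - 1) * f' s)"
    using Suc tame_pred f'(3) by (intro tame_mult tame_const Suc.IH) blast+
  ultimately show ?case
    using slow_powr[OF f'(1) Suc.prems(2,3), of a] unfolding tame_Suc
    by (intro conjI exI[of _ "\<lambda>s. a * f s powr (a - 1) * f' s"])
qed

lemma tame_inverse:
  assumes "tame m f" "(\<lambda>s. 1 / f s) \<in> slow" "\<forall>\<^sub>F s in at_right 0. 0 < f s"
  shows "tame m (\<lambda>s. 1 / f s)"
  by (rule tame_cong[OF tame_powr[OF assms, of "-1"]])
    (use assms(3) in \<open>auto elim!: eventually_mono simp: powr_minus_divide\<close>)

text \<open>Differentiating \<open>H k (R s)\<close> and dividing by \<open>R'\<close> yields \<open>H (Suc k) (R s)\<close>.  As \<open>1 / R'\<close> is tame,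
  each such step lowers the order of the jet by one and multiplies the coefficient by \<open>1 / R'\<close>.\<close>

lemma jet_chain:
  fixes H :: "nat \<Rightarrow> real \<Rightarrow> real"
  assumes dH: "\<And>k r. 0 < r \<Longrightarrow> (H k has_real_derivative H (Suc k) r) (at r)"
    and dR: "\<forall>\<^sub>F s in at_right 0. (R has_real_derivative R' s) (at s)"
    and R: "\<forall>\<^sub>F s in at_right 0. 0 < R s" "\<forall>\<^sub>F s in at_right 0. 0 < R' s"
    and q: "tame n (\<lambda>s. 1 / R' s)"
    and H0: "jet \<Gamma> (Suc n) (\<lambda>s. H 0 (R s)) c"
  shows "k \<le> Suc n \<Longrightarrow> jet \<Gamma> (Suc n - k) (\<lambda>s. H k (R s)) (\<lambda>s. (1 / R' s) ^ k * c s)"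
proof (induction k)
  case 0
  then show ?case using H0 by simp
next
  case (Suc k)
  define m where "m = n - k"
  have m: "Suc n - k = Suc m" "Suc n - Suc k = m" "m \<le> n"
    using Suc.prems by (auto simp: m_def)
  from Suc obtain f' where
    f': "\<forall>\<^sub>F s in at_right 0. ((\<lambda>s. H k (R s)) has_real_derivative f' s) (at s)"
      "jet \<Gamma> m f' (\<lambda>s. (1 / R' s) ^ k * c s)"
    by (auto simp: m)
  have "\<forall>\<^sub>F s in at_right 0. 1 / R' s * f' s = H (Suc k) (R s)"
    using f'(1) dR R
  proof eventually_elim
    case (elim s)
    have "((\<lambda>s. H k (R s)) has_real_derivative H (Suc k) (R s) * R' s) (at s)"
      using elim by (intro DERIV_chain2[OF dH]) auto
    then have "f' s = H (Suc k) (R s) * R' s"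
      using elim(1) by (rule DERIV_unique[symmetric])
    with elim show ?case by simp
  qed
  moreover have "jet \<Gamma> m (\<lambda>s. 1 / R' s * f' s) (\<lambda>s. 1 / R' s * ((1 / R' s) ^ k * c s))"
    using f'(2) tame_antimono[OF m(3) q] by (rule jet_mult)
  ultimately have "jet \<Gamma> m (\<lambda>s. H (Suc k) (R s)) (\<lambda>s. 1 / R' s * ((1 / R' s) ^ k * c s))"
    by (rule jet_cong[rotated])
  then show ?case
    unfolding m by (simp add: mult_ac)
qed

text \<open>The transformation \<open>G \<mapsto> H\<close> is the effect of the free multiplicative power on
  \<open>G 0 s = \<integral> u / (1 + s u) \<mu>(du)\<close>.  The derivative of \<open>G 0 / Q = G 0 ^ t (1 - s G 0) ^ (1 - t)\<close>
  is \<open>B G 1\<close> up to a tame function, where \<open>B\<close> is tame and asymptotic to \<open>t / Q\<close>; the inner function contributes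
  the factors \<open>1 / Q\<close> only, because the singular term \<open>s Q'\<close> of its derivative carries an extra \<open>s\<close>.\<close>

theorem power_transform_derivatives:
  fixes G H :: "nat \<Rightarrow> real \<Rightarrow> real" and t :: real
  defines "Q \<equiv> (\<lambda>s. ((1 - s * G 0 s) / G 0 s) powr (t - 1))"
  assumes dG: "\<And>k s. 0 < s \<Longrightarrow> (G k has_real_derivative G (Suc k) s) (at s)"
    and dH: "\<And>k r. 0 < r \<Longrightarrow> (H k has_real_derivative H (Suc k) r) (at r)"
    and pos: "\<And>s. 0 < s \<Longrightarrow> 0 < G 0 s"
    and slow: "\<And>k. k \<le> n \<Longrightarrow> G k \<in> slow" "(\<lambda>s. s * G (Suc n) s) \<in> slow" "(\<lambda>s. 1 / G 0 s) \<in> slow"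
    and lim0: "((\<lambda>s. s * G 0 s) \<longlongrightarrow> 0) (at_right 0)"
    and lim1: "((\<lambda>s. s * G 1 s / G 0 s) \<longlongrightarrow> 0) (at_right 0)"
    and big: "\<eta> > 0" "(\<lambda>s. s powr - \<eta>) \<in> O[at_right 0](G (Suc n))"
    and rel: "\<forall>\<^sub>F s in at_right 0. H 0 (s * Q s) = G 0 s / Q s"
    and t: "t > 0"
  shows "((\<lambda>s. H (Suc n) (s * Q s) * Q s ^ (n + 2) / G (Suc n) s) \<longlongrightarrow> t) (at_right 0)"
proof -
  define \<Gamma> where "\<Gamma> = G (Suc n)"
  define p where "p = t - 1"
  define g where "g = G 0"
  define g1 where "g1 = G 1"
  define W where "W = (\<lambda>s. 1 - s * g s)"
  note ev_s = eventually_at_right_less[of "0::real"]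
  have gpos: "\<forall>\<^sub>F s in at_right 0. 0 < g s"
    using ev_s by eventually_elim (simp add: g_def pos)
  have W_lim: "(W \<longlongrightarrow> 1) (at_right 0)"
    using tendsto_diff[OF tendsto_const[of 1] lim0] by (simp add: W_def g_def)
  then have Wpos: "\<forall>\<^sub>F s in at_right 0. 0 < W s"
    by (rule order_tendstoD) simp
  have Gjet: "jet \<Gamma> (Suc n - k) (G k) (\<lambda>_. 1)" if "k \<le> Suc n" for k
    using that
  proof (induction rule: inc_induct)
    case base
    show ?case by (simp add: \<Gamma>_def)
  next
    case (step k)
    then have "Suc n - k = Suc (n - k)" "Suc n - Suc k = n - k" by auto
    moreover have "\<forall>\<^sub>F s in at_right 0. (G k has_real_derivative G (Suc k) s) (at s)"
      using ev_s by eventually_elim (rule dG)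
    ultimately show ?case
      using step slow(1)[of k] by auto
  qed
  have Gtame: "tame (n - k) (G k)" if "k \<le> n" for k
    using Gjet[of k] that jet_imp_tame by (simp add: Suc_diff_le)
  have sGtame: "tame (Suc n - k) (\<lambda>s. s * G k s)" if "k \<le> Suc n" for k
    using that
  proof (induction rule: inc_induct)
    case base
    show ?case using slow(2) by simp
  next
    case (step k)
    then have "Suc n - k = Suc (n - k)" "Suc n - Suc k = n - k" by auto
    moreover have "\<forall>\<^sub>F s in at_right 0. ((\<lambda>s. s * G k s) has_real_derivative G k s + s * G (Suc k) s) (at s)"
      using ev_s by eventually_elim (auto intro!: derivative_eq_intros dG)
    moreover have "tame (n - k) (\<lambda>s. G k s + s * G (Suc k) s)"
      using step Gtame[of k] by (intro tame_add) auto
    ultimately show ?case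
      using step slow_mult[OF slow_ident slow(1)[of k]] by (auto simp: tame_Suc)
  qed
  have g_tame: "tame n g" and s1_tame: "tame n (\<lambda>s. s * g1 s)"
    using Gtame[of 0] sGtame[of 1] by (auto simp: g_def g1_def)
  have W_tame: "tame n W"
    unfolding W_def by (intro tame_diff tame_mult g_tame) auto
  have W_inv: "(\<lambda>s. 1 / W s) \<in> slow"
    by (rule slow_of_tendsto[where c = "1 / 1"]) (intro tendsto_intros W_lim, simp)
  have gp: "tame n (\<lambda>s. g s powr a)" for a
    using g_tame slow(3) gpos by (intro tame_powr) (auto simp: g_def)
  have Wp: "tame n (\<lambda>s. W s powr a)" for a
    using W_tame W_inv Wpos by (rule tame_powr)
  have Q_eq: "\<forall>\<^sub>F s in at_right 0. Q s = W s powr p * g s powr - p"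
    using gpos Wpos
    unfolding powr_minus by eventually_elim (simp add: Q_def W_def g_def p_def powr_divide inverse_eq_divide)
  define R' where "R' = (\<lambda>s. W s powr p * g s powr - p
      - p * s * W s powr (p - 1) * (g s + s * g1 s) * g s powr - p
      - p * W s powr p * g s powr (- p - 1) * (s * g1 s))"
  have dW: "\<forall>\<^sub>F s in at_right 0. (W has_real_derivative - (g s + s * g1 s)) (at s)"
    using ev_s unfolding W_def g_def g1_def
    by eventually_elim (auto intro!: derivative_eq_intros dG)
  have dg: "\<forall>\<^sub>F s in at_right 0. (g has_real_derivative g1 s) (at s)"
    using ev_s unfolding g_def g1_def One_nat_def by eventually_elim (rule dG)
  have "\<forall>\<^sub>F s in at_right 0. ((\<lambda>s. s * (W s powr p * g s powr - p)) has_real_derivative R' s) (at s)"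
    using dW dg gpos Wpos
  proof eventually_elim
    case (elim s)
    note d = DERIV_mult[OF DERIV_ident DERIV_mult[OF DERIV_powr_const[OF elim(1,4), of p]
          DERIV_powr_const[OF elim(2,3), of "- p"]]]
    show ?case
      by (rule DERIV_cong[OF d]) (simp add: R'_def algebra_simps)
  qed
  then have dR: "\<forall>\<^sub>F s in at_right 0. ((\<lambda>s. s * Q s) has_real_derivative R' s) (at s)"
    by (rule eventually_deriv_cong) (use Q_eq in \<open>auto elim!: eventually_mono\<close>)
  have R'_tame: "tame n R'"
    unfolding R'_def by (intro tame_diff tame_mult tame_add gp Wp g_tame s1_tame tame_const tame_ident)
  have Qpos: "\<forall>\<^sub>F s in at_right 0. 0 < Q s"
    using Q_eq gpos Wpos by eventually_elim simp
  have Q_slow: "Q \<in> slow"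
    by (rule slow_cong[OF slow_mult[OF tame_slow[OF Wp] tame_slow[OF gp]]])
      (use Q_eq in \<open>auto elim!: eventually_mono\<close>)
  have Qinv_slow: "(\<lambda>s. 1 / Q s) \<in> slow"
    by (rule slow_cong[OF slow_mult[OF tame_slow[OF Wp[of "- p"]] tame_slow[OF gp[of p]]]])
      (use Q_eq in \<open>auto elim!: eventually_mono simp: powr_minus field_simps\<close>)
  have R'Q: "((\<lambda>s. R' s / Q s) \<longlongrightarrow> 1) (at_right 0)"
  proof -
    have "((\<lambda>s. 1 - p * (s * g s + s * g s * (s * g1 s / g s)) / W s - p * (s * g1 s / g s)) \<longlongrightarrow>
        1 - p * (0 + 0 * 0) / 1 - p * 0) (at_right 0)"
      using lim0 lim1 W_lim by (intro tendsto_intros) (auto simp: g_def g1_def)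
    then have "((\<lambda>s. 1 - p * (s * g s + s * g s * (s * g1 s / g s)) / W s - p * (s * g1 s / g s)) \<longlongrightarrow> 1) (at_right 0)"
      by simp
    moreover have "\<forall>\<^sub>F s in at_right 0.
        1 - p * (s * g s + s * g s * (s * g1 s / g s)) / W s - p * (s * g1 s / g s) = R' s / Q s"
      using Q_eq gpos Wpos
    proof eventually_elim
      case (elim s)
      define a where "a = W s powr p"
      define b where "b = g s powr - p"
      have ab: "0 < a" "0 < b" "W s powr (p - 1) = a / W s" "g s powr (- p - 1) = b / g s"
        using elim by (auto simp: a_def b_def powr_diff)
      show ?case
        using elim(2,3) ab(1,2) unfolding elim(1) R'_def ab(3,4) a_def[symmetric] b_def[symmetric]
        by (simp add: field_simps)
    qed
    ultimately show ?thesis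
      by (rule Lim_transform_eventually)
  qed
  have R'pos: "\<forall>\<^sub>F s in at_right 0. 0 < R' s"
    by (rule eventually_pos_of_ratio[OF Qpos R'Q zero_less_one])
  have QR': "((\<lambda>s. Q s / R' s) \<longlongrightarrow> 1) (at_right 0)"
    using tendsto_inverse[OF R'Q] by simp
  have "(\<lambda>s. 1 / R' s) \<in> slow"
    by (rule slow_cong[OF slow_mult[OF Qinv_slow slow_of_tendsto[OF QR']]])
      (use Qpos in \<open>auto elim!: eventually_mono\<close>)
  then have q_tame: "tame n (\<lambda>s. 1 / R' s)"
    using R'_tame R'pos by (intro tame_inverse)
  define B where "B = (\<lambda>s. (1 + p) * g s powr p * W s powr - p + p * s * g s powr (1 + p) * W s powr (- p - 1))"
  define E where "E = (\<lambda>s. p * g s powr (2 + p) * W s powr (- p - 1))"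
  have B_tame: "tame n B" and E_tame: "tame n E"
    unfolding B_def E_def by (intro tame_add tame_mult gp Wp tame_const tame_ident)+
  have f0: "\<forall>\<^sub>F s in at_right 0. g s powr (1 + p) * W s powr - p = H 0 (s * Q s)"
    using Q_eq gpos Wpos rel
  proof eventually_elim
    case (elim s)
    have "g s / (W s powr p * g s powr - p) = g s powr (1 + p) * W s powr - p"
      using elim(2,3) by (simp add: powr_add powr_minus_divide)
    then show ?case
      using elim(1,4) by (simp add: g_def)
  qed
  have "\<forall>\<^sub>F s in at_right 0. ((\<lambda>s. g s powr (1 + p) * W s powr - p) has_real_derivative B s * g1 s + E s) (at s)"
    using dW dg gpos Wpos
  proof eventually_elim
    case (elim s)
    note d = DERIV_mult[OF DERIV_powr_const[OF elim(2,3), of "1 + p"]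
        DERIV_powr_const[OF elim(1,4), of "- p"]]
    have "g s powr (1 + p) = g s * g s powr p" "g s powr (2 + p) = g s * g s * g s powr p"
      using elim(3) by (simp_all add: powr_add power2_eq_square)
    then show ?case
      by (intro DERIV_cong[OF d]) (simp add: B_def E_def algebra_simps)
  qed
  moreover have "jet \<Gamma> n (\<lambda>s. B s * g1 s + E s) (\<lambda>s. B s * 1 + 0)"
    using Gjet[of 1] B_tame E_tame
    by (intro jet_add jet_mult tame_imp_jet) (auto simp: g1_def)
  moreover have "(\<lambda>s. g s powr (1 + p) * W s powr - p) \<in> slow"
    by (intro slow_mult tame_slow[OF gp] tame_slow[OF Wp])
  ultimately have "jet \<Gamma> (Suc n) (\<lambda>s. g s powr (1 + p) * W s powr - p) B"
    by auto
  from jet_cong[OF this f0] have H0: "jet \<Gamma> (Suc n) (\<lambda>s. H 0 (s * Q s)) B" .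
  have "\<forall>\<^sub>F s in at_right 0. 0 < s * Q s"
    using ev_s Qpos by eventually_elim simp
  from jet_chain[OF dH dR this R'pos q_tame H0, of "Suc n"]
  have e_slow: "(\<lambda>s. H (Suc n) (s * Q s) - (1 / R' s) ^ Suc n * B s * \<Gamma> s) \<in> slow" (is "?e \<in> slow")
    by simp
  have "(\<lambda>s. ?e s * Q s ^ (n + 2)) \<in> slow"
    by (intro slow_mult e_slow slow_power Q_slow)
  then have "(\<lambda>s. ?e s * Q s ^ (n + 2)) \<in> O[at_right 0](\<lambda>s. s powr - (\<eta> / 2))"
    using big by (intro slowD) auto
  also have "(\<lambda>s. s powr - (\<eta> / 2)) \<in> o[at_right 0](\<lambda>s. s powr - \<eta>)"
  proof (rule smalloI_tendsto)
    have "((\<lambda>s. s powr (\<eta> / 2)) \<longlongrightarrow> 0) (at_right 0)"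
    proof -
      have "\<forall>\<^sub>F s in at_right 0. 0 \<le> (s::real)"
        using ev_s by eventually_elim simp
      then show ?thesis
        using tendsto_powr'[OF tendsto_ident_at tendsto_const[of "\<eta> / 2"], of 0 "{0<..}"] big(1)
        by simp
    qed
    moreover have "\<forall>\<^sub>F s in at_right 0. s powr (\<eta> / 2) = s powr - (\<eta> / 2) / s powr - \<eta>"
      using ev_s by eventually_elim (simp flip: powr_diff)
    ultimately show "((\<lambda>s. s powr - (\<eta> / 2) / s powr - \<eta>) \<longlongrightarrow> 0) (at_right 0)"
      by (rule Lim_transform_eventually)
    show "\<forall>\<^sub>F s in at_right 0. s powr - \<eta> \<noteq> 0"
      using ev_s by eventually_elim simp
  qed
  also note big(2)
  finally have err: "((\<lambda>s. ?e s * Q s ^ (n + 2) / \<Gamma> s) \<longlongrightarrow> 0) (at_right 0)"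
    unfolding \<Gamma>_def by (rule smalloD_tendsto)
  have BQ: "((\<lambda>s. B s * Q s) \<longlongrightarrow> t) (at_right 0)"
  proof -
    have "((\<lambda>s. (1 + p) + p * (s * g s) / W s) \<longlongrightarrow> (1 + p) + p * 0 / 1) (at_right 0)"
      using lim0 W_lim by (intro tendsto_intros) (auto simp: g_def)
    then have "((\<lambda>s. (1 + p) + p * (s * g s) / W s) \<longlongrightarrow> t) (at_right 0)"
      by (simp add: p_def)
    moreover have "\<forall>\<^sub>F s in at_right 0. (1 + p) + p * (s * g s) / W s = B s * Q s"
      using Q_eq gpos Wpos
    proof eventually_elim
      case (elim s)
      define a where "a = W s powr p"
      define b where "b = g s powr p"
      have ab: "0 < a" "0 < b" "W s powr - p = 1 / a" "g s powr - p = 1 / b"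
          "W s powr (- p - 1) = 1 / a / W s" "g s powr (1 + p) = g s * b"
        using elim by (auto simp: a_def b_def powr_diff powr_add powr_minus_divide)
      show ?case
        using elim(2,3) ab(1,2) unfolding elim(1) B_def ab(3-6) a_def[symmetric] b_def[symmetric]
        by (simp add: field_simps)
    qed
    ultimately show ?thesis
      by (rule Lim_transform_eventually)
  qed
  have "((\<lambda>s. B s * Q s * (Q s / R' s) ^ Suc n + ?e s * Q s ^ (n + 2) / \<Gamma> s) \<longlongrightarrow> t * 1 ^ Suc n + 0) (at_right 0)"
    by (intro tendsto_intros BQ QR' err)
  then have lim: "((\<lambda>s. B s * Q s * (Q s / R' s) ^ Suc n + ?e s * Q s ^ (n + 2) / \<Gamma> s) \<longlongrightarrow> t) (at_right 0)"
    by simp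
  have "\<forall>\<^sub>F s in at_right 0. \<Gamma> s \<noteq> 0"
  proof -
    obtain C where "\<forall>\<^sub>F s in at_right 0. norm (s powr - \<eta>) \<le> C * norm (\<Gamma> s)"
      using big(2) unfolding \<Gamma>_def by (elim landau_o.bigE) blast
    then show ?thesis
      using ev_s by eventually_elim auto
  qed
  then have "\<forall>\<^sub>F s in at_right 0. B s * Q s * (Q s / R' s) ^ Suc n + ?e s * Q s ^ (n + 2) / \<Gamma> s =
      H (Suc n) (s * Q s) * Q s ^ (n + 2) / \<Gamma> s"
    by eventually_elim (simp add: field_simps power_divide)
  with lim show ?thesis
    unfolding \<Gamma>_def by (rule Lim_transform_eventually)
qed

section \<open>Free multiplicative powers as a change of variable\<close>

text \<open>Up to the factor \<open>(- 1) ^ (k - 1) (k - 1)!\<close>, this is the derivative of order \<open>k - 1\<close> of the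
  case \<open>k = 1\<close>, which is \<open>- \<psi>(- s) / s\<close>.\<close>

definition kernel_moment :: "real measure \<Rightarrow> nat \<Rightarrow> real \<Rightarrow> real" where
  "kernel_moment \<mu> k s = (LINT t|\<mu>. (t / (1 + s * t)) ^ k)"

lemma kernel_moment_eq:
  assumes "0 < x"
  shows "kernel_moment \<mu> k (inverse x) = x ^ k * stieltjes \<mu> k x"
proof -
  have eq: "t / (1 + inverse x * t) = x * (t / (t + x))" for t
    using assms by (simp add: divide_simps)
  show ?thesis
    unfolding kernel_moment_def stieltjes_def eq power_mult_distrib by simp
qed

lemma inverse_kernel_bounds:
  fixes s t :: real
  assumes "0 < s" "0 \<le> t"
  shows "0 \<le> t / (1 + s * t)" "t / (1 + s * t) \<le> 1 / s"
  using assms by (auto simp: field_simps add_pos_nonneg)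

context half_line_distribution
begin

lemma DERIV_kernel_moment:
  assumes s: "0 < s"
  shows "(kernel_moment M k has_real_derivative - real k * kernel_moment M (Suc k) s) (at s)"
proof -
  define v where "v = (\<lambda>(r::real) (t::real). t / (1 + r * t))"
  have int: "integrable M (\<lambda>t. v r t ^ j)" if "0 < r" for r j
  proof (rule integrable_const_bound[where B = "(1 / r) ^ j"])
    show "AE t in M. norm (v r t ^ j) \<le> (1 / r) ^ j"
      using AE_nonneg
      by eventually_elim (use inverse_kernel_bounds that in \<open>auto simp: v_def power_abs intro!: power_mono\<close>)
  qed (simp add: v_def)
  \<comment> \<open>The difference quotient of \<open>v r t ^ k\<close> in \<open>r\<close> is bounded by telescoping.\<close>
  define D where "D = (\<lambda>r t. - (v s t * v r t) * (\<Sum>i<k. v s t ^ (k - Suc i) * v r t ^ i))"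
  have quot: "(v r t ^ k - v s t ^ k) / (r - s) = D r t" if "0 \<le> t" "0 < r" "r \<noteq> s" for r t
  proof -
    have "0 < 1 + r * t" "0 < 1 + s * t"
      using that s by (auto intro!: add_pos_nonneg)
    then have "v r t - v s t = - (v s t * v r t) * (r - s)"
      by (simp add: v_def divide_simps) (simp add: algebra_simps)
    then show ?thesis
      using that(3) power_diff_sumr2[of "v r t" k "v s t"] by (simp add: D_def)
  qed
  have "((\<lambda>r. (kernel_moment M k r - kernel_moment M k s) / (r - s)) \<longlongrightarrow>
      - real k * kernel_moment M (Suc k) s) (at s within {s / 2<..})"
    unfolding tendsto_at_iff_sequentially
  proof (intro allI impI)
    fix X :: "nat \<Rightarrow> real"
    assume X: "\<forall>i. X i \<in> {s / 2<..} - {s}" "X \<longlonglongrightarrow> s"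
    then have Xpos: "s / 2 < X i" "0 < X i" "X i \<noteq> s" for i
      using s by (auto intro: less_trans[of 0 "s / 2"])
    have "(\<lambda>i. LINT t|M. D (X i) t) \<longlonglongrightarrow> (LINT t|M. - real k * v s t ^ Suc k)"
    proof (rule integral_dominated_convergence[where w = "\<lambda>_. (2 / s * (2 / s)) * (\<Sum>i<k. (2 / s) ^ (k - Suc i) * (2 / s) ^ i)"])
      show "AE t in M. (\<lambda>i. D (X i) t) \<longlonglongrightarrow> - real k * v s t ^ Suc k"
        using AE_nonneg
      proof eventually_elim
        case (elim t)
        have "1 + s * t \<noteq> 0"
          using elim s by (simp add: add_pos_nonneg less_imp_neq[symmetric])
        then have "(\<lambda>i. v (X i) t) \<longlonglongrightarrow> v s t"
          unfolding v_def using X(2) by (intro tendsto_intros)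
        then have "(\<lambda>i. D (X i) t) \<longlonglongrightarrow> - (v s t * v s t) * (\<Sum>i<k. v s t ^ (k - Suc i) * v s t ^ i)"
          unfolding D_def by (intro tendsto_intros)
        also have "(\<Sum>i<k. v s t ^ (k - Suc i) * v s t ^ i) = (\<Sum>i<k. v s t ^ (k - 1))"
          by (intro sum.cong) (auto simp flip: power_add)
        also have "- (v s t * v s t) * \<dots> = - real k * v s t ^ Suc k"
          by (cases k) (auto simp: algebra_simps)
        finally show ?case .
      qed
      show "AE t in M. norm (D (X i) t) \<le> (2 / s * (2 / s)) * (\<Sum>i<k. (2 / s) ^ (k - Suc i) * (2 / s) ^ i)" for i
        using AE_nonneg
      proof eventually_elim
        case (elim t)
        have "v s t \<le> 1 / s" "v (X i) t \<le> 1 / X i" "0 \<le> v s t" "0 \<le> v (X i) t"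
          using inverse_kernel_bounds[OF _ elim] s Xpos(2) by (auto simp: v_def)
        moreover have "1 / s \<le> 2 / s" "1 / X i \<le> 2 / s"
          using s Xpos(1,2)[of i] by (auto simp: field_simps)
        ultimately have b: "v s t \<le> 2 / s" "v (X i) t \<le> 2 / s" "0 \<le> v s t" "0 \<le> v (X i) t"
          by linarith+
        have "norm (D (X i) t) = (v s t * v (X i) t) * (\<Sum>j<k. v s t ^ (k - Suc j) * v (X i) t ^ j)"
          unfolding D_def using b by (simp add: abs_mult sum_nonneg)
        also have "\<dots> \<le> (2 / s * (2 / s)) * (\<Sum>i<k. (2 / s) ^ (k - Suc i) * (2 / s) ^ i)"
          using b s by (intro mult_mono sum_mono power_mono sum_nonneg) auto
        finally show ?case .
      qed
    qed (auto simp: D_def v_def)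
    moreover have "(LINT t|M. D (X i) t) =
        (kernel_moment M k (X i) - kernel_moment M k s) / (X i - s)" for i
    proof -
      have "(LINT t|M. D (X i) t) = (LINT t|M. (v (X i) t ^ k - v s t ^ k) / (X i - s))"
      proof (rule integral_cong_AE)
        show "AE t in M. D (X i) t = (v (X i) t ^ k - v s t ^ k) / (X i - s)"
          using AE_nonneg by eventually_elim (use quot Xpos in auto)
      qed (auto simp: D_def v_def)
      also have "\<dots> = (kernel_moment M k (X i) - kernel_moment M k s) / (X i - s)"
        using int[OF Xpos(2), of i k] int[OF s, of k]
        by (simp add: kernel_moment_def v_def)
      finally show ?thesis .
    qed
    moreover have "(LINT t|M. - real k * v s t ^ Suc k) = - real k * kernel_moment M (Suc k) s"
      by (simp add: kernel_moment_def v_def del: power_Suc)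
    ultimately show "((\<lambda>r. (kernel_moment M k r - kernel_moment M k s) / (r - s)) \<circ> X) \<longlonglongrightarrow>
        - real k * kernel_moment M (Suc k) s"
      unfolding o_def by (simp only:)
  qed
  then show ?thesis
    using s by (simp add: has_field_derivative_iff at_within_open[of s "{s / 2<..}"])
qed

lemma stieltjes_continuous_on: "continuous_on {0<..} (stieltjes M n)"
proof -
  have "continuous_on {0<..} (kernel_moment M n)"
    by (intro continuous_at_imp_continuous_on ballI)
      (auto intro: DERIV_isCont[OF DERIV_kernel_moment])
  then have "continuous_on {0<..} (\<lambda>x. kernel_moment M n (inverse x))"
    by (rule continuous_on_compose2) (auto intro!: continuous_on_inverse continuous_on_id)
  then have "continuous_on {0<..} (\<lambda>x. kernel_moment M n (inverse x) / x ^ n)"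
    by (intro continuous_on_divide continuous_on_power continuous_on_id) auto
  then show ?thesis
    by (rule continuous_on_eq) (simp add: kernel_moment_eq)
qed

lemma stieltjes_1_strict_antimono:
  assumes atom: "measure M {0} < 1" and xy: "0 < x" "x < y"
  shows "stieltjes M 1 y < stieltjes M 1 x"
proof (rule ccontr)
  assume "\<not> ?thesis"
  then have "stieltjes M 1 x = stieltjes M 1 y"
    using stieltjes_antimono[of x y 1] xy by simp
  note int = kernel_integrable[of x 1, unfolded power_one_right] kernel_integrable[of y 1, unfolded power_one_right]
  define d where "d = (\<lambda>t. t / (t + x) - t / (t + y))"
  have d: "d t = t * (y - x) / ((t + x) * (t + y))" if "0 \<le> t" for t
  proof -
    have "0 < t + x" "0 < t + y"
      using that xy by auto
    then show ?thesis
      by (simp add: d_def divide_simps) (simp add: algebra_simps)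
  qed
  have "(LINT t|M. d t) = 0"
    using int xy \<open>stieltjes M 1 x = stieltjes M 1 y\<close> by (simp add: d_def stieltjes_def)
  moreover have "AE t in M. 0 \<le> d t"
    using AE_nonneg by eventually_elim (use xy in \<open>auto simp: d\<close>)
  ultimately have "AE t in M. d t = 0"
    using int xy by (subst (asm) integral_nonneg_eq_0_iff_AE) (auto simp: d_def)
  then have "AE t in M. t \<in> {0}"
    using AE_nonneg by eventually_elim (use xy in \<open>auto simp: d\<close>)
  then show False
    using atom by (subst (asm) AE_in_set_eq_1) auto
qed

lemma psi_eq_stieltjes:
  assumes "0 < x"
  shows "psi M (- 1 / x) = - stieltjes M 1 x"
proof -
  have eq: "(- 1 / x) * t / (1 - (- 1 / x) * t) = - (t / (t + x))" for t
    using assms by (simp add: divide_simps)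
  show ?thesis
    unfolding psi_def stieltjes_def eq by simp
qed

lemma psi_inj_on:
  assumes "measure M {0} < 1"
  shows "inj_on (psi M) {..<0}"
proof (rule inj_onI)
  fix z w assume "z \<in> {..<0}" "w \<in> {..<0}" and eq: "psi M z = psi M w"
  then have zw: "0 < - 1 / z" "0 < - 1 / w" "z = - 1 / (- 1 / z)" "w = - 1 / (- 1 / w)"
    by auto
  have "stieltjes M 1 (- 1 / z) = stieltjes M 1 (- 1 / w)"
    using eq psi_eq_stieltjes[OF zw(1)] psi_eq_stieltjes[OF zw(2)] zw(3,4) by simp
  then have "- 1 / z = - 1 / w"
    using stieltjes_1_strict_antimono[OF assms zw(1), of "- 1 / w"]
      stieltjes_1_strict_antimono[OF assms zw(2), of "- 1 / z"]
    by (cases "- 1 / z" "- 1 / w" rule: linorder_cases) auto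
  then show "z = w"
    using zw(3,4) by simp
qed

lemma S_transform_eq:
  assumes "measure M {0} < 1" "0 < x"
  shows "S_transform M (- stieltjes M 1 x) = (1 - stieltjes M 1 x) / stieltjes M 1 x / x"
proof -
  have "chi M (- stieltjes M 1 x) = - 1 / x"
    unfolding chi_def using assms
    by (intro the_inv_into_f_eq psi_inj_on psi_eq_stieltjes) auto
  then show ?thesis
    by (simp add: S_transform_def)
qed

end

text \<open>If \<open>stieltjes \<mu> 1 x = u = stieltjes \<nu> 1 y\<close>, then \<open>S_transform\<close> at \<open>- u\<close> is \<open>(1 - u) / (u x)\<close> for
  \<open>\<mu>\<close> and \<open>(1 - u) / (u y)\<close> for \<open>\<nu>\<close>.  The curve is the solution \<open>y\<close> of
  \<open>(1 - u) / (u y) = ((1 - u) / (u x)) powr t\<close>.\<close>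

definition power_curve :: "real measure \<Rightarrow> real \<Rightarrow> real \<Rightarrow> real" where
  "power_curve \<mu> t x = x * (x * stieltjes \<mu> 1 x / (1 - stieltjes \<mu> 1 x)) powr (t - 1)"

locale free_power =
  fixes \<mu> \<nu> :: "real measure" and t :: real
  assumes \<mu>_M_plus: "\<mu> \<in> M_plus" and power: "is_free_mult_power \<mu> t \<nu>" and t_ge_1: "1 \<le> t"
begin

sublocale \<mu>: half_line_distribution \<mu>
  by (rule half_line_distribution_of_M_plus[OF \<mu>_M_plus])

sublocale \<nu>: half_line_distribution \<nu>
  by (rule half_line_distribution_of_M_plus) (use power in \<open>simp add: is_free_mult_power_def\<close>)

lemma atoms: "measure \<mu> {0} < 1" "measure \<nu> {0} < 1"
  using power by (auto simp: is_free_mult_power_def)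

abbreviation X :: "real \<Rightarrow> real" where "X \<equiv> power_curve \<mu> t"
abbreviation U :: "nat \<Rightarrow> real \<Rightarrow> real" where "U \<equiv> stieltjes \<mu>"
abbreviation V :: "nat \<Rightarrow> real \<Rightarrow> real" where "V \<equiv> stieltjes \<nu>"

lemma stieltjes_power_curve:
  "\<forall>\<^sub>F x in at_top. 1 \<le> X x \<and> V 1 (X x) = U 1 x"
proof -
  obtain \<epsilon> where \<epsilon>: "\<epsilon> > 0" "\<And>z. z \<in> {-\<epsilon><..<0} \<Longrightarrow> S_transform \<nu> z = S_transform \<mu> z powr t"
    using power by (auto simp: is_free_mult_power_def)
  have "0 < min (min \<epsilon> 1) (V 1 1)"
    using \<epsilon>(1) \<nu>.stieltjes_pos[OF atoms(2)] by simp
  from order_tendstoD(2)[OF \<mu>.stieltjes_tendsto_0[OF zero_less_one] this] eventually_gt_at_top[of 0]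
  show ?thesis
  proof eventually_elim
    case (elim x)
    define u where "u = U 1 x"
    have u: "0 < u" "u < \<epsilon>" "u < 1" "u < V 1 1"
      using elim \<mu>.stieltjes_pos[OF atoms(1)] by (auto simp: u_def)
    have "\<forall>\<^sub>F y in at_top. V 1 y < u \<and> 1 \<le> y"
      using order_tendstoD(2)[OF \<nu>.stieltjes_tendsto_0[OF zero_less_one] u(1)]
      by (intro eventually_conj eventually_ge_at_top) auto
    then obtain z where "V 1 z < u" "1 \<le> z"
      using eventually_happens' trivial_limit_at_top_linorder by blast
    moreover have "continuous_on {1..z} (V 1)"
      by (rule continuous_on_subset[OF \<nu>.stieltjes_continuous_on]) auto
    ultimately obtain y where y: "1 \<le> y" "V 1 y = u"
      using IVT2'[of "V 1" z u 1] u(4) by auto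
    have "S_transform \<nu> (- u) = S_transform \<mu> (- u) powr t"
      using u by (intro \<epsilon>(2)) auto
    moreover have "S_transform \<nu> (- u) = (1 - u) / u / y"
      using \<nu>.S_transform_eq[OF atoms(2), of y] y by simp
    moreover have "S_transform \<mu> (- u) = (1 - u) / u / x"
      using \<mu>.S_transform_eq[OF atoms(1) elim(2)] by (simp add: u_def)
    ultimately have eq: "(1 - u) / u / y = ((1 - u) / u / x) powr t"
      by simp
    define w where "w = (1 - u) / u / x"
    have w: "0 < w"
      using u elim by (simp add: w_def)
    have "w * x / y = w powr t"
      using eq elim by (simp add: w_def)
    then have "y = w * x / w powr t"
      using w y by (simp add: field_simps)
    also have "\<dots> = x * (1 / w) powr (t - 1)"
      using w by (simp add: powr_divide powr_diff)
    also have "1 / w = x * u / (1 - u)"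
      by (simp add: w_def)
    finally have "X x = y"
      by (simp add: power_curve_def u_def)
    with y show ?case
      by (simp add: u_def)
  qed
qed

lemma power_curve_at_top: "filterlim X at_top at_top"
  unfolding filterlim_at_top
proof
  fix Z :: real
  define Z' where "Z' = max Z 1"
  have "0 < V 1 Z'"
    by (rule \<nu>.stieltjes_pos[OF atoms(2)]) (simp add: Z'_def)
  from order_tendstoD(2)[OF \<mu>.stieltjes_tendsto_0[OF zero_less_one] this] stieltjes_power_curve
  show "\<forall>\<^sub>F x in at_top. Z \<le> X x"
  proof eventually_elim
    case (elim x)
    have "Z' \<le> X x"
    proof (rule ccontr)
      assume "\<not> Z' \<le> X x"
      then have "V 1 Z' \<le> V 1 (X x)"
        using elim by (intro \<nu>.stieltjes_antimono) auto
      with elim show False by simp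
    qed
    then show ?case
      by (simp add: Z'_def)
  qed
qed

lemma power_curve_continuous: "\<exists>a. continuous_on {a..} X"
proof -
  have "\<forall>\<^sub>F x in at_top. U 1 x < 1 \<and> 0 < x"
    using order_tendstoD(2)[OF \<mu>.stieltjes_tendsto_0[OF zero_less_one], of 1]
    by (intro eventually_conj eventually_gt_at_top) auto
  then obtain a where a: "\<And>x. a \<le> x \<Longrightarrow> U 1 x < 1 \<and> 0 < x"
    by (auto simp: eventually_at_top_linorder)
  have c: "continuous_on {a..} (U 1)"
    using a by (intro continuous_on_subset[OF \<mu>.stieltjes_continuous_on]) auto
  have nz: "1 - U 1 x \<noteq> 0" "x * U 1 x / (1 - U 1 x) \<noteq> 0" if "x \<in> {a..}" for x
    using a[of x] that \<mu>.stieltjes_pos[OF atoms(1), of x 1] by auto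
  have "continuous_on {a..} X"
    unfolding power_curve_def using nz
    by (intro continuous_on_mult continuous_on_id continuous_on_powr continuous_on_divide
        continuous_on_diff continuous_on_const c ballI)
  then show ?thesis by blast
qed

lemma tendsto_along_power_curve:
  fixes f :: "real \<Rightarrow> real"
  assumes "((\<lambda>x. f (X x)) \<longlongrightarrow> L) at_top"
  shows "(f \<longlongrightarrow> L) at_top"
  using power_curve_continuous tendsto_along_curve[OF _ power_curve_at_top assms] by blast

end

text \<open>Integrating \<open>\<bar>f' s\<bar> \<le> C s powr (- 1 - \<epsilon>)\<close>: the bound \<open>(C / \<epsilon>) s powr (- \<epsilon>)\<close> dominates
  the growth of \<open>f\<close> in both directions.\<close>

lemma slow_of_derivative:
  assumes f: "\<And>s. 0 < s \<Longrightarrow> (f has_real_derivative f' s) (at s)" and f': "(\<lambda>s. s * f' s) \<in> slow"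
  shows "f \<in> slow"
proof (rule slowI)
  fix \<epsilon> :: real assume \<epsilon>: "\<epsilon> > 0"
  obtain C where C: "C > 0" "\<forall>\<^sub>F s in at_right 0. norm (s * f' s) \<le> C * norm (s powr - \<epsilon>)"
    using slowD[OF f' \<epsilon>] by (elim landau_o.bigE) blast
  then obtain b where b: "b > 0" "\<And>s. 0 < s \<Longrightarrow> s < b \<Longrightarrow> \<bar>s * f' s\<bar> \<le> C * s powr - \<epsilon>"
    by (auto simp: eventually_at_right_field)
  define c where "c = b / 2"
  have c: "0 < c" "c < b"
    using b by (auto simp: c_def)
  define h where "h = (\<lambda>s::real. C / \<epsilon> * s powr - \<epsilon>)"
  have f'_bound: "\<bar>f' s\<bar> \<le> C * s powr (- \<epsilon> - 1)" if "0 < s" "s < b" for s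
    using b(2)[OF that] that by (simp add: abs_mult powr_diff field_simps)
  have dh: "(h has_real_derivative - C * s powr (- \<epsilon> - 1)) (at s)" if "0 < s" for s
  proof -
    have "(h has_real_derivative C / \<epsilon> * (- \<epsilon> * s powr (- \<epsilon> - 1) * 1)) (at s)"
      unfolding h_def using that by (intro DERIV_cmult DERIV_powr_const DERIV_ident)
    then show ?thesis using \<epsilon> by simp
  qed
  have bound: "\<bar>f s\<bar> \<le> \<bar>f c\<bar> + h s" if s: "0 < s" "s < c" for s
  proof -
    have "f c + h c \<le> f s + h s"
    proof (rule DERIV_nonpos_imp_nonincreasing[of s c "\<lambda>s. f s + h s"])
      fix r assume "s \<le> r" "r \<le> c"
      then have r: "0 < r" "r < b" using s c by auto
      show "\<exists>y. ((\<lambda>s. f s + h s) has_real_derivative y) (at r) \<and> y \<le> 0"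
        using f'_bound[OF r] 
        by (intro exI[of _ "f' r + - C * r powr (- \<epsilon> - 1)"] conjI DERIV_add f dh r) linarith
    qed (use s in auto)
    moreover have "- f c + h c \<le> - f s + h s"
    proof (rule DERIV_nonpos_imp_nonincreasing[of s c "\<lambda>s. - f s + h s"])
      fix r assume "s \<le> r" "r \<le> c"
      then have r: "0 < r" "r < b" using s c by auto
      show "\<exists>y. ((\<lambda>s. - f s + h s) has_real_derivative y) (at r) \<and> y \<le> 0"
        using f'_bound[OF r] 
        by (intro exI[of _ "- f' r + - C * r powr (- \<epsilon> - 1)"] conjI DERIV_add DERIV_minus f dh r) linarith
    qed (use s in auto)
    moreover have "0 \<le> h c"
      using C \<epsilon> by (simp add: h_def)
    ultimately show ?thesis by linarith
  qed
  have "\<forall>\<^sub>F s in at_right 0. norm (f s) \<le> norm (\<bar>f c\<bar> + h s)"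
    using eventually_at_right_real[OF c(1)]
    by eventually_elim (use bound in \<open>auto intro!: order.trans[OF bound]\<close>)
  then have "f \<in> O[at_right 0](\<lambda>s. \<bar>f c\<bar> + h s)"
    by (intro landau_o.bigI[of 1]) auto
  also have "(\<lambda>s. \<bar>f c\<bar> + h s) \<in> O[at_right 0](\<lambda>s. s powr - \<epsilon>)"
  proof (intro sum_in_bigo slowD[OF slow_const \<epsilon>])
    show "h \<in> O[at_right 0](\<lambda>s. s powr - \<epsilon>)"
      using C \<epsilon> by (intro bigoI[of _ "C / \<epsilon>"]) (simp add: h_def)
  qed
  finally show "f \<in> O[at_right 0](\<lambda>s. s powr - \<epsilon>)" .
qed

lemma inverse_powr_uminus:
  fixes s :: real
  assumes "0 < s"
  shows "inverse s powr - a = s powr a"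
  using assms by (simp add: inverse_eq_divide powr_divide powr_minus_divide)

context free_power
begin

text \<open>An index \<open>\<alpha>\<close> between \<open>n + 1\<close> and \<open>n + 2\<close> first shows in the derivative of order \<open>n + 1\<close> of
  \<open>kernel_moment \<mu> 1\<close>: up to slow factors it grows like
  \<open>s powr (\<alpha> - n - 2)\<close>, whereas the derivatives of lower order are slow.  With
  \<open>s = 1 / x\<close> and \<open>s Q s = 1 / X x\<close>, the claim becomes the theorem on derivatives.\<close>

theorem stieltjes_power_ratio:
  assumes U: "varies (- \<alpha>) (U (n + 2))" and \<alpha>: "real n + 1 \<le> \<alpha>" "\<alpha> < real n + 2"
    and lim1: "((\<lambda>s. s * kernel_moment \<mu> 2 s / kernel_moment \<mu> 1 s) \<longlongrightarrow> 0) (at_right 0)"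
  shows "((\<lambda>x. V (n + 2) (X x) / U (n + 2) x) \<longlongrightarrow> t) at_top"
proof -
  define J where "J = kernel_moment"
  define G where "G = (\<lambda>k s. (-1) ^ k * fact k * J \<mu> (Suc k) s)"
  define H where "H = (\<lambda>k s. (-1) ^ k * fact k * J \<nu> (Suc k) s)"
  define Q where "Q = (\<lambda>s. ((1 - s * G 0 s) / G 0 s) powr (t - 1))"
  note ev_s = eventually_at_right_less[of "0::real"]
  have at_inv: "J M k s = stieltjes M k (inverse s) / s ^ k" if "0 < s" for M k s
    using kernel_moment_eq[of "inverse s" M k] that by (simp add: J_def field_simps)
  have dG: "(G k has_real_derivative G (Suc k) s) (at s)" if "0 < s" for k s
    unfolding G_def J_def
    by (rule DERIV_cong[OF DERIV_cmult[OF \<mu>.DERIV_kernel_moment[OF that]]]) (simp add: algebra_simps)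
  have dH: "(H k has_real_derivative H (Suc k) s) (at s)" if "0 < s" for k s
    unfolding H_def J_def
    by (rule DERIV_cong[OF DERIV_cmult[OF \<nu>.DERIV_kernel_moment[OF that]]]) (simp add: algebra_simps)
  have J_pos: "0 < J \<mu> k s" if "0 < s" for k s
    using \<mu>.stieltjes_pos[OF atoms(1), of "inverse s"] that by (simp add: at_inv)
  have inv_top: "filterlim inverse at_top (at_right (0::real))"
    by (rule filterlim_inverse_at_top_right)
  have sJN: "(\<lambda>s. s * G (Suc n) s) \<in> slow"
  proof (rule slowI)
    fix \<epsilon> :: real assume "\<epsilon> > 0"
    define \<epsilon>' where "\<epsilon>' = min \<epsilon> 1"
    have \<epsilon>': "0 < \<epsilon>'" "\<epsilon>' \<le> \<alpha>" "\<epsilon>' \<le> \<epsilon>"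
      using \<open>\<epsilon> > 0\<close> \<alpha> by (auto simp: \<epsilon>'_def)
    obtain c where c: "\<forall>\<^sub>F x in at_top. U (n + 2) x \<le> c * x powr - (\<alpha> - \<epsilon>')"
      using varies_powr_upper_bound[OF \<mu>.stieltjes_antimono U \<epsilon>'(1,2)] by blast
    have "\<forall>\<^sub>F s in at_right 0. norm (s * J \<mu> (n + 2) s) \<le> \<bar>c\<bar> * norm (s powr - \<epsilon>)"
      using filterlim_iff[THEN iffD1, OF inv_top, rule_format, OF c]
        eventually_at_right_real[OF zero_less_one]
    proof eventually_elim
      case (elim s)
      then have s: "0 < s" "s < 1" by auto
      have "norm (s * J \<mu> (n + 2) s) = s powr (- real n - 1) * U (n + 2) (inverse s)"
        using s J_pos[OF s(1), of "n + 2"] \<mu>.stieltjes_nonneg[of "inverse s" "n + 2"]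
        by (simp add: abs_mult at_inv powr_diff powr_minus powr_realpow field_simps)
      also have "\<dots> \<le> s powr (- real n - 1) * (\<bar>c\<bar> * s powr (\<alpha> - \<epsilon>'))"
      proof (intro mult_left_mono order.trans[OF elim(1)])
        have "inverse s powr - (\<alpha> - \<epsilon>') = s powr (\<alpha> - \<epsilon>')"
          by (rule inverse_powr_uminus[OF s(1)])
        then show "c * inverse s powr - (\<alpha> - \<epsilon>') \<le> \<bar>c\<bar> * s powr (\<alpha> - \<epsilon>')"
          by (simp add: mult_right_mono)
      qed simp
      also have "\<dots> = \<bar>c\<bar> * s powr (- real n - 1 + (\<alpha> - \<epsilon>'))"
        using s by (simp only: powr_add mult_ac)
      also have "\<dots> \<le> \<bar>c\<bar> * s powr - \<epsilon>"
        using s \<alpha> \<epsilon>' by (intro mult_left_mono powr_mono') auto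
      finally show ?case by simp
    qed
    then have "(\<lambda>s. s * J \<mu> (n + 2) s) \<in> O[at_right 0](\<lambda>s. s powr - \<epsilon>)"
      by (rule bigoI)
    then have "(\<lambda>s. (-1) ^ Suc n * fact (Suc n) * (s * J \<mu> (n + 2) s)) \<in> O[at_right 0](\<lambda>s. s powr - \<epsilon>)"
      by simp
    then show "(\<lambda>s. s * G (Suc n) s) \<in> O[at_right 0](\<lambda>s. s powr - \<epsilon>)"
      by (simp add: G_def mult_ac)
  qed
  have sG_slow: "(\<lambda>s. s * G (Suc k) s) \<in> slow" if "k \<le> n" for k
    using that
  proof (induction rule: inc_induct)
    case (step k)
    show ?case
      by (rule slow_mult[OF slow_ident slow_of_derivative[OF dG step.IH]])
  qed (rule sJN)
  have G_slow: "G k \<in> slow" if "k \<le> n" for k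
    by (rule slow_of_derivative[OF dG sG_slow[OF that]])
  have G0: "G 0 s = U 1 (inverse s) / s" if "0 < s" for s
    using at_inv[OF that, of \<mu> 1] by (simp add: G_def)
  have inv_slow: "(\<lambda>s. 1 / G 0 s) \<in> slow"
  proof (rule slow_bounded)
    show "\<forall>\<^sub>F s in at_right 0. \<bar>1 / G 0 s\<bar> \<le> 1 / G 0 1"
      using eventually_at_right_real[OF zero_less_one]
    proof eventually_elim
      case (elim s)
      have "G 0 1 \<le> G 0 s"
      proof (rule DERIV_nonpos_imp_nonincreasing[of s 1 "G 0"])
        fix r assume "s \<le> r" "r \<le> 1"
        then have "0 < r" using elim by auto
        then show "\<exists>y. (G 0 has_real_derivative y) (at r) \<and> y \<le> 0"
          using dG[of r 0] J_pos[of r 2] by (auto simp: G_def numeral_2_eq_2)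
      qed (use elim in auto)
      then show ?case
        using J_pos[of s 1] J_pos[of 1 1] elim by (simp add: G_def divide_left_mono)
    qed
  qed
  have lim0: "((\<lambda>s. s * G 0 s) \<longlongrightarrow> 0) (at_right 0)"
  proof (rule Lim_transform_eventually)
    show "((\<lambda>s. U 1 (inverse s)) \<longlongrightarrow> 0) (at_right 0)"
      by (rule filterlim_compose[OF \<mu>.stieltjes_tendsto_0[OF zero_less_one] inv_top])
    show "\<forall>\<^sub>F s in at_right 0. U 1 (inverse s) = s * G 0 s"
      using ev_s by eventually_elim (simp add: G0)
  qed
  have lim1': "((\<lambda>s. s * G 1 s / G 0 s) \<longlongrightarrow> 0) (at_right 0)"
    using tendsto_minus[OF lim1] by (simp add: G_def J_def numeral_2_eq_2)
  define \<eta> where "\<eta> = (real n + 2 - \<alpha>) / 2"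
  have \<eta>: "0 < \<eta>" using \<alpha> by (simp add: \<eta>_def)
  have big: "(\<lambda>s. s powr - \<eta>) \<in> O[at_right 0](G (Suc n))"
  proof -
    obtain c where c: "c > 0" "\<forall>\<^sub>F x in at_top. c * x powr - (\<alpha> + \<eta>) \<le> U (n + 2) x"
      using varies_powr_lower_bound[OF \<mu>.stieltjes_antimono U _ \<eta>] \<alpha> by auto
    have "\<forall>\<^sub>F s in at_right 0. norm (s powr - \<eta>) \<le> 1 / (c * fact (Suc n)) * norm (G (Suc n) s)"
      using filterlim_iff[THEN iffD1, OF inv_top, rule_format, OF c(2)] ev_s
    proof eventually_elim
      case (elim s)
      have p1: "inverse s powr - (\<alpha> + \<eta>) = s powr (\<alpha> + \<eta>)"
        by (rule inverse_powr_uminus[OF elim(2)])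
      have p2: "s powr (\<alpha> + \<eta>) / s ^ (n + 2) = s powr - \<eta>"
      proof -
        have "s powr (\<alpha> + \<eta>) / s ^ (n + 2) = s powr (\<alpha> + \<eta> - real (n + 2))"
          unfolding powr_diff powr_realpow[OF elim(2)] ..
        also have "\<alpha> + \<eta> - real (n + 2) = - \<eta>"
          by (simp add: \<eta>_def field_simps)
        finally show ?thesis .
      qed
      have "c * s powr - \<eta> = c * inverse s powr - (\<alpha> + \<eta>) / s ^ (n + 2)"
        unfolding p1 p2[symmetric] by simp
      also have "\<dots> \<le> J \<mu> (n + 2) s"
        unfolding at_inv[OF elim(2)] using elim by (intro divide_right_mono) auto
      finally have "c * s powr - \<eta> \<le> J \<mu> (n + 2) s" .
      then have "s powr - \<eta> \<le> 1 / c * J \<mu> (n + 2) s"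
        using c(1) by (simp add: field_simps)
      also have "\<dots> = 1 / (c * fact (Suc n)) * (fact (Suc n) * J \<mu> (n + 2) s)"
        by (simp del: fact_Suc)
      also have "fact (Suc n) * J \<mu> (n + 2) s = norm (G (Suc n) s)"
        using J_pos[OF elim(2), of "n + 2"] by (simp add: G_def abs_mult power_abs del: fact_Suc)
      finally show ?case
        by simp
    qed
    then show ?thesis by (rule bigoI)
  qed
  have X_inv: "\<forall>\<^sub>F s in at_right 0. s * Q s = inverse (X (inverse s)) \<and> 0 < Q s"
  proof -
    have "\<forall>\<^sub>F x in at_top. U 1 x < 1"
      using order_tendstoD(2)[OF \<mu>.stieltjes_tendsto_0[OF zero_less_one], of 1] by simp
    from filterlim_iff[THEN iffD1, OF inv_top, rule_format, OF this] ev_s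
    show ?thesis
    proof eventually_elim
      case (elim s)
      define u where "u = U 1 (inverse s)"
      have u: "0 < u" "u < 1"
        using elim \<mu>.stieltjes_pos[OF atoms(1)] by (auto simp: u_def)
      define w where "w = (1 - u) / (u / s)"
      have w: "0 < w" using u elim by (simp add: w_def)
      have "Q s = w powr (t - 1)"
        using elim by (simp add: Q_def G0 w_def u_def)
      moreover have "X (inverse s) = inverse s * (1 / w) powr (t - 1)"
        using elim by (simp add: power_curve_def w_def u_def field_simps)
      moreover have "(1 / w) powr (t - 1) = inverse (w powr (t - 1))"
        using w by (simp add: powr_divide inverse_eq_divide)
      ultimately show ?case
        using w elim by simp
    qed
  qed
  note curve = filterlim_iff[THEN iffD1, OF inv_top, rule_format, OF stieltjes_power_curve]
  have H_at: "H k (s * Q s) = (-1) ^ k * fact k * V (Suc k) (X (inverse s)) / (s * Q s) ^ Suc k"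
    if "s * Q s = inverse (X (inverse s))" "1 \<le> X (inverse s)" for k s
    using that at_inv[of "s * Q s" \<nu> "Suc k"] by (simp add: H_def)
  have rel: "\<forall>\<^sub>F s in at_right 0. H 0 (s * Q s) = G 0 s / Q s"
    using X_inv curve ev_s
  proof eventually_elim
    case (elim s)
    have "H 0 (s * Q s) = (-1) ^ 0 * fact 0 * V (Suc 0) (X (inverse s)) / (s * Q s) ^ Suc 0"
      by (rule H_at) (use elim in auto)
    also have "\<dots> = U 1 (inverse s) / s / Q s"
      using elim(2) by simp
    finally show ?case
      by (simp add: G0[OF elim(3)])
  qed
  have lim: "((\<lambda>s. H (Suc n) (s * Q s) * Q s ^ (n + 2) / G (Suc n) s) \<longlongrightarrow> t) (at_right 0)"
    unfolding Q_def
    by (rule power_transform_derivatives[OF dG dH _ G_slow sJN inv_slow lim0 lim1' \<eta> big rel[unfolded Q_def]])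
      (use J_pos t_ge_1 in \<open>auto simp: G_def\<close>)
  have "\<forall>\<^sub>F s in at_right 0. H (Suc n) (s * Q s) * Q s ^ (n + 2) / G (Suc n) s =
      V (n + 2) (X (inverse s)) / U (n + 2) (inverse s)"
    using X_inv curve ev_s
  proof eventually_elim
    case (elim s)
    have "H (Suc n) (s * Q s) = (-1) ^ Suc n * fact (Suc n) *
        V (Suc (Suc n)) (X (inverse s)) / (s * Q s) ^ Suc (Suc n)"
      by (rule H_at) (use elim in auto)
    then have "H (Suc n) (s * Q s) = (-1) ^ Suc n * fact (Suc n) *
        (V (n + 2) (X (inverse s)) / (s ^ (n + 2) * Q s ^ (n + 2)))"
      by (simp add: power_mult_distrib del: power_Suc fact_Suc)
    moreover have "G (Suc n) s = (-1) ^ Suc n * fact (Suc n) * (U (n + 2) (inverse s) / s ^ (n + 2))"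
      using at_inv[OF elim(3), of \<mu> "n + 2"] by (simp add: G_def del: power_Suc fact_Suc)
    ultimately show ?case
      using elim(1,3) by (simp del: power_Suc fact_Suc)
  qed
  from Lim_transform_eventually[OF lim this]
  have "((\<lambda>s. V (n + 2) (X (inverse s)) / U (n + 2) (inverse s)) \<longlongrightarrow> t) (at_right 0)" .
  then show ?thesis
    by (simp add: filterlim_at_right_to_top)
qed

end

section \<open>Tails of free multiplicative powers\<close>

lemma varies_powr_mult:
  assumes "varies \<rho> f"
  shows "varies (a + \<rho>) (\<lambda>x. x powr a * f x)"
proof -
  have "\<forall>\<^sub>F x in at_top. 0 < x powr a * f x"
    using variesD(1)[OF assms] eventually_gt_at_top[of 0] by eventually_elim simp
  moreover have "((\<lambda>x. (l * x) powr a * f (l * x) / (x powr a * f x)) \<longlongrightarrow> l powr (a + \<rho>)) at_top"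
    if l: "0 < l" for l
  proof -
    have "((\<lambda>x. l powr a * (f (l * x) / f x)) \<longlongrightarrow> l powr a * l powr \<rho>) at_top"
      by (intro tendsto_intros variesD(2)[OF assms l])
    moreover have "\<forall>\<^sub>F x in at_top. l powr a * (f (l * x) / f x) =
        (l * x) powr a * f (l * x) / (x powr a * f x)"
      using eventually_gt_at_top[of 0] by eventually_elim (use l in \<open>simp add: powr_mult\<close>)
    ultimately show ?thesis
      unfolding powr_add by (rule Lim_transform_eventually)
  qed
  ultimately show ?thesis
    by (simp add: varies_def)
qed

lemma filterlim_powr_at_top:
  fixes p :: real
  assumes "0 < p"
  shows "filterlim (\<lambda>y. y powr p) at_top at_top"
proof (rule filterlim_cong[THEN iffD1, OF refl refl])
  show "filterlim (\<lambda>y. exp (p * ln y)) at_top at_top"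
    by (intro filterlim_compose[OF exp_at_top] filterlim_compose[OF filterlim_const_mult_at_top[OF assms]] ln_at_top)
  show "\<forall>\<^sub>F y in at_top. exp (p * ln y) = y powr p"
    using eventually_gt_at_top[of 0] by eventually_elim (simp add: powr_def)
qed

lemma varies_const: "0 < c \<Longrightarrow> varies 0 (\<lambda>_. c)"
  by (simp add: varies_def)

lemma ratio_of_asymp_equiv:
  fixes f g :: "real \<Rightarrow> real"
  assumes "f \<sim>[at_top] g" "\<forall>\<^sub>F x in at_top. 0 < g x"
  shows "((\<lambda>x. f x / g x) \<longlongrightarrow> 1) at_top"
  by (rule asymp_equivD_strong[OF assms(1)]) (use assms(2) in \<open>auto elim: eventually_mono\<close>)

lemma varies_of_asymp_equiv:
  assumes "f \<sim>[at_top] g" "varies \<rho> g"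
  shows "varies \<rho> f"
  using varies_of_ratio[OF assms(2) ratio_of_asymp_equiv[OF assms(1) variesD(1)[OF assms(2)]]] by simp

text \<open>The comparison theorem needs some distribution with a prescribed index; a power of the
  variable changes the index at will.\<close>

lemma (in half_line_distribution) exists_tail_index:
  assumes tail: "varies (- \<alpha>) (tail M)" and \<alpha>: "0 < \<alpha>" "0 < \<alpha>'"
  shows "\<exists>M'. half_line_distribution M' \<and> varies (- \<alpha>') (tail M')"
proof -
  define \<gamma> where "\<gamma> = \<alpha> / \<alpha>'"
  have \<gamma>: "0 < \<gamma>" "\<alpha> / \<gamma> = \<alpha>'" using \<alpha> by (auto simp: \<gamma>_def)
  define M' where "M' = distr M borel (\<lambda>x. x powr \<gamma>)"
  interpret M': prob_space M'
    unfolding M'_def by (intro prob_space_distr) simp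
  have "half_line_distribution M'"
  proof
    show "sets M' = sets borel" by (simp add: M'_def)
    show "AE t in M'. 0 \<le> t"
      unfolding M'_def by (subst AE_distr_iff) auto
  qed
  moreover have tail': "tail M' y = tail M (y powr (1 / \<gamma>))" if y: "0 < y" for y
  proof -
    have "tail M' y = measure M {x \<in> space M. y < x powr \<gamma>}"
      unfolding tail_def M'_def by (subst measure_distr) (auto simp: vimage_def)
    also have "\<dots> = tail M (y powr (1 / \<gamma>))"
      unfolding tail_def
    proof (rule finite_measure_eq_AE)
      show "AE x in M. x \<in> {x \<in> space M. y < x powr \<gamma>} \<longleftrightarrow> x \<in> {y powr (1 / \<gamma>)<..}"
        using AE_nonneg
      proof eventually_elim
        case (elim x)
        have "y < x powr \<gamma> \<longleftrightarrow> y powr (1 / \<gamma>) < x"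
        proof
          assume "y < x powr \<gamma>"
          then have "y powr (1 / \<gamma>) < (x powr \<gamma>) powr (1 / \<gamma>)"
            using y \<gamma> by (intro powr_less_mono2) auto
          also have "\<dots> = x"
            using \<gamma> elim by (simp add: powr_powr)
          finally show "y powr (1 / \<gamma>) < x" .
        next
          assume "y powr (1 / \<gamma>) < x"
          then have "(y powr (1 / \<gamma>)) powr \<gamma> < x powr \<gamma>"
            using \<gamma> by (intro powr_less_mono2) auto
          then show "y < x powr \<gamma>"
            using \<gamma> y by (simp add: powr_powr)
        qed
        then show ?case by simp
      qed
    qed auto
    finally show ?thesis .
  qed
  have "varies (- \<alpha>') (tail M')"
    unfolding varies_def
  proof (intro conjI allI impI)
    have top: "filterlim (\<lambda>y. y powr (1 / \<gamma>)) at_top at_top"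
      using \<gamma> by (intro filterlim_powr_at_top) auto
    show "\<forall>\<^sub>F y in at_top. 0 < tail M' y"
      using eventually_compose_filterlim[OF variesD(1)[OF tail] top] eventually_gt_at_top[of 0]
      by eventually_elim (simp add: tail')
    fix l :: real assume l: "0 < l"
    have "((\<lambda>y. tail M (l powr (1 / \<gamma>) * y powr (1 / \<gamma>)) / tail M (y powr (1 / \<gamma>))) \<longlongrightarrow>
        (l powr (1 / \<gamma>)) powr - \<alpha>) at_top"
      by (rule filterlim_compose[OF variesD(2)[OF tail] top]) (use l in simp)
    moreover have "\<forall>\<^sub>F y in at_top. tail M (l powr (1 / \<gamma>) * y powr (1 / \<gamma>)) / tail M (y powr (1 / \<gamma>)) =
        tail M' (l * y) / tail M' y"
      using eventually_gt_at_top[of 0] by eventually_elim (use l in \<open>simp add: tail' powr_mult\<close>)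
    moreover have "(l powr (1 / \<gamma>)) powr - \<alpha> = l powr - \<alpha>'"
      using \<gamma> by (simp add: powr_powr)
    ultimately show "((\<lambda>y. tail M' (l * y) / tail M' y) \<longlongrightarrow> l powr - \<alpha>') at_top"
      using Lim_transform_eventually by fastforce
  qed
  ultimately show ?thesis by blast
qed

text \<open>A slowly varying function stays above every negative power of \<open>x\<close>, so its logarithm is negligible
  against \<open>ln x\<close>.\<close>

lemma ln_ratio_tendsto_0:
  fixes f :: "real \<Rightarrow> real"
  assumes mono: "\<And>x y. 0 < x \<Longrightarrow> x \<le> y \<Longrightarrow> f y \<le> f x"
    and f: "varies 0 f" and le: "\<And>x. 0 < x \<Longrightarrow> f x \<le> 1"
  shows "((\<lambda>x. ln (f x) / ln x) \<longlongrightarrow> 0) at_top"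
proof (rule tendstoI)
  fix e :: real assume e: "e > 0"
  obtain c where c: "c > 0" "\<forall>\<^sub>F x in at_top. c * x powr - (0 + e / 2) \<le> f x"
    using varies_powr_lower_bound[where f = f and \<alpha> = 0 and \<epsilon> = "e / 2", OF mono] f e by auto
  have "((\<lambda>x. ln c / ln x) \<longlongrightarrow> 0) at_top"
    by (intro tendsto_divide_0[OF tendsto_const] filterlim_at_top_imp_at_infinity ln_at_top)
  then have "\<forall>\<^sub>F x in at_top. - (e / 2) < ln c / ln x"
    by (rule order_tendstoD) (use e in simp)
  with c(2) eventually_gt_at_top[of 1]
  show "\<forall>\<^sub>F x in at_top. dist (ln (f x) / ln x) 0 < e"
  proof eventually_elim
    case (elim x)
    have pos: "0 < c * x powr - (e / 2)" "0 < ln x"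
      using c elim by auto
    have "ln c - e / 2 * ln x = ln (c * x powr - (e / 2))"
      using c elim by (simp add: ln_mult ln_powr)
    also have "\<dots> \<le> ln (f x)"
      using pos elim by (intro ln_mono) auto
    finally have "(ln c - e / 2 * ln x) / ln x \<le> ln (f x) / ln x"
      using pos by (intro divide_right_mono) auto
    then have "- e < ln (f x) / ln x"
      using pos elim by (simp add: diff_divide_distrib)
    moreover have "ln (f x) / ln x \<le> 0"
      using pos elim le[of x] by (intro divide_nonpos_pos) auto
    ultimately show ?case
      using e by (simp add: dist_real_def)
  qed
qed

context free_power
begin

lemma one_minus_stieltjes_tendsto: "((\<lambda>x. 1 - U 1 x) \<longlongrightarrow> 1) at_top"
  using tendsto_diff[OF tendsto_const \<mu>.stieltjes_tendsto_0[OF zero_less_one], of 1] by simp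

lemma eventually_stieltjes_bounds:
  "\<forall>\<^sub>F x in at_top. 0 < x \<and> 0 < U 1 x \<and> U 1 x < 1"
  using order_tendstoD(2)[OF \<mu>.stieltjes_tendsto_0[OF zero_less_one] zero_less_one] eventually_gt_at_top[of 0]
  by eventually_elim (use \<mu>.stieltjes_pos[OF atoms(1)] in auto)

text \<open>When \<open>\<nu>\<close> keeps the index of \<open>\<mu>\<close>, the Abelian and the Tauberian constants cancel.\<close>

lemma tail_ratio_of_stieltjes_ratio:
  assumes tail: "varies (- \<alpha>) (tail \<mu>)" and \<alpha>: "0 \<le> \<alpha>" "\<alpha> < n"
    and ratio: "((\<lambda>x. V n x / U n x) \<longlongrightarrow> D) at_top" and D: "0 < D"
  shows "((\<lambda>x. tail \<nu> x / tail \<mu> x) \<longlongrightarrow> D) at_top"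
proof -
  define C where "C = n * Beta (n - \<alpha>) (1 + \<alpha>)"
  have C: "0 < C" unfolding C_def by (rule \<mu>.Abelian_constant_pos[OF \<alpha>])
  note U = \<mu>.varies_stieltjes_of_tail[OF tail \<alpha>]
  note V = varies_of_ratio[OF U ratio D]
  have "((\<lambda>x. tail \<nu> x / V n x * (V n x / U n x) * (U n x / tail \<mu> x)) \<longlongrightarrow>
      1 / C * D * C) at_top"
    unfolding C_def
    by (intro tendsto_mult ratio \<mu>.stieltjes_tail_ratio[OF tail \<alpha>]
        Tauberian_comparison[OF \<mu>.half_line_distribution_axioms \<nu>.half_line_distribution_axioms tail V \<alpha>])
  then have "((\<lambda>x. tail \<nu> x / V n x * (V n x / U n x) * (U n x / tail \<mu> x)) \<longlongrightarrow>
      D) at_top"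
    using C by simp
  then show ?thesis
    by (rule Lim_transform_eventually)
      (use variesD(1)[OF U] variesD(1)[OF V] in \<open>eventually_elim, simp\<close>)
qed

lemma ln_power_curve:
  "\<forall>\<^sub>F x in at_top. ln (X x) = ln x + (t - 1) * (ln x + ln (U 1 x) - ln (1 - U 1 x))"
  using eventually_stieltjes_bounds
  by eventually_elim (simp add: power_curve_def ln_mult ln_powr ln_div)

text \<open>For such a tail, which varies slowly, \<open>ln (U 1 x)\<close> is negligible against \<open>ln x\<close>, so that
  \<open>ln (X x) \<sim> t ln x\<close>: in the variable \<open>ln x\<close> the curve is multiplication by \<open>t\<close>.\<close>

lemma logarithmic_tail:
  assumes f: "varies (- \<beta>) (\<lambda>y. tail \<mu> (exp y))"
  shows "((\<lambda>x. tail \<nu> x / tail \<mu> x) \<longlongrightarrow> t powr \<beta>) at_top"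
proof -
  have mono: "tail \<mu> (exp y) \<le> tail \<mu> (exp x)" if "x \<le> y" for x y
    using that by (intro \<mu>.tail_antimono) simp
  \<comment> \<open>A reparametrisation \<open>Z\<close> of the argument acts on \<open>y = ln x\<close>.\<close>
  have along: "((\<lambda>x. tail \<mu> (Z x) / tail \<mu> x) \<longlongrightarrow> \<kappa> powr (- \<beta>)) at_top"
    if \<kappa>: "0 < \<kappa>" and Z: "((\<lambda>x. ln (Z x) / ln x) \<longlongrightarrow> \<kappa>) at_top" "\<forall>\<^sub>F x in at_top. 0 < Z x" for Z \<kappa>
  proof -
    have "((\<lambda>y. ln (Z (exp y)) / ln (exp y)) \<longlongrightarrow> \<kappa>) at_top"
      by (rule filterlim_compose[OF Z(1) exp_at_top])
    then have "((\<lambda>y. ln (Z (exp y)) / y) \<longlongrightarrow> \<kappa>) at_top"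
      by simp
    from varies_comp_ratio[OF mono f this \<kappa>]
    have "((\<lambda>y. tail \<mu> (exp (ln (Z (exp y)))) / tail \<mu> (exp y)) \<longlongrightarrow> \<kappa> powr - \<beta>) at_top" .
    from filterlim_compose[OF this ln_at_top]
    have "((\<lambda>x. tail \<mu> (exp (ln (Z (exp (ln x))))) / tail \<mu> (exp (ln x))) \<longlongrightarrow> \<kappa> powr - \<beta>) at_top" .
    then show ?thesis
      by (rule Lim_transform_eventually)
        (use Z(2) eventually_gt_at_top[of 0] in \<open>eventually_elim, simp\<close>)
  qed
  have ln_inv: "((\<lambda>x. c / ln x) \<longlongrightarrow> 0) at_top" for c :: real
    by (intro tendsto_divide_0[OF tendsto_const] filterlim_at_top_imp_at_infinity ln_at_top)
  have slowly: "varies (- 0) (tail \<mu>)"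
    unfolding varies_def
  proof (intro conjI allI impI)
    show "\<forall>\<^sub>F x in at_top. 0 < tail \<mu> x"
      using eventually_compose_filterlim[OF variesD(1)[OF f] ln_at_top] eventually_gt_at_top[of 0]
      by eventually_elim simp
    fix l :: real assume l: "0 < l"
    have "((\<lambda>x. 1 + ln l / ln x) \<longlongrightarrow> 1 + 0) at_top"
      by (intro tendsto_add tendsto_const ln_inv)
    moreover have "\<forall>\<^sub>F x in at_top. 1 + ln l / ln x = ln (l * x) / ln x"
      using eventually_gt_at_top[of 1]
      by eventually_elim (use l in \<open>simp add: ln_mult field_simps\<close>)
    ultimately have "((\<lambda>x. ln (l * x) / ln x) \<longlongrightarrow> 1 + 0) at_top"
      by (rule Lim_transform_eventually)
    then have "((\<lambda>x. ln (l * x) / ln x) \<longlongrightarrow> 1) at_top"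
      by simp
    moreover have "\<forall>\<^sub>F x in at_top. 0 < l * x"
      using eventually_gt_at_top[of 0] by eventually_elim (use l in simp)
    ultimately have "((\<lambda>x. tail \<mu> (l * x) / tail \<mu> x) \<longlongrightarrow> 1 powr - \<beta>) at_top"
      by (intro along) auto
    then show "((\<lambda>x. tail \<mu> (l * x) / tail \<mu> x) \<longlongrightarrow> l powr - 0) at_top"
      using l by simp
  qed
  define C where "C = real 1 * Beta (real 1 - 0) (1 + 0)"
  have C: "0 < C" unfolding C_def by (rule \<mu>.Abelian_constant_pos) auto
  have U: "((\<lambda>x. U 1 x / tail \<mu> x) \<longlongrightarrow> C) at_top"
    unfolding C_def by (rule \<mu>.stieltjes_tail_ratio[OF slowly]) auto
  have Uv: "varies 0 (U 1)"
    using varies_of_ratio[OF slowly U C] by simp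
  have lnU: "((\<lambda>x. ln (U 1 x) / ln x) \<longlongrightarrow> 0) at_top"
    by (rule ln_ratio_tendsto_0[OF \<mu>.stieltjes_antimono Uv \<mu>.stieltjes_le_1])
  have lnU': "((\<lambda>x. ln (1 - U 1 x) / ln x) \<longlongrightarrow> 0) at_top"
    by (rule tendsto_divide_0[OF tendsto_ln[OF one_minus_stieltjes_tendsto]])
      (auto intro: filterlim_at_top_imp_at_infinity ln_at_top)
  have "((\<lambda>x. 1 + (t - 1) * (1 + ln (U 1 x) / ln x - ln (1 - U 1 x) / ln x)) \<longlongrightarrow>
      1 + (t - 1) * (1 + 0 - 0)) at_top"
    by (intro tendsto_intros lnU lnU')
  then have "((\<lambda>x. 1 + (t - 1) * (1 + ln (U 1 x) / ln x - ln (1 - U 1 x) / ln x)) \<longlongrightarrow> t) at_top"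
    by simp
  moreover have "\<forall>\<^sub>F x in at_top. 1 + (t - 1) * (1 + ln (U 1 x) / ln x - ln (1 - U 1 x) / ln x) =
      ln (X x) / ln x"
    using ln_power_curve eventually_gt_at_top[of 1]
  proof eventually_elim
    case (elim x)
    then have "ln x \<noteq> 0" by simp
    then show ?case
      unfolding elim(1) by (simp add: field_simps)
  qed
  ultimately have "((\<lambda>x. ln (X x) / ln x) \<longlongrightarrow> t) at_top"
    by (rule Lim_transform_eventually)
  moreover have "\<forall>\<^sub>F x in at_top. 0 < X x"
    using stieltjes_power_curve by eventually_elim auto
  ultimately have tX: "((\<lambda>x. tail \<mu> (X x) / tail \<mu> x) \<longlongrightarrow> t powr - \<beta>) at_top"
    using t_ge_1 by (intro along) auto
  have "((\<lambda>x. U 1 x / tail \<mu> x / (tail \<mu> (X x) / tail \<mu> x) / (U 1 (X x) / tail \<mu> (X x))) \<longlongrightarrow>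
      C / (t powr - \<beta>) / C) at_top"
    using C t_ge_1 by (intro tendsto_divide U tX filterlim_compose[OF U power_curve_at_top]) auto
  moreover have "C / (t powr - \<beta>) / C = t powr \<beta>"
    using C by (simp add: powr_minus divide_inverse)
  ultimately have "((\<lambda>x. U 1 x / tail \<mu> x / (tail \<mu> (X x) / tail \<mu> x) / (U 1 (X x) / tail \<mu> (X x))) \<longlongrightarrow>
      t powr \<beta>) at_top" by simp
  then have "((\<lambda>x. V 1 (X x) / U 1 (X x)) \<longlongrightarrow> t powr \<beta>) at_top"
    by (rule Lim_transform_eventually)
      (use variesD(1)[OF slowly] eventually_compose_filterlim[OF variesD(1)[OF slowly] power_curve_at_top]
        stieltjes_power_curve in \<open>eventually_elim, simp\<close>)
  then have "((\<lambda>x. V 1 x / U 1 x) \<longlongrightarrow> t powr \<beta>) at_top"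
    by (rule tendsto_along_power_curve)
  then show ?thesis
    using t_ge_1 by (intro tail_ratio_of_stieltjes_ratio[OF slowly]) auto
qed

lemma alpha_pow_bounds:
  assumes "0 < \<alpha>" "\<alpha> < 1"
  shows "0 < alpha_pow \<alpha> t" "alpha_pow \<alpha> t < 1" "0 < \<alpha> + t * (1 - \<alpha>)"
proof -
  have "0 < t * (1 - \<alpha>)"
    using assms t_ge_1 by simp
  then show "0 < alpha_pow \<alpha> t" "alpha_pow \<alpha> t < 1" "0 < \<alpha> + t * (1 - \<alpha>)"
    using assms by (auto simp: alpha_pow_def)
qed

text \<open>The curve varies regularly with index \<open>\<rho> = \<alpha> + t (1 - \<alpha>)\<close>, and \<open>V 1\<close> is
  \<open>U 1\<close> composed with its inverse.\<close>

lemma varies_stieltjes_power: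
  assumes U: "varies (- \<alpha>) (U 1)" and \<alpha>: "0 < \<alpha>" "\<alpha> < 1"
  shows "varies (- alpha_pow \<alpha> t) (V 1)"
  unfolding varies_def
proof (intro conjI allI impI)
  show "\<forall>\<^sub>F x in at_top. 0 < V 1 x"
    using eventually_gt_at_top[of 0] by eventually_elim (rule \<nu>.stieltjes_pos[OF atoms(2)])
  define \<rho> where "\<rho> = \<alpha> + t * (1 - \<alpha>)"
  have \<rho>: "0 < \<rho>" using alpha_pow_bounds[OF \<alpha>] by (simp add: \<rho>_def)
  have X_ratio: "((\<lambda>x. X (\<eta> * x) / X x) \<longlongrightarrow> \<eta> powr \<rho>) at_top" if \<eta>: "0 < \<eta>" for \<eta>
  proof -
    note big = filterlim_const_mult_at_top[OF \<eta>]
    have "((\<lambda>x. \<eta> * (\<eta> * (U 1 (\<eta> * x) / U 1 x) *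
        ((1 - U 1 x) / (1 - U 1 (\<eta> * x)))) powr (t - 1)) \<longlongrightarrow>
        \<eta> * (\<eta> * (\<eta> powr - \<alpha>) * (1 / 1)) powr (t - 1)) at_top"
      using \<eta>
      by (intro tendsto_intros variesD(2)[OF U] one_minus_stieltjes_tendsto
          filterlim_compose[OF one_minus_stieltjes_tendsto big]) auto
    also have "\<eta> * (\<eta> * (\<eta> powr - \<alpha>) * (1 / 1)) powr (t - 1) = \<eta> powr 1 * (\<eta> powr (1 + - \<alpha>)) powr (t - 1)"
      using \<eta> powr_add[of \<eta> 1 "- \<alpha>"] by simp
    also have "\<dots> = \<eta> powr \<rho>"
      unfolding powr_powr powr_add[symmetric] by (simp add: \<rho>_def algebra_simps)
    finally have "((\<lambda>x. \<eta> * (\<eta> * (U 1 (\<eta> * x) / U 1 x) *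
        ((1 - U 1 x) / (1 - U 1 (\<eta> * x)))) powr (t - 1)) \<longlongrightarrow> \<eta> powr \<rho>) at_top" .
    moreover have "\<forall>\<^sub>F x in at_top. \<eta> * (\<eta> * (U 1 (\<eta> * x) / U 1 x) *
        ((1 - U 1 x) / (1 - U 1 (\<eta> * x)))) powr (t - 1) = X (\<eta> * x) / X x"
      using eventually_stieltjes_bounds eventually_compose_filterlim[OF eventually_stieltjes_bounds big]
    proof eventually_elim
      case (elim x)
      have "X (\<eta> * x) / X x = \<eta> * ((\<eta> * x * U 1 (\<eta> * x) / (1 - U 1 (\<eta> * x))) powr (t - 1) /
          (x * U 1 x / (1 - U 1 x)) powr (t - 1))"
        using elim by (simp add: power_curve_def)
      also have "(\<eta> * x * U 1 (\<eta> * x) / (1 - U 1 (\<eta> * x))) powr (t - 1) /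
          (x * U 1 x / (1 - U 1 x)) powr (t - 1) =
          ((\<eta> * x * U 1 (\<eta> * x) / (1 - U 1 (\<eta> * x))) /
          (x * U 1 x / (1 - U 1 x))) powr (t - 1)"
        by (rule powr_divide[symmetric])
      also have "(\<eta> * x * U 1 (\<eta> * x) / (1 - U 1 (\<eta> * x))) /
          (x * U 1 x / (1 - U 1 x)) =
          \<eta> * (U 1 (\<eta> * x) / U 1 x) *
          ((1 - U 1 x) / (1 - U 1 (\<eta> * x)))"
        using elim by (simp add: mult_ac)
      finally show ?case by simp
    qed
    ultimately show ?thesis
      by (rule Lim_transform_eventually)
  qed
  fix l :: real assume l: "0 < l"
  define \<kappa> where "\<kappa> = l powr (1 / \<rho>)"
  have \<kappa>: "0 < \<kappa>" "\<kappa> powr \<rho> = l" "\<kappa> powr - \<alpha> = l powr - alpha_pow \<alpha> t"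
    using l \<rho> by (auto simp: \<kappa>_def powr_powr alpha_pow_def \<rho>_def)
  note V_pos = \<nu>.stieltjes_pos[OF atoms(2)]
  have lim: "((\<lambda>x. U 1 (\<eta> * x) / U 1 x) \<longlongrightarrow> \<eta> powr - \<alpha>) at_top" if "0 < \<eta>" for \<eta>
    by (rule variesD(2)[OF U that])
  have curves: "\<forall>\<^sub>F x in at_top. 1 \<le> X x \<and> 1 \<le> X (\<eta> * x) \<and> V 1 (X x) = U 1 x \<and>
      V 1 (X (\<eta> * x)) = U 1 (\<eta> * x) \<and> 0 < U 1 x" if "0 < \<eta>" for \<eta>
    using stieltjes_power_curve eventually_stieltjes_bounds
      eventually_compose_filterlim[OF stieltjes_power_curve filterlim_const_mult_at_top[OF that]]
    by eventually_elim auto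
  have "((\<lambda>x. V 1 (l * X x) / V 1 (X x)) \<longlongrightarrow> \<kappa> powr - \<alpha>) at_top"
  proof (rule tendsto_squeeze_family)
    show "at_right \<kappa> \<noteq> bot" "at_left \<kappa> \<noteq> bot"
      by simp_all
    show "((\<lambda>\<eta>. \<eta> powr - \<alpha>) \<longlongrightarrow> \<kappa> powr - \<alpha>) (at_right \<kappa>)" "((\<lambda>\<eta>. \<eta> powr - \<alpha>) \<longlongrightarrow> \<kappa> powr - \<alpha>) (at_left \<kappa>)"
      using \<kappa>(1) by (auto intro!: tendsto_intros)
    show "\<forall>\<^sub>F \<eta> in at_right \<kappa>. \<exists>g. (g \<longlongrightarrow> \<eta> powr - \<alpha>) at_top \<and>
        (\<forall>\<^sub>F x in at_top. g x \<le> V 1 (l * X x) / V 1 (X x))"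
      using eventually_at_right_less[of \<kappa>]
    proof eventually_elim
      case (elim \<eta>)
      then have \<eta>: "0 < \<eta>" using \<kappa> by simp
      have "l < \<eta> powr \<rho>"
        using elim \<kappa> \<rho> powr_less_mono2[of \<rho> \<kappa> \<eta>] by simp
      from order_tendstoD(1)[OF X_ratio[OF \<eta>] this] curves[OF \<eta>]
      have "\<forall>\<^sub>F x in at_top. U 1 (\<eta> * x) / U 1 x \<le>
          V 1 (l * X x) / V 1 (X x)"
      proof eventually_elim
        case (elim x)
        then have "V 1 (X (\<eta> * x)) \<le> V 1 (l * X x)"
          using l by (intro \<nu>.stieltjes_antimono) (auto simp: field_simps)
        with elim show ?case
          by (auto intro!: divide_right_mono)
      qed
      with lim[OF \<eta>] show ?case by blast
    qed
    show "\<forall>\<^sub>F \<eta> in at_left \<kappa>. \<exists>g. (g \<longlongrightarrow> \<eta> powr - \<alpha>) at_top \<and>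
        (\<forall>\<^sub>F x in at_top. V 1 (l * X x) / V 1 (X x) \<le> g x)"
      using eventually_at_left_real[OF \<kappa>(1)]
    proof eventually_elim
      case (elim \<eta>)
      then have \<eta>: "0 < \<eta>" by simp
      have "\<eta> powr \<rho> < l"
        using elim \<kappa> \<rho> powr_less_mono2[of \<rho> \<eta> \<kappa>] by simp
      from order_tendstoD(2)[OF X_ratio[OF \<eta>] this] curves[OF \<eta>]
      have "\<forall>\<^sub>F x in at_top. V 1 (l * X x) / V 1 (X x) \<le>
          U 1 (\<eta> * x) / U 1 x"
      proof eventually_elim
        case (elim x)
        then have "V 1 (l * X x) \<le> V 1 (X (\<eta> * x))"
          using l by (intro \<nu>.stieltjes_antimono) (auto simp: field_simps)
        with elim show ?case
          by (auto intro!: divide_right_mono)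
      qed
      with lim[OF \<eta>] show ?case by blast
    qed
  qed
  then show "((\<lambda>x. V 1 (l * x) / V 1 x) \<longlongrightarrow> l powr - alpha_pow \<alpha> t) at_top"
    unfolding \<kappa>(3) by (rule tendsto_along_power_curve)
qed

lemma tail_of_stieltjes:
  assumes tail: "varies (- \<alpha>) (tail \<mu>)" and \<alpha>: "0 < \<alpha>"
    and V: "varies (- \<alpha>') (V n)" and \<alpha>': "0 < \<alpha>'" "\<alpha>' < n"
  shows "((\<lambda>x. tail \<nu> x / V n x) \<longlongrightarrow> 1 / (n * Beta (n - \<alpha>') (1 + \<alpha>'))) at_top"
proof -
  obtain M' where "half_line_distribution M'" "varies (- \<alpha>') (tail M')"
    using \<mu>.exists_tail_index[OF tail \<alpha> \<alpha>'(1)] by blast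
  then show ?thesis
    using Tauberian_comparison[OF _ \<nu>.half_line_distribution_axioms _ V] \<alpha>' by simp
qed

lemma algebraic_tail:
  assumes tail: "varies (- \<alpha>) (tail \<mu>)" and \<alpha>: "0 < \<alpha>" "\<alpha> < 1"
  shows "regularly_varying (- alpha_pow \<alpha> t) (tail \<nu>)"
proof -
  define \<alpha>' where "\<alpha>' = alpha_pow \<alpha> t"
  have \<alpha>': "0 < \<alpha>'" "\<alpha>' < real 1" "0 \<le> \<alpha>'"
    using alpha_pow_bounds[OF \<alpha>] by (auto simp: \<alpha>'_def)
  have "varies (- \<alpha>) (U 1)"
    using \<mu>.varies_stieltjes_of_tail[OF tail, of 1] \<alpha> by simp
  from varies_stieltjes_power[OF this \<alpha>]
  have V: "varies (- \<alpha>') (V 1)"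
    by (simp add: \<alpha>'_def)
  have "0 < 1 / (real 1 * Beta (real 1 - \<alpha>') (1 + \<alpha>'))"
    using \<nu>.Abelian_constant_pos[OF \<alpha>'(3,2)] by simp
  from varies_of_ratio[OF V tail_of_stieltjes[OF tail \<alpha>(1) V \<alpha>'(1,2)] this]
  have T: "varies (- \<alpha>') (tail \<nu>)" .
  then obtain a where "\<And>x. a \<le> x \<Longrightarrow> 0 < tail \<nu> x"
    by (auto simp: varies_def eventually_at_top_linorder)
  then have "\<forall>x>a. 0 < tail \<nu> x"
    by auto
  moreover have "tail \<nu> \<in> borel_measurable (restrict_space borel {a<..})"
    by (intro measurable_restrict_space1 \<nu>.tail_measurable)
  ultimately show ?thesis
    using T unfolding regularly_varying_def varies_def \<alpha>'_def by blast
qed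

text \<open>With \<open>\<rho> = \<alpha> + t (1 - \<alpha>)\<close> and \<open>\<alpha>' = \<alpha> / \<rho>\<close>, the quantity \<open>V 1 (X x) X x powr \<alpha>'\<close> is the power
  \<open>t / \<rho>\<close> of \<open>U 1 x x powr \<alpha>\<close>, up to a factor tending to \<open>1\<close>, because \<open>\<rho> + (t - 1) \<alpha> = t\<close>.\<close>

lemma pure_power_tail:
  assumes tail: "tail \<mu> \<sim>[at_top] (\<lambda>x. c / x powr \<alpha>)" and \<alpha>: "0 < \<alpha>" "\<alpha> < 1" and c: "0 < c"
  shows "tail \<nu> \<sim>[at_top] (\<lambda>x. c_pow c \<alpha> t / x powr alpha_pow \<alpha> t)"
proof -
  define \<rho> where "\<rho> = \<alpha> + t * (1 - \<alpha>)"
  define \<alpha>' where "\<alpha>' = alpha_pow \<alpha> t"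
  have \<alpha>': "0 < \<alpha>'" "\<alpha>' < real 1" "\<alpha>' = \<alpha> / \<rho>" and \<rho>: "0 < \<rho>"
    using alpha_pow_bounds[OF \<alpha>] by (auto simp: \<alpha>'_def \<rho>_def alpha_pow_def)
  have g: "varies (- \<alpha>) (\<lambda>x. c / x powr \<alpha>)"
    using varies_powr_mult[OF varies_const[OF c], of "- \<alpha>"] by (simp add: powr_minus divide_inverse mult.commute)
  note tailv = varies_of_asymp_equiv[OF tail g]
  define K where "K = pi * \<alpha> / sin (pi * \<alpha>)"
  define K' where "K' = pi * \<alpha>' / sin (pi * \<alpha>')"
  have K: "real 1 * Beta (real 1 - \<alpha>) (1 + \<alpha>) = K" "real 1 * Beta (real 1 - \<alpha>') (1 + \<alpha>') = K'"
    using Beta_reflection[OF \<alpha>] Beta_reflection[of \<alpha>'] \<alpha>' by (auto simp: K_def K'_def)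
  have Kpos: "0 < K" "0 < K'"
    using \<mu>.Abelian_constant_pos[of \<alpha> 1] \<mu>.Abelian_constant_pos[of \<alpha>' 1] \<alpha> \<alpha>' K by auto
  have "((\<lambda>x. U 1 x / tail \<mu> x * (tail \<mu> x / (c / x powr \<alpha>)) * c) \<longlongrightarrow> K * 1 * c) at_top"
    using \<mu>.stieltjes_tail_ratio[OF tailv, of 1] \<alpha> ratio_of_asymp_equiv[OF tail variesD(1)[OF g]]
    unfolding K by (intro tendsto_mult tendsto_const) auto
  then have "((\<lambda>x. U 1 x * x powr \<alpha>) \<longlongrightarrow> K * 1 * c) at_top"
    by (rule Lim_transform_eventually)
      (use variesD(1)[OF tailv] eventually_gt_at_top[of 0] in \<open>eventually_elim, use c in simp\<close>)
  then have U: "((\<lambda>x. U 1 x * x powr \<alpha>) \<longlongrightarrow> c * K) at_top"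
    by (simp add: mult.commute)
  have "((\<lambda>x. (U 1 x * x powr \<alpha>) powr (t / \<rho>) * (1 - U 1 x) powr ((1 - t) * \<alpha>')) \<longlongrightarrow>
      (c * K) powr (t / \<rho>) * 1 powr ((1 - t) * \<alpha>')) at_top"
    using c Kpos by (intro tendsto_intros U one_minus_stieltjes_tendsto) auto
  then have "((\<lambda>x. (U 1 x * x powr \<alpha>) powr (t / \<rho>) * (1 - U 1 x) powr ((1 - t) * \<alpha>')) \<longlongrightarrow>
      (c * K) powr (t / \<rho>)) at_top"
    by simp
  moreover have "\<forall>\<^sub>F x in at_top. (U 1 x * x powr \<alpha>) powr (t / \<rho>) *
      (1 - U 1 x) powr ((1 - t) * \<alpha>') = V 1 (X x) * X x powr \<alpha>'"
    using ln_power_curve stieltjes_power_curve eventually_stieltjes_bounds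
  proof eventually_elim
    case (elim x)
    define u where "u = U 1 x"
    have u: "0 < u" "u < 1" "0 < x" "0 < X x"
      using elim by (auto simp: u_def)
    have lnX: "ln (X x) = ln x + (t - 1) * (ln x + ln u - ln (1 - u))"
      using elim by (simp add: u_def)
    have e: "1 + (t - 1) * \<alpha>' = t / \<rho>" "t * \<alpha>' = \<alpha> * (t / \<rho>)"
      using \<rho> unfolding \<alpha>'(3) by (auto simp: field_simps \<rho>_def)
    have "ln (u * X x powr \<alpha>') = ln u + \<alpha>' * (ln x + (t - 1) * (ln x + ln u - ln (1 - u)))"
      using u by (simp add: ln_mult ln_powr lnX)
    also have "\<dots> = (1 + (t - 1) * \<alpha>') * ln u + (t * \<alpha>') * ln x + (1 - t) * \<alpha>' * ln (1 - u)"
      by (simp add: algebra_simps)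
    also have "\<dots> = ln ((u * x powr \<alpha>) powr (t / \<rho>) * (1 - u) powr ((1 - t) * \<alpha>'))"
      unfolding e using u by (simp add: ln_mult ln_powr algebra_simps)
    finally have "u * X x powr \<alpha>' = (u * x powr \<alpha>) powr (t / \<rho>) * (1 - u) powr ((1 - t) * \<alpha>')"
      using u by (subst (asm) ln_inj_iff) auto
    then show ?case
      using elim by (simp add: u_def)
  qed
  ultimately have "((\<lambda>x. V 1 (X x) * X x powr \<alpha>') \<longlongrightarrow> (c * K) powr (t / \<rho>)) at_top"
    by (rule Lim_transform_eventually)
  then have V: "((\<lambda>x. V 1 x * x powr \<alpha>') \<longlongrightarrow> (c * K) powr (t / \<rho>)) at_top"
    by (rule tendsto_along_power_curve)
  have Uv: "varies (- \<alpha>) (U 1)"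
    using \<mu>.varies_stieltjes_of_tail[OF tailv, of 1] \<alpha> by simp
  have Vv: "varies (- \<alpha>') (V 1)"
    unfolding \<alpha>'_def by (rule varies_stieltjes_power[OF Uv \<alpha>])
  have "((\<lambda>x. tail \<nu> x / V 1 x * (V 1 x * x powr \<alpha>')) \<longlongrightarrow> 1 / K' * (c * K) powr (t / \<rho>)) at_top"
    using tail_of_stieltjes[OF tailv \<alpha>(1) Vv \<alpha>'(1,2)] V unfolding K by (rule tendsto_mult)
  moreover have "1 / K' * (c * K) powr (t / \<rho>) = c_pow c \<alpha> t"
    by (simp add: c_pow_def K_def K'_def \<rho>_def \<alpha>'_def)
  ultimately have lim: "((\<lambda>x. tail \<nu> x / V 1 x * (V 1 x * x powr \<alpha>')) \<longlongrightarrow> c_pow c \<alpha> t) at_top"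
    by simp
  then have "((\<lambda>x. tail \<nu> x / x powr - \<alpha>') \<longlongrightarrow> c_pow c \<alpha> t) at_top"
    by (rule Lim_transform_eventually)
      (use variesD(1)[OF Vv] in \<open>eventually_elim, simp add: powr_minus divide_inverse\<close>)
  moreover have "c_pow c \<alpha> t \<noteq> 0"
    using Kpos c \<open>1 / K' * (c * K) powr (t / \<rho>) = c_pow c \<alpha> t\<close>[symmetric] by simp
  ultimately have "tail \<nu> \<sim>[at_top] (\<lambda>x. c_pow c \<alpha> t * x powr - \<alpha>')"
    by (rule asymp_equivI'_const)
  then show ?thesis
    by (simp add: \<alpha>'_def powr_minus divide_inverse)
qed

lemma mean_ratio_at_right_0:
  assumes "((\<lambda>x. x * U 2 x / (x * U 1 x)) \<longlongrightarrow> 0) at_top"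
  shows "((\<lambda>s. s * kernel_moment \<mu> 2 s / kernel_moment \<mu> 1 s) \<longlongrightarrow> 0) (at_right 0)"
  unfolding filterlim_at_right_to_top
  using assms
  by (rule Lim_transform_eventually)
    (use eventually_gt_at_top[of 0] in
      \<open>eventually_elim, simp add: kernel_moment_eq power2_eq_square\<close>)

text \<open>Here the truncated mean \<open>x U 1 x\<close> has derivative \<open>U 2 x \<sim> c / x\<close>.\<close>

lemma truncated_mean_log:
  assumes U2: "((\<lambda>x. x * U 2 x) \<longlongrightarrow> c) at_top"
  shows "((\<lambda>x. x * U 1 x / ln x) \<longlongrightarrow> c) at_top"
proof (rule lhospital_at_top_at_top[where f' = "U 2" and g' = "\<lambda>x. 1 / x"])
  show "filterlim ln at_top (at_top :: real filter)" by (rule ln_at_top)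
  show "\<forall>\<^sub>F x in at_top. 1 / x \<noteq> (0::real)"
    using eventually_gt_at_top[of 0] by eventually_elim simp
  show "\<forall>\<^sub>F x in at_top. (ln has_real_derivative 1 / x) (at x)"
    using eventually_gt_at_top[of 0] by eventually_elim (auto intro!: derivative_eq_intros)
  show "\<forall>\<^sub>F x in at_top. ((\<lambda>x. x * U 1 x) has_real_derivative U 2 x) (at x)"
    using eventually_gt_at_top[of 0]
  proof eventually_elim
    case (elim x)
    have "((\<lambda>x. kernel_moment \<mu> 1 (inverse x)) has_real_derivative
        (- real 1 * kernel_moment \<mu> (Suc 1) (inverse x)) * (- (inverse x ^ Suc (Suc 0)))) (at x)"
      using elim by (intro DERIV_chain2[OF \<mu>.DERIV_kernel_moment] DERIV_inverse) auto
    also have "(- real 1 * kernel_moment \<mu> (Suc 1) (inverse x)) * (- (inverse x ^ Suc (Suc 0))) =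
        U 2 x"
      using elim kernel_moment_eq[OF elim, of \<mu> 2]
      by (simp add: numeral_2_eq_2 field_simps)
    finally show ?case
      by (rule has_field_derivative_transform_within_open[where S = "{0<..}"])
        (use elim kernel_moment_eq[of _ \<mu> 1] in auto)
  qed
  show "((\<lambda>x. U 2 x / (1 / x)) \<longlongrightarrow> c) at_top"
    using U2 by (simp add: mult.commute)
qed

text \<open>The index is \<open>1\<close> and the mean is infinite.  Here \<open>X x \<sim> x (c ln x) powr (t - 1)\<close> and
  \<open>ln (X x) \<sim> ln x\<close>, so the curve replaces \<open>U 2 x \<sim> c / x\<close> by a multiple of \<open>ln x powr (t - 1) / x\<close>.\<close>

lemma inverse_linear_tail:
  assumes tail: "tail \<mu> \<sim>[at_top] (\<lambda>x. c / x)" and c: "0 < c"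
  shows "((\<lambda>x. tail \<nu> x / (ln x powr (t - 1) * tail \<mu> x)) \<longlongrightarrow> c powr (t - 1) * t) at_top"
proof -
  have g: "varies (- 1) (\<lambda>x. c / x)"
  proof (rule varies_of_ratio[where c = 1])
    show "varies (- 1) (\<lambda>x. x powr - 1 * c)"
      using varies_powr_mult[OF varies_const[OF c], of "- 1"] by (simp only: add_0_right)
    show "((\<lambda>x. c / x / (x powr - 1 * c)) \<longlongrightarrow> 1) at_top"
      by (rule tendsto_eventually)
        (use eventually_gt_at_top[of 0] in \<open>eventually_elim, use c in \<open>simp add: powr_minus_divide\<close>\<close>)
  qed simp
  note tailv = varies_of_asymp_equiv[OF tail g]
  have C: "real 2 * Beta (real 2 - 1) (1 + 1) = 1"
    by (simp add: Beta_def Gamma_numeral fact_numeral)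
  have xtail: "((\<lambda>x. x * tail \<mu> x) \<longlongrightarrow> c) at_top"
  proof -
    have "((\<lambda>x. tail \<mu> x / (c / x) * c) \<longlongrightarrow> 1 * c) at_top"
      by (intro tendsto_intros ratio_of_asymp_equiv[OF tail variesD(1)[OF g]])
    then show ?thesis
      using c by (simp add: mult.commute)
  qed
  have U2: "((\<lambda>x. x * U 2 x) \<longlongrightarrow> c) at_top"
  proof -
    have "((\<lambda>x. U 2 x / tail \<mu> x * (x * tail \<mu> x)) \<longlongrightarrow> 1 * c) at_top"
      using \<mu>.stieltjes_tail_ratio[OF tailv, of 2] xtail unfolding C by (intro tendsto_mult) auto
    then have "((\<lambda>x. x * U 2 x) \<longlongrightarrow> 1 * c) at_top"
      by (rule Lim_transform_eventually) (use variesD(1)[OF tailv] in \<open>eventually_elim, simp\<close>)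
    then show ?thesis by simp
  qed
  define k where "k = (\<lambda>x. x * U 1 x / (1 - U 1 x))"
  have k: "((\<lambda>x. k x / ln x) \<longlongrightarrow> c) at_top"
    using tendsto_divide[OF truncated_mean_log[OF U2] one_minus_stieltjes_tendsto]
    by (simp add: k_def mult.commute)
  have kpos: "\<forall>\<^sub>F x in at_top. 0 < k x"
    using eventually_stieltjes_bounds by eventually_elim (simp add: k_def)
  have ln_inv: "((\<lambda>x. 1 / ln x) \<longlongrightarrow> 0) (at_top :: real filter)"
    by (intro tendsto_divide_0[OF tendsto_const] filterlim_at_top_imp_at_infinity ln_at_top)
  have ln_k: "((\<lambda>x. ln (k x) / ln x) \<longlongrightarrow> 0) at_top"
  proof -
    have "((\<lambda>x. ln (k x / ln x) * (1 / ln x) + ln (ln x) / ln x) \<longlongrightarrow> ln c * 0 + 0) at_top"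
      using c by (intro tendsto_intros k ln_inv filterlim_compose[OF ln_x_over_x_tendsto_0 ln_at_top]) auto
    then have "((\<lambda>x. ln (k x / ln x) * (1 / ln x) + ln (ln x) / ln x) \<longlongrightarrow> 0) at_top"
      by simp
    then show ?thesis
      by (rule Lim_transform_eventually)
        (use kpos eventually_gt_at_top[of 1] in \<open>eventually_elim, simp add: ln_div field_simps\<close>)
  qed
  have X_eq: "X x = x * k x powr (t - 1)" for x
    by (simp add: power_curve_def k_def)
  have ln_X: "((\<lambda>x. ln (X x) / ln x) \<longlongrightarrow> 1) at_top"
  proof -
    have "((\<lambda>x. 1 + (t - 1) * (ln (k x) / ln x)) \<longlongrightarrow> 1 + (t - 1) * 0) at_top"
      by (intro tendsto_intros ln_k)
    then have "((\<lambda>x. 1 + (t - 1) * (ln (k x) / ln x)) \<longlongrightarrow> 1) at_top"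
      by simp
    then show ?thesis
      by (rule Lim_transform_eventually)
        (use kpos eventually_gt_at_top[of 1] in \<open>eventually_elim, simp add: X_eq ln_mult ln_powr field_simps\<close>)
  qed
  have mean: "((\<lambda>x. x * U 2 x / (x * U 1 x)) \<longlongrightarrow> 0) at_top"
  proof -
    have "((\<lambda>x. x * U 2 x / (x * U 1 x / ln x) * (1 / ln x)) \<longlongrightarrow> c / c * 0) at_top"
      using c by (intro tendsto_intros U2 truncated_mean_log[OF U2] ln_inv) auto
    then have "((\<lambda>x. x * U 2 x / (x * U 1 x / ln x) * (1 / ln x)) \<longlongrightarrow> 0) at_top"
      by simp
    then show ?thesis
      by (rule Lim_transform_eventually)
        (use eventually_gt_at_top[of 1] in \<open>eventually_elim, simp\<close>)
  qed
  have ratio: "((\<lambda>x. V 2 (X x) / U 2 x) \<longlongrightarrow> t) at_top"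
    using stieltjes_power_ratio[of 1 0] \<mu>.varies_stieltjes_of_tail[OF tailv, of 2]
      mean_ratio_at_right_0[OF mean] by (simp add: numeral_2_eq_2)
  have U2pos: "\<forall>\<^sub>F x in at_top. 0 < U 2 x"
    using eventually_gt_at_top[of 0] by eventually_elim (rule \<mu>.stieltjes_pos[OF atoms(1)])
  have "((\<lambda>x. V 2 (X x) / U 2 x * (x * U 2 x) *
      (k x / ln x / (ln (X x) / ln x)) powr (t - 1)) \<longlongrightarrow> t * c * (c / 1) powr (t - 1)) at_top"
    using c by (intro tendsto_intros ratio U2 k ln_X) auto
  moreover have "\<forall>\<^sub>F x in at_top. V 2 (X x) / U 2 x * (x * U 2 x) *
      (k x / ln x / (ln (X x) / ln x)) powr (t - 1) =
      V 2 (X x) / (ln (X x) powr (t - 1) / X x)"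
    using U2pos kpos eventually_gt_at_top[of 1]
      order_tendstoD(1)[OF ln_X zero_less_one]
  proof eventually_elim
    case (elim x)
    then have "0 < ln x" "0 < ln (X x)"
      by (auto simp: zero_less_divide_iff)
    then have "k x / ln x / (ln (X x) / ln x) = k x / ln (X x)"
      by simp
    then show ?case
      using elim by (simp add: X_eq powr_divide)
  qed
  ultimately have "((\<lambda>x. V 2 (X x) / (ln (X x) powr (t - 1) / X x)) \<longlongrightarrow> t * c * c powr (t - 1)) at_top"
    using Lim_transform_eventually by fastforce
  then have V2: "((\<lambda>x. V 2 x / (ln x powr (t - 1) / x)) \<longlongrightarrow> t * c * c powr (t - 1)) at_top"
    by (rule tendsto_along_power_curve)
  have log_varies: "varies (- 1) (\<lambda>x. ln x powr (t - 1) / x)"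
    unfolding varies_def
  proof (intro conjI allI impI)
    show "\<forall>\<^sub>F x in at_top. 0 < ln x powr (t - 1) / x"
      using eventually_gt_at_top[of 1] by eventually_elim simp
    fix l :: real assume l: "0 < l"
    have "((\<lambda>x. (1 + ln l * (1 / ln x)) powr (t - 1) / l) \<longlongrightarrow> (1 + ln l * 0) powr (t - 1) / l) at_top"
      using l by (intro tendsto_intros ln_inv) auto
    moreover have "\<forall>\<^sub>F x in at_top. (1 + ln l * (1 / ln x)) powr (t - 1) / l =
        ln (l * x) powr (t - 1) / (l * x) / (ln x powr (t - 1) / x)"
      using eventually_gt_at_top[of 1]
    proof eventually_elim
      case (elim x)
      then have "1 + ln l * (1 / ln x) = ln (l * x) / ln x"
        using l by (simp add: ln_mult field_simps)
      then show ?case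
        using elim by (simp add: powr_divide)
    qed
    ultimately have "((\<lambda>x. ln (l * x) powr (t - 1) / (l * x) / (ln x powr (t - 1) / x)) \<longlongrightarrow>
        (1 + ln l * 0) powr (t - 1) / l) at_top"
      by (rule Lim_transform_eventually)
    then show "((\<lambda>x. ln (l * x) powr (t - 1) / (l * x) / (ln x powr (t - 1) / x)) \<longlongrightarrow> l powr - 1) at_top"
      using l by (simp add: powr_minus_divide)
  qed
  have Vv: "varies (- 1) (V 2)"
    by (rule varies_of_ratio[OF log_varies V2]) (use c t_ge_1 in simp)
  have T: "((\<lambda>x. tail \<nu> x / V 2 x) \<longlongrightarrow> 1 / 1) at_top"
    using Tauberian_comparison[OF \<mu>.half_line_distribution_axioms \<nu>.half_line_distribution_axioms tailv Vv]
    unfolding C by simp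
  have "((\<lambda>x. tail \<nu> x / V 2 x * (V 2 x / (ln x powr (t - 1) / x)) / (x * tail \<mu> x)) \<longlongrightarrow>
      1 / 1 * (t * c * c powr (t - 1)) / c) at_top"
    using c by (intro tendsto_divide tendsto_mult T V2 xtail) auto
  moreover have "1 / 1 * (t * c * c powr (t - 1)) / c = c powr (t - 1) * t"
    using c by simp
  moreover have "\<forall>\<^sub>F x in at_top. tail \<nu> x / V 2 x * (V 2 x / (ln x powr (t - 1) / x)) / (x * tail \<mu> x) =
      tail \<nu> x / (ln x powr (t - 1) * tail \<mu> x)"
    using variesD(1)[OF Vv] eventually_gt_at_top[of 1] by eventually_elim simp
  ultimately show ?thesis
    using Lim_transform_eventually by fastforce
qed

lemma truncated_mean_tendsto:
  assumes "integrable \<mu> (\<lambda>s. s)"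
  shows "((\<lambda>x. x * U 1 x) \<longlongrightarrow> first_moment \<mu>) at_top"
    and "((\<lambda>x. x * U 2 x) \<longlongrightarrow> 0) at_top"
proof -
  define k where "k = (\<lambda>j (x::real) (t::real). max 0 t * (max 1 x / (max 0 t + max 1 x)) * (max 0 t / (max 0 t + max 1 x)) ^ j)"
  have *: "((\<lambda>x. LINT t|\<mu>. k j x t) \<longlongrightarrow> (LINT t|\<mu>. max 0 t * 0 ^ j)) at_top" for j
  proof (rule integral_dominated_convergence_at_top[where w = "\<lambda>t. \<bar>t\<bar>"])
    show "integrable \<mu> (\<lambda>t. \<bar>t\<bar>)" using assms by simp
    have "((\<lambda>x. t / (t + x)) \<longlongrightarrow> 0) at_top" if "0 \<le> t" for t :: real
      by (intro tendsto_divide_0[OF tendsto_const] filterlim_at_top_imp_at_infinity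
          filterlim_tendsto_add_at_top[OF tendsto_const] filterlim_ident)
    then have small: "((\<lambda>x. max 0 t / (max 0 t + x)) \<longlongrightarrow> 0) at_top" for t :: real
      by simp
    have "((\<lambda>x. k j x t) \<longlongrightarrow> max 0 t * (1 - 0) * 0 ^ j) at_top" for t
    proof -
      have "((\<lambda>x. max 0 t * (1 - max 0 t / (max 0 t + x)) * (max 0 t / (max 0 t + x)) ^ j) \<longlongrightarrow>
          max 0 t * (1 - 0) * 0 ^ j) at_top"
        by (intro tendsto_intros small)
      then show ?thesis
        by (rule Lim_transform_eventually)
          (use eventually_ge_at_top[of 1] in \<open>eventually_elim, simp add: k_def field_simps add_nonneg_pos less_imp_neq[symmetric]\<close>)
    qed
    then show "AE t in \<mu>. ((\<lambda>x. k j x t) \<longlongrightarrow> max 0 t * 0 ^ j) at_top"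
      by simp
    show "\<forall>\<^sub>F x in at_top. AE t in \<mu>. norm (k j x t) \<le> \<bar>t\<bar>"
    proof (intro always_eventually allI AE_I2)
      fix x t :: real
      have "max 1 x / (max 0 t + max 1 x) \<le> 1" "max 0 t / (max 0 t + max 1 x) \<le> 1"
        by auto
      then have "max 0 t * (max 1 x / (max 0 t + max 1 x)) * (max 0 t / (max 0 t + max 1 x)) ^ j \<le> \<bar>t\<bar> * 1 * 1"
        by (intro mult_mono power_le_one) auto
      then show "norm (k j x t) \<le> \<bar>t\<bar>"
        by (simp add: k_def abs_mult)
    qed
  qed (auto simp: k_def)
  have k_eq: "\<forall>\<^sub>F x in at_top. (LINT t|\<mu>. k j x t) = x * U (Suc j) x" for j
    using eventually_ge_at_top[of 1]
  proof eventually_elim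
    case (elim x)
    have "(LINT t|\<mu>. k j x t) = (LINT t|\<mu>. x * (t / (t + x)) ^ Suc j)"
      by (rule integral_cong_AE) (use \<mu>.AE_nonneg elim in \<open>auto simp: k_def elim!: eventually_mono\<close>)
    then show ?case
      by (simp add: stieltjes_def del: power_Suc)
  qed
  have "(LINT t|\<mu>. max 0 t * 0 ^ 0) = first_moment \<mu>"
    unfolding first_moment_def
    by (rule integral_cong_AE) (use \<mu>.AE_nonneg in \<open>auto elim!: eventually_mono\<close>)
  then show "((\<lambda>x. x * U 1 x) \<longlongrightarrow> first_moment \<mu>) at_top"
    using Lim_transform_eventually[OF *[of 0] k_eq[of 0]] by simp
  show "((\<lambda>x. x * U 2 x) \<longlongrightarrow> 0) at_top"
    using Lim_transform_eventually[OF *[of 1] k_eq[of 1]] by (simp add: numeral_2_eq_2)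
qed

lemma first_moment_pos:
  assumes "integrable \<mu> (\<lambda>s. s)"
  shows "0 < first_moment \<mu>"
proof -
  have "U 1 1 \<le> first_moment \<mu>"
    unfolding stieltjes_def first_moment_def
  proof (rule integral_mono_AE[OF \<mu>.kernel_integrable assms])
    show "AE t in \<mu>. (t / (t + 1)) ^ 1 \<le> t"
      using \<mu>.AE_nonneg by eventually_elim (simp add: divide_le_eq mult_le_cancel_left1)
  qed simp
  then show ?thesis
    using \<mu>.stieltjes_pos[OF atoms(1), of 1 1] by simp
qed

text \<open>With mean \<open>m\<close>, the curve is asymptotic to \<open>m powr (t - 1) x\<close>.  The factor \<open>t\<close> comes from the
  derivatives, and the power of \<open>m\<close> from moving the argument from \<open>X x\<close> back to \<open>x\<close>.\<close>

lemma finite_mean_tail: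
  assumes tail: "varies (- \<alpha>) (tail \<mu>)" and \<alpha>: "1 \<le> \<alpha>" and int: "integrable \<mu> (\<lambda>s. s)"
  shows "((\<lambda>x. tail \<nu> x / tail \<mu> x) \<longlongrightarrow> t * first_moment \<mu> powr (\<alpha> * (t - 1))) at_top"
proof -
  define m where "m = first_moment \<mu>"
  have m: "0 < m" unfolding m_def by (rule first_moment_pos[OF int])
  note K = truncated_mean_tendsto[OF int, folded m_def]
  define n where "n = nat (\<lfloor>\<alpha>\<rfloor> - 1)"
  have n: "real n + 1 \<le> \<alpha>" "\<alpha> < real n + 2" "0 \<le> \<alpha>" "\<alpha> < real (n + 2)"
    using \<alpha> by (auto simp: n_def of_nat_nat) linarith+
  note U = \<mu>.varies_stieltjes_of_tail[OF tail n(3,4)]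
  have "((\<lambda>x. x * U 2 x / (x * U 1 x)) \<longlongrightarrow> 0 / m) at_top"
    using m by (intro tendsto_divide K) auto
  then have mean: "((\<lambda>x. x * U 2 x / (x * U 1 x)) \<longlongrightarrow> 0) at_top"
    by simp
  have ratio: "((\<lambda>x. V (n + 2) (X x) / U (n + 2) x) \<longlongrightarrow> t) at_top"
    by (rule stieltjes_power_ratio[OF U n(1,2) mean_ratio_at_right_0[OF mean]])
  have "((\<lambda>x. (x * U 1 x / (1 - U 1 x)) powr (t - 1)) \<longlongrightarrow> (m / 1) powr (t - 1)) at_top"
    using m by (intro tendsto_intros K one_minus_stieltjes_tendsto) auto
  then have "((\<lambda>x. X x / x) \<longlongrightarrow> (m / 1) powr (t - 1)) at_top"
    by (rule Lim_transform_eventually)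
      (use eventually_gt_at_top[of 0] in \<open>eventually_elim, simp add: power_curve_def\<close>)
  then have "((\<lambda>x. X x / x) \<longlongrightarrow> m powr (t - 1)) at_top"
    by simp
  from varies_comp_ratio[OF \<mu>.stieltjes_antimono U this]
  have UX: "((\<lambda>x. U (n + 2) (X x) / U (n + 2) x) \<longlongrightarrow> (m powr (t - 1)) powr - \<alpha>) at_top"
    using m by simp
  have "((\<lambda>x. V (n + 2) (X x) / U (n + 2) x /
      (U (n + 2) (X x) / U (n + 2) x)) \<longlongrightarrow> t / (m powr (t - 1)) powr - \<alpha>) at_top"
    using m by (intro tendsto_divide ratio UX) auto
  moreover have "t / (m powr (t - 1)) powr - \<alpha> = t * m powr (\<alpha> * (t - 1))"
    by (simp add: powr_powr powr_minus divide_inverse mult.commute)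
  ultimately have "((\<lambda>x. V (n + 2) (X x) / U (n + 2) x /
      (U (n + 2) (X x) / U (n + 2) x)) \<longlongrightarrow> t * m powr (\<alpha> * (t - 1))) at_top"
    by simp
  then have "((\<lambda>x. V (n + 2) (X x) / U (n + 2) (X x)) \<longlongrightarrow> t * m powr (\<alpha> * (t - 1))) at_top"
    by (rule Lim_transform_eventually) (use variesD(1)[OF U] in \<open>eventually_elim, simp\<close>)
  then have "((\<lambda>x. V (n + 2) x / U (n + 2) x) \<longlongrightarrow> t * m powr (\<alpha> * (t - 1))) at_top"
    by (rule tendsto_along_power_curve)
  then show ?thesis
    unfolding m_def[symmetric] using m t_ge_1
    by (intro tail_ratio_of_stieltjes_ratio[OF tail n(3,4)]) auto
qed

end

theorem theorem1p3:
  fixes \<mu> :: "real measure"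
  assumes "\<mu> \<in> M_plus"
  shows
    "(\<forall>L \<beta>. regularly_varying 0 L \<and> \<beta> > 0 \<and>
        tail \<mu> \<sim>[at_top] (\<lambda>x. L (ln x) / ln x powr \<beta>) \<longrightarrow>
        (\<forall>t\<ge>1. \<forall>\<nu>. is_free_mult_power \<mu> t \<nu> \<longrightarrow>
           tail \<nu> \<sim>[at_top] (\<lambda>x. t powr \<beta> * tail \<mu> x)))
   \<and> (\<forall>L \<alpha>. 0 < \<alpha> \<and> \<alpha> < 1 \<and> regularly_varying 0 L \<and>
        tail \<mu> \<sim>[at_top] (\<lambda>x. x powr (- \<alpha>) * L x) \<longrightarrow>
        (\<forall>t\<ge>1. \<forall>\<nu>. is_free_mult_power \<mu> t \<nu> \<longrightarrow>
           regularly_varying (- alpha_pow \<alpha> t) (tail \<nu>)))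
   \<and> (\<forall>c \<alpha>. 0 < \<alpha> \<and> \<alpha> < 1 \<and> c > 0 \<and>
        tail \<mu> \<sim>[at_top] (\<lambda>x. c / x powr \<alpha>) \<longrightarrow>
        (\<forall>t\<ge>1. \<forall>\<nu>. is_free_mult_power \<mu> t \<nu> \<longrightarrow>
           tail \<nu> \<sim>[at_top] (\<lambda>x. c_pow c \<alpha> t / x powr alpha_pow \<alpha> t)))
   \<and> (\<forall>c. c > 0 \<and> tail \<mu> \<sim>[at_top] (\<lambda>x. c / x) \<longrightarrow>
        (\<forall>t\<ge>1. \<forall>\<nu>. is_free_mult_power \<mu> t \<nu> \<longrightarrow>
           tail \<nu> \<sim>[at_top] (\<lambda>x. c powr (t - 1) * t * ln x powr (t - 1) * tail \<mu> x)))
   \<and> (\<forall>L \<alpha>. \<alpha> \<ge> 1 \<and> regularly_varying 0 L \<and>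
        tail \<mu> \<sim>[at_top] (\<lambda>x. x powr (- \<alpha>) * L x) \<and> integrable \<mu> (\<lambda>s. s) \<longrightarrow>
        (\<forall>t\<ge>1. \<forall>\<nu>. is_free_mult_power \<mu> t \<nu> \<longrightarrow>
           tail \<nu> \<sim>[at_top] (\<lambda>x. t * first_moment \<mu> powr (\<alpha> * (t - 1)) * tail \<mu> x)))"
proof (intro conjI allI impI; elim conjE)
  fix L \<beta> t \<nu>
  assume L: "regularly_varying 0 L"
    and tail: "tail \<mu> \<sim>[at_top] (\<lambda>x. L (ln x) / ln x powr \<beta>)"
    and t: "1 \<le> t" "is_free_mult_power \<mu> t \<nu>"
  interpret free_power \<mu> \<nu> t
    using assms t by unfold_locales
  have g: "varies (- \<beta>) (\<lambda>y. y powr - \<beta> * L y)"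
    using varies_powr_mult[OF regularly_varying_imp_varies[OF L], of "- \<beta>"] by simp
  have "(\<lambda>y. tail \<mu> (exp y)) \<sim>[at_top] (\<lambda>y. L (ln (exp y)) / ln (exp y) powr \<beta>)"
    by (rule asymp_equiv_compose'[OF tail exp_at_top])
  then have "(\<lambda>y. tail \<mu> (exp y)) \<sim>[at_top] (\<lambda>y. y powr - \<beta> * L y)"
    by (simp add: powr_minus divide_inverse mult.commute)
  from logarithmic_tail[OF varies_of_asymp_equiv[OF this g]]
  show "tail \<nu> \<sim>[at_top] (\<lambda>x. t powr \<beta> * tail \<mu> x)"
    using t by (intro asymp_equivI'_const) auto
next
  fix L \<alpha> t \<nu>
  assume \<alpha>: "0 < \<alpha>" "\<alpha> < 1" and L: "regularly_varying 0 L"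
    and tail: "tail \<mu> \<sim>[at_top] (\<lambda>x. x powr - \<alpha> * L x)"
    and t: "1 \<le> t" "is_free_mult_power \<mu> t \<nu>"
  interpret free_power \<mu> \<nu> t
    using assms t by unfold_locales
  have "varies (- \<alpha>) (\<lambda>x. x powr - \<alpha> * L x)"
    using varies_powr_mult[OF regularly_varying_imp_varies[OF L], of "- \<alpha>"] by simp
  from algebraic_tail[OF varies_of_asymp_equiv[OF tail this] \<alpha>]
  show "regularly_varying (- alpha_pow \<alpha> t) (tail \<nu>)" .
next
  fix c \<alpha> t \<nu>
  assume \<alpha>: "0 < \<alpha>" "\<alpha> < 1" "0 < c" and tail: "tail \<mu> \<sim>[at_top] (\<lambda>x. c / x powr \<alpha>)"
    and t: "1 \<le> t" "is_free_mult_power \<mu> t \<nu>"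
  interpret free_power \<mu> \<nu> t
    using assms t by unfold_locales
  show "tail \<nu> \<sim>[at_top] (\<lambda>x. c_pow c \<alpha> t / x powr alpha_pow \<alpha> t)"
    by (rule pure_power_tail[OF tail \<alpha>])
next
  fix c t \<nu>
  assume c: "0 < c" and tail: "tail \<mu> \<sim>[at_top] (\<lambda>x. c / x)"
    and t: "1 \<le> t" "is_free_mult_power \<mu> t \<nu>"
  interpret free_power \<mu> \<nu> t
    using assms t by unfold_locales
  have "tail \<nu> \<sim>[at_top] (\<lambda>x. c powr (t - 1) * t * (ln x powr (t - 1) * tail \<mu> x))"
    using inverse_linear_tail[OF tail c] c t by (intro asymp_equivI'_const) auto
  then show "tail \<nu> \<sim>[at_top] (\<lambda>x. c powr (t - 1) * t * ln x powr (t - 1) * tail \<mu> x)"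
    by (simp add: mult.assoc)
next
  fix L \<alpha> t \<nu>
  assume \<alpha>: "1 \<le> \<alpha>" and L: "regularly_varying 0 L"
    and tail: "tail \<mu> \<sim>[at_top] (\<lambda>x. x powr - \<alpha> * L x)" and int: "integrable \<mu> (\<lambda>s. s)"
    and t: "1 \<le> t" "is_free_mult_power \<mu> t \<nu>"
  interpret free_power \<mu> \<nu> t
    using assms t by unfold_locales
  have "varies (- \<alpha>) (\<lambda>x. x powr - \<alpha> * L x)"
    using varies_powr_mult[OF regularly_varying_imp_varies[OF L], of "- \<alpha>"] by simp
  from finite_mean_tail[OF varies_of_asymp_equiv[OF tail this] \<alpha> int]
  show "tail \<nu> \<sim>[at_top] (\<lambda>x. t * first_moment \<mu> powr (\<alpha> * (t - 1)) * tail \<mu> x)"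
    using first_moment_pos[OF int] t by (intro asymp_equivI'_const) auto
qed

end
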